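(* Let $K$ be a Killing tensor on $S^3$ with diagonal algebraic curvature tensor $$R_{0\alpha0\alpha}=w_\alpha+t_\alpha+\tfrac{s}{12},\qquad R_{\beta\gamma\beta\gamma}=w_\alpha-t_\alpha+\tfrac{s}{12},\qquad w_1+w_2+w_3=0,$$ where $(\alpha,\beta,\gamma)$ runs over the cyclic permutations of $(1,2,3)$. Then $K$ is integrable if and only if the associated matrix $$\begin{pmatrix}\Delta_1&-t_3&t_2\\ t_3&\Delta_2&-t_1\\ -t_2&t_1&\Delta_3\end{pmatrix},\qquad \Delta_1=w_2-w_3,\ \Delta_2=w_3-w_1,\ \Delta_3=w_1-w_2,$$ has zero trace and zero determinant. This defines a projective variety in $\mathbb P^4$ which carries a natural $S_4$-action, given by conjugating the matrix with the symmetries of the regular octahedron in $\mathbb R^3$ with vertices $\pm e_i$ and adjacent faces oppositely oriented. Two diagonal algebraic curvature tensors are equivalent under the isometry group if and only if their associated matrices are equivalent under this $S_4$-action.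
   Context: Let $(V,g)$ be a $4$-dimensional Euclidean vector space and $S^3=\{x\in V: g(x,x)=1\}$ with the induced round metric; its isometry group is $\mathrm{O}(V,g)$. A Killing tensor is a symmetric tensor field $K_{\alpha\beta}$ with $\nabla_{(\gamma}K_{\alpha\beta)}=0$ ($\nabla$ the Levi-Civita connection, round brackets denoting complete symmetrisation); it is also regarded as a field of symmetric endomorphisms via the metric. It is integrable if around any point of some open and dense set there are local coordinates whose coordinate vectors are eigenvectors of $K$. An algebraic curvature tensor on $V$ is a tensor $R_{a_1b_1a_2b_2}$ with the algebraic symmetries of a Riemannian curvature tensor. Killing tensors on $S^3$ are in linear, $\mathrm{O}(V,g)$-equivariant bijection with algebraic curvature tensors on $V$ via $K_x(v,w)=R_{a_1b_1a_2b_2}x^{a_1}x^{a_2}v^{b_1}w^{b_2}$ for $x\in S^3$, $v,w\in T_xS^3$. Fix an orthonormal basis $e_0,e_1,e_2,e_3$ of $V$. $R$ is diagonal if $R_{ijkl}=0$ unless $\{i,j\}=\{k,l\}$; every diagonal algebraic curvature tensor is of the form given in the claim. Here the $w_\alpha$ are the eigenvalues of the self-dual Weyl part (the same as those of the anti-self-dual Weyl part), the $t_\alpha$ parametrise the eigenvalues of the trace-free Ricci tensor, and $s$ is the scalar curvature. The ambient $\mathbb P^4$ is the projectivisation of the $5$-dimensional real vector space of trace-free $3\times3$ matrices of the form $\begin{pmatrix}\Delta_1&-t_3&t_2\\ t_3&\Delta_2&-t_1\\ -t_2&t_1&\Delta_3\end{pmatrix}$. The octahedral symmetry group in question is the subgroup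 $S_4\subset\mathrm{SO}(3)$ of signed permutation matrices of determinant $1$; the $e_i$ in "vertices $\pm e_i$" denote the standard basis vectors of $\mathbb R^3$.
   Formalization: The last claim fails literally (the matrix forgets s; odd permutations give −PMP⁻¹). Proved instead: equivalence up to scale and constant curvature iff the points of P⁴ are S₄-equivalent; and R, R' are isometric iff s = s' and M' = sgn(P)PMP⁻¹ for some P in S₄. *)

theory Defs
  imports "HOL-Analysis.Analysis" "HOL-Algebra.Sym_Groups" "HOL-Algebra.Group_Action"
begin

section \<open>Smooth functions\<close>

text \<open>On an open subset of a Euclidean space, \<open>Ck_on k S f\<close> says that \<open>f\<close> is \<open>k\<close> times
  continuously differentiable.\<close>

primrec Ck_on ::
    "nat \<Rightarrow> 'a::real_normed_vector set \<Rightarrow> ('a \<Rightarrow> 'b::real_normed_vector) \<Rightarrow> bool" where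
  "Ck_on 0 S f \<longleftrightarrow> continuous_on S f"
| "Ck_on (Suc k) S f \<longleftrightarrow>
     (\<forall>x\<in>S. f differentiable at x) \<and> (\<forall>v. Ck_on k S (\<lambda>x. frechet_derivative f (at x) v))"

definition smooth_on :: "'a::real_normed_vector set \<Rightarrow> ('a \<Rightarrow> 'b::real_normed_vector) \<Rightarrow> bool" where
  "smooth_on S f \<longleftrightarrow> (\<forall>k. Ck_on k S f)"

section \<open>The round sphere\<close>

text \<open>The ambient Euclidean space is a type \<open>'a\<close> of class \<open>euclidean_space\<close>; dimension 4 is
  assumed in the theorem.  Functions and tensor fields on the unit sphere are total functions of
  which only the values at points of the sphere (and at tangent vectors there) matter.  A function
  \<open>f\<close> on the sphere is differentiated through its extension \<open>\<lambda>y. f (sgn y)\<close>, where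
  \<open>sgn y = y / norm y\<close>, to the complement of the origin.\<close>

abbreviation unit_sphere :: "'a::euclidean_space set" where
  "unit_sphere \<equiv> sphere 0 1"

definition tangent_space :: "'a::euclidean_space \<Rightarrow> 'a set" where
  "tangent_space x = {v. x \<bullet> v = 0}"

definition smooth_on_sphere :: "('a::euclidean_space \<Rightarrow> 'b::real_normed_vector) \<Rightarrow> bool" where
  "smooth_on_sphere f \<longleftrightarrow> smooth_on (- {0}) (\<lambda>y. f (sgn y))"

definition sphere_deriv ::
    "('a::euclidean_space \<Rightarrow> 'b::real_normed_vector) \<Rightarrow> 'a \<Rightarrow> 'a \<Rightarrow> 'b" where
  "sphere_deriv f x v = frechet_derivative (\<lambda>y. f (sgn y)) (at x) v"

definition vector_field :: "('a::euclidean_space \<Rightarrow> 'a) \<Rightarrow> bool" where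
  "vector_field X \<longleftrightarrow> (\<forall>x\<in>unit_sphere. X x \<in> tangent_space x) \<and> smooth_on_sphere X"

text \<open>The Levi-Civita connection of the induced metric is the tangential projection of the flat
  derivative of the ambient space.\<close>

definition levi_civita :: "('a::euclidean_space \<Rightarrow> 'a) \<Rightarrow> ('a \<Rightarrow> 'a) \<Rightarrow> 'a \<Rightarrow> 'a" where
  "levi_civita X Y x =
     sphere_deriv Y x (X x) - (x \<bullet> sphere_deriv Y x (X x)) *\<^sub>R x"

section \<open>Killing tensors and integrability\<close>

type_synonym 'a tensor_field2 = "'a \<Rightarrow> 'a \<Rightarrow> 'a \<Rightarrow> real"

definition symmetric_tensor_field :: "('a::euclidean_space) tensor_field2 \<Rightarrow> bool" where
  "symmetric_tensor_field K \<longleftrightarrow>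
     (\<forall>x\<in>unit_sphere. \<forall>u\<in>tangent_space x. \<forall>v\<in>tangent_space x. K x u v = K x v u) \<and>
     (\<forall>x\<in>unit_sphere. \<forall>u\<in>tangent_space x. \<forall>v\<in>tangent_space x. \<forall>w\<in>tangent_space x. \<forall>a b.
        K x (a *\<^sub>R u + b *\<^sub>R v) w = a * K x u w + b * K x v w) \<and>
     (\<forall>X Y. vector_field X \<and> vector_field Y \<longrightarrow> smooth_on_sphere (\<lambda>x. K x (X x) (Y x)))"

definition cov_deriv ::
    "('a::euclidean_space) tensor_field2 \<Rightarrow> ('a \<Rightarrow> 'a) \<Rightarrow> ('a \<Rightarrow> 'a) \<Rightarrow> ('a \<Rightarrow> 'a) \<Rightarrow> 'a \<Rightarrow> real" where
  "cov_deriv K X Y Z x =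
     sphere_deriv (\<lambda>y. K y (Y y) (Z y)) x (X x)
     - K x (levi_civita X Y x) (Z x) - K x (Y x) (levi_civita X Z x)"

text \<open>As \<open>K\<close> is symmetric, the complete symmetrisation of its covariant derivative is, up to a
  factor, the cyclic sum.\<close>

definition killing_tensor :: "('a::euclidean_space) tensor_field2 \<Rightarrow> bool" where
  "killing_tensor K \<longleftrightarrow> symmetric_tensor_field K \<and>
     (\<forall>X Y Z. vector_field X \<and> vector_field Y \<and> vector_field Z \<longrightarrow>
        (\<forall>x\<in>unit_sphere. cov_deriv K X Y Z x + cov_deriv K Y Z X x + cov_deriv K Z X Y x = 0))"

text \<open>The eigenvalue equation \<open>K v = l v\<close> of the endomorphism obtained from \<open>K\<close> by raising an
  index, written with the index lowered again.\<close>

definition eigenvector_at :: "('a::euclidean_space) tensor_field2 \<Rightarrow> 'a \<Rightarrow> 'a \<Rightarrow> bool" where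
  "eigenvector_at K x v \<longleftrightarrow> v \<in> tangent_space x \<and> v \<noteq> 0 \<and>
     (\<exists>l. \<forall>w\<in>tangent_space x. K x v w = l * (v \<bullet> w))"

text \<open>Local coordinates on the (three-dimensional) sphere are given by the inverse \<open>\<psi>\<close> of the
  chart, and the coordinate vectors are the partial derivatives of \<open>\<psi>\<close>.\<close>

definition coordinate_parametrisation :: "(real^3) set \<Rightarrow> (real^3 \<Rightarrow> 'a::euclidean_space) \<Rightarrow> bool" where
  "coordinate_parametrisation D \<psi> \<longleftrightarrow>
     open D \<and> smooth_on D \<psi> \<and> inj_on \<psi> D \<and>
     (\<forall>u\<in>D. inj (frechet_derivative \<psi> (at u))) \<and>
     openin (top_of_set unit_sphere) (\<psi> ` D)"

definition coordinate_vector :: "(real^3 \<Rightarrow> 'a::euclidean_space) \<Rightarrow> real^3 \<Rightarrow> 3 \<Rightarrow> 'a" where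
  "coordinate_vector \<psi> u i = frechet_derivative \<psi> (at u) (axis i 1)"

definition integrable_tensor :: "('a::euclidean_space) tensor_field2 \<Rightarrow> bool" where
  "integrable_tensor K \<longleftrightarrow>
     (\<exists>U. openin (top_of_set unit_sphere) U \<and> unit_sphere \<subseteq> closure U \<and>
       (\<forall>x\<in>U. \<exists>D \<psi>. coordinate_parametrisation D \<psi> \<and> x \<in> \<psi> ` D \<and>
          (\<forall>u\<in>D. \<forall>i. eigenvector_at K (\<psi> u) (coordinate_vector \<psi> u i))))"

section \<open>Algebraic curvature tensors\<close>

type_synonym 'a tensor4 = "'a \<Rightarrow> 'a \<Rightarrow> 'a \<Rightarrow> 'a \<Rightarrow> real"

definition algebraic_curvature_tensor :: "('a::euclidean_space) tensor4 \<Rightarrow> bool" where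
  "algebraic_curvature_tensor R \<longleftrightarrow>
     (\<forall>b c d. linear (\<lambda>a. R a b c d)) \<and> (\<forall>a c d. linear (\<lambda>b. R a b c d)) \<and>
     (\<forall>a b d. linear (\<lambda>c. R a b c d)) \<and> (\<forall>a b c. linear (\<lambda>d. R a b c d)) \<and>
     (\<forall>a b c d. R b a c d = - R a b c d) \<and>
     (\<forall>a b c d. R a b d c = - R a b c d) \<and>
     (\<forall>a b c d. R c d a b = R a b c d) \<and>
     (\<forall>a b c d. R a b c d + R a c d b + R a d b c = 0)"

definition corresponds :: "('a::euclidean_space) tensor_field2 \<Rightarrow> 'a tensor4 \<Rightarrow> bool" where
  "corresponds K R \<longleftrightarrow>
     (\<forall>x\<in>unit_sphere. \<forall>v\<in>tangent_space x. \<forall>w\<in>tangent_space x. K x v w = R x v x w)"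

definition diagonal_tensor :: "(nat \<Rightarrow> 'a::euclidean_space) \<Rightarrow> 'a tensor4 \<Rightarrow> bool" where
  "diagonal_tensor e R \<longleftrightarrow>
     (\<forall>i<4. \<forall>j<4. \<forall>k<4. \<forall>l<4. {i, j} \<noteq> {k, l} \<longrightarrow> R (e i) (e j) (e k) (e l) = 0)"

definition diagonal_curvature_tensor ::
    "(nat \<Rightarrow> 'a::euclidean_space) \<Rightarrow> 'a tensor4 \<Rightarrow> real^3 \<Rightarrow> real^3 \<Rightarrow> real \<Rightarrow> bool" where
  "diagonal_curvature_tensor e R w t s \<longleftrightarrow>
     algebraic_curvature_tensor R \<and> diagonal_tensor e R \<and>
     R (e 0) (e 1) (e 0) (e 1) = w$1 + t$1 + s/12 \<and>
     R (e 0) (e 2) (e 0) (e 2) = w$2 + t$2 + s/12 \<and>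
     R (e 0) (e 3) (e 0) (e 3) = w$3 + t$3 + s/12 \<and>
     R (e 2) (e 3) (e 2) (e 3) = w$1 - t$1 + s/12 \<and>
     R (e 3) (e 1) (e 3) (e 1) = w$2 - t$2 + s/12 \<and>
     R (e 1) (e 2) (e 1) (e 2) = w$3 - t$3 + s/12 \<and>
     w$1 + w$2 + w$3 = 0"

definition pullback_tensor :: "('a::euclidean_space \<Rightarrow> 'a) \<Rightarrow> 'a tensor4 \<Rightarrow> 'a tensor4" where
  "pullback_tensor \<phi> R = (\<lambda>a b c d. R (\<phi> a) (\<phi> b) (\<phi> c) (\<phi> d))"

definition isometric_tensors :: "('a::euclidean_space) tensor4 \<Rightarrow> 'a tensor4 \<Rightarrow> bool" where
  "isometric_tensors R R' \<longleftrightarrow> (\<exists>\<phi>. orthogonal_transformation \<phi> \<and> R' = pullback_tensor \<phi> R)"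

definition constant_curvature_tensor :: "('a::euclidean_space) tensor4" where
  "constant_curvature_tensor = (\<lambda>a b c d. (a \<bullet> c) * (b \<bullet> d) - (a \<bullet> d) * (b \<bullet> c))"

text \<open>Passing from \<open>R\<close> to the point of the projective space of matrices forgets the scalar curvature
  and the scale.  Accordingly, this is equivalence under isometries of classes of curvature tensors
  modulo constant curvature tensors and up to a non-zero factor; in terms of Killing tensors,
  modulo multiples of the metric and up to a non-zero factor.\<close>

definition projectively_isometric_tensors ::
    "('a::euclidean_space) tensor4 \<Rightarrow> 'a tensor4 \<Rightarrow> bool" where
  "projectively_isometric_tensors R R' \<longleftrightarrow>
     (\<exists>\<phi> c m. orthogonal_transformation \<phi> \<and> c \<noteq> 0 \<and>
       R' = (\<lambda>x y z u. c * pullback_tensor \<phi> R x y z u + m * constant_curvature_tensor x y z u))"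

section \<open>The associated matrices and their projective space\<close>

definition matrix_form :: "real^3 \<Rightarrow> real^3 \<Rightarrow> real^3^3" where
  "matrix_form \<Delta> t = vector
     [vector [\<Delta>$1, - (t$3), t$2],
      vector [t$3, \<Delta>$2, - (t$1)],
      vector [- (t$2), t$1, \<Delta>$3]]"

definition assoc_matrix :: "real^3 \<Rightarrow> real^3 \<Rightarrow> real^3^3" where
  "assoc_matrix w t = matrix_form (vector [w$2 - w$3, w$3 - w$1, w$1 - w$2]) t"

definition matrix_space :: "(real^3^3) set" where
  "matrix_space = {M. trace M = 0 \<and> (\<exists>\<Delta> t. M = matrix_form \<Delta> t)}"

text \<open>Points of a projectivisation are the lines through the origin.\<close>

definition projectivisation :: "'a::real_vector set \<Rightarrow> 'a set set" where
  "projectivisation W = {span {M} |M. M \<in> W \<and> M \<noteq> 0}"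

definition homogeneous_polynomial :: "nat \<Rightarrow> ('a::real_normed_vector \<Rightarrow> real) \<Rightarrow> bool" where
  "homogeneous_polynomial d f \<longleftrightarrow>
     real_polynomial_function f \<and> (\<forall>c x. f (c *\<^sub>R x) = c ^ d * f x)"

text \<open>Projective varieties are not required to be irreducible.\<close>

definition projective_variety :: "'a::real_normed_vector set \<Rightarrow> 'a set set \<Rightarrow> bool" where
  "projective_variety W V \<longleftrightarrow>
     (\<exists>F. finite F \<and> (\<forall>f\<in>F. \<exists>d. homogeneous_polynomial d f) \<and>
       V = {p \<in> projectivisation W. \<forall>f\<in>F. \<forall>M\<in>p. f M = 0})"

definition integrable_variety :: "(real^3^3) set set" where
  "integrable_variety = {p \<in> projectivisation matrix_space. \<forall>M\<in>p. trace M = 0 \<and> det M = 0}"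

section \<open>The octahedral group\<close>

definition signed_permutation_matrix :: "real^3^3 \<Rightarrow> bool" where
  "signed_permutation_matrix P \<longleftrightarrow>
     (\<exists>\<sigma> \<epsilon>. \<sigma> permutes UNIV \<and> (\<forall>j. \<epsilon> j = 1 \<or> \<epsilon> j = -1) \<and>
       P = (\<chi> i j. if i = \<sigma> j then \<epsilon> j else 0))"

definition octahedral_group :: "(real^3^3) monoid" where
  "octahedral_group =
     \<lparr> carrier = {P. signed_permutation_matrix P \<and> det P = 1}, mult = (**), one = mat 1 \<rparr>"

definition conj_matrix :: "real^3^3 \<Rightarrow> real^3^3 \<Rightarrow> real^3^3" where
  "conj_matrix P M = P ** M ** matrix_inv P"

definition conj_point :: "real^3^3 \<Rightarrow> (real^3^3) set \<Rightarrow> (real^3^3) set" where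
  "conj_point P p = conj_matrix P ` p"

text \<open>The sign of the underlying permutation of a signed permutation matrix.\<close>

definition perm_sign :: "real^3^3 \<Rightarrow> real" where
  "perm_sign P = det (\<chi> i j. \<bar>P $ i $ j\<bar>)"

end

(*
  Write k_ij for the sectional curvatures R(e_i,e_j,e_i,e_j) and K_x(v) for the endomorphism defined by
  a diagonal R.

  Necessity.  If X_1, X_2, X_3 are coordinate vectors with K X_a = l_a X_a, differentiating this
  equation and using that partial derivatives commute shows that the alternating sum of
  (nabla_{K u} K)(v, K w) vanishes on (X_1,X_2,X_3), whatever the multiplicities of the l_a.  Evaluated
  on (e_1,e_2,e_3) it is a non-zero constant times x_0^2 x_1 x_2 x_3 det M.

  Sufficiency.  det M = 0 says that, up to adding a constant to all k_ij, either
  k_ij = b (a_k + a_l) + c a_k a_l for {i,j,k,l} = {0,1,2,3}, or k_0j = 0 for all j up to renumbering.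
  According to the coincidences among the parameters, K is diagonalised by elliptic, oblate or prolate,
  toroidal, conical or spherical coordinates.  In all of them x_i^2 is a product of affine functions of
  one coordinate each, so no inverse function theorem is needed.

  Equivalence.  Both sides amount to a permutation of the pairs (w_a, t_a) with an even number of sign
  changes of the t_a.  For an isometry, the squared entries of its second compound matrix form a doubly
  stochastic matrix that vanishes unless the eigenvalues of R and of its Ricci part agree; hence these
  occur with the same multiplicities.
*)
theory Submission
  imports Defs
begin

section \<open>Calculus of continuously differentiable functions\<close>

text \<open>Adding a constant to all k_ij adds a multiple of the metric to K, so eigenvectors do not
  change. det M = 0 says that the points (k_01 + k_23, k_01 k_23), (k_02 + k_13, k_02 k_13), (k_03 +
  k_12, k_03 k_12) are collinear; if their line has a slope, subtracting it from all k_ij makes the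
  three products of opposite values equal, and the normal forms are read off from that. The obstacle
  to necessity is that integrability supplies eigenvectors only: eigenvalues may coincide,
  coordinate vectors with equal eigenvalues need not be orthogonal, and the eigenvalues are not
  given as differentiable functions. Hence the eigenvalue equation is differentiated in
  cross-multiplied form, and a combination is taken in which coincident eigenvalues cancel. In the
  equivalence, \<open>perm_sign\<close> arises because an odd permutation of the w_a reverses all
  differences \<Delta>_a. Conjugation therefore matches the data only up to this sign, which is
  invisible in projective space. The scalar curvature, absent from the matrix, is compared
  separately.\<close>

lemma Ck_on_cong:
  assumes "open S" "\<And>x. x \<in> S \<Longrightarrow> f x = g x" "Ck_on k S f"
  shows "Ck_on k S g"
  using assms(2,3)
proof (induction k arbitrary: f g)
  case 0
  then show ?case by (simp cong: continuous_on_cong)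
next
  case (Suc k)
  have D: "(g has_derivative frechet_derivative f (at x)) (at x)" if "x \<in> S" for x
  proof (rule has_derivative_transform_within_open[OF _ \<open>open S\<close> that])
    show "(f has_derivative frechet_derivative f (at x)) (at x)"
      using Suc.prems(2) that frechet_derivative_works by auto
  qed (use Suc.prems(1) in auto)
  have eq: "frechet_derivative g (at x) = frechet_derivative f (at x)" if "x \<in> S" for x
    using frechet_derivative_at[OF D[OF that]] by simp
  have "Ck_on k S (\<lambda>x. frechet_derivative g (at x) v)" for v
    by (rule Suc.IH[of "\<lambda>x. frechet_derivative f (at x) v"]) (use eq Suc.prems(2) in auto)
  then show ?case using D by (auto intro: differentiableI)
qed

lemma Ck_on_continuous: "Ck_on k S f \<Longrightarrow> continuous_on S f"
  by (cases k) (auto intro!: continuous_at_imp_continuous_on differentiable_imp_continuous_within)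

text \<open>\<open>frechet_derivative\<close> is a choice, but a derivative at a point is unique; so
  explicit derivative formulas may be used in the inductions below.\<close>

lemma Ck_on_SucI:
  assumes "open S" "\<And>x. x \<in> S \<Longrightarrow> (f has_derivative f' x) (at x)" "\<And>v. Ck_on k S (\<lambda>x. f' x v)"
  shows "Ck_on (Suc k) S f"
proof -
  have eq: "frechet_derivative f (at x) = f' x" if "x \<in> S" for x
    using frechet_derivative_at[OF assms(2)[OF that]] by simp
  have "Ck_on k S (\<lambda>x. frechet_derivative f (at x) v)" for v
    by (rule Ck_on_cong[OF \<open>open S\<close> _ assms(3)[of v]]) (simp add: eq)
  then show ?thesis using assms(2) by (auto intro: differentiableI)
qed

lemma Ck_on_SucD:
  assumes "Ck_on (Suc k) S f"
  shows "x \<in> S \<Longrightarrow> (f has_derivative frechet_derivative f (at x)) (at x)"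
    and "Ck_on k S (\<lambda>x. frechet_derivative f (at x) v)"
  using assms frechet_derivative_works by auto

lemma Ck_on_Suc_mono: "Ck_on (Suc k) S f \<Longrightarrow> Ck_on k S f"
proof (induction k arbitrary: f)
  case 0
  then show ?case using Ck_on_continuous[of "Suc 0"] by (simp only: Ck_on.simps(1))
next
  case (Suc k)
  then show ?case by (metis Ck_on.simps(2))
qed

lemma Ck_on_const: "open S \<Longrightarrow> Ck_on k S (\<lambda>x. c)"
proof (induction k arbitrary: c)
  case (Suc k)
  show ?case by (rule Ck_on_SucI[where f' = "\<lambda>x v. 0"]) (use Suc in auto)
qed auto

lemma Ck_on_bounded_linear:
  assumes "open S" "bounded_linear f" shows "Ck_on k S f"
proof (cases k)
  case 0
  then show ?thesis using assms by (simp add: linear_continuous_on)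
next
  case (Suc k)
  show ?thesis unfolding Suc
    by (rule Ck_on_SucI[where f' = "\<lambda>x. f"])
       (use assms in \<open>auto intro!: Ck_on_const bounded_linear_imp_has_derivative\<close>)
qed

lemma Ck_on_bounded_linear_compose:
  assumes "open S" "bounded_linear h" "Ck_on k S f"
  shows "Ck_on k S (\<lambda>x. h (f x))"
  using assms(3)
proof (induction k arbitrary: f)
  case 0
  then show ?case using assms(2) by (simp add: bounded_linear.continuous_on)
next
  case (Suc k)
  show ?case
    by (rule Ck_on_SucI[where f' = "\<lambda>x v. h (frechet_derivative f (at x) v)", OF \<open>open S\<close>])
       (rule bounded_linear.has_derivative[OF assms(2)] Ck_on_SucD(1)[OF Suc.prems]
          Suc.IH Ck_on_SucD(2)[OF Suc.prems] | assumption)+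
qed

lemma Ck_on_add:
  assumes "open S" "Ck_on k S f" "Ck_on k S g"
  shows "Ck_on k S (\<lambda>x. f x + g x)"
  using assms(2,3)
proof (induction k arbitrary: f g)
  case 0
  then show ?case by (simp add: continuous_on_add)
next
  case (Suc k)
  show ?case
    by (rule Ck_on_SucI[where f' = "\<lambda>x v. frechet_derivative f (at x) v + frechet_derivative g (at x) v", OF \<open>open S\<close>])
       (rule has_derivative_add Suc.prems[THEN Ck_on_SucD(1)] Suc.IH Suc.prems[THEN Ck_on_SucD(2)] | assumption)+
qed

lemma Ck_on_sum:
  assumes "open S" "\<And>i. i \<in> I \<Longrightarrow> Ck_on k S (f i)"
  shows "Ck_on k S (\<lambda>x. \<Sum>i\<in>I. f i x)"
  using assms(2) by (induction I rule: infinite_finite_induct) (auto intro!: Ck_on_const Ck_on_add assms(1))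

text \<open>Each term of the product rule is again \<open>h\<close> of one factor and the derivative
  of the other, so the induction closes with both factors generalised; the undifferentiated factor
  is lowered from order \<open>Suc k\<close> to \<open>k\<close>.\<close>

lemma Ck_on_bilinear:
  assumes "open S" "bounded_bilinear h" "Ck_on k S f" "Ck_on k S g"
  shows "Ck_on k S (\<lambda>x. h (f x) (g x))"
  using assms(3,4)
proof (induction k arbitrary: f g)
  case 0
  then show ?case using assms(2) by (simp add: bounded_bilinear.continuous_on)
next
  case (Suc k)
  show ?case
  proof (rule Ck_on_SucI[where f' = "\<lambda>x v. h (f x) (frechet_derivative g (at x) v) + h (frechet_derivative f (at x) v) (g x)", OF \<open>open S\<close>])
    show "((\<lambda>x. h (f x) (g x)) has_derivative
        (\<lambda>v. h (f x) (frechet_derivative g (at x) v) + h (frechet_derivative f (at x) v) (g x))) (at x)"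
      if "x \<in> S" for x
      using that Suc.prems by (intro bounded_bilinear.FDERIV[OF assms(2)] Ck_on_SucD(1))
    show "Ck_on k S (\<lambda>x. h (f x) (frechet_derivative g (at x) v) + h (frechet_derivative f (at x) v) (g x))" for v
      by (intro Ck_on_add Suc.IH \<open>open S\<close> Suc.prems[THEN Ck_on_SucD(2)] Suc.prems[THEN Ck_on_Suc_mono])
  qed
qed

lemmas Ck_on_mult = Ck_on_bilinear[OF _ bounded_bilinear_mult]
lemmas Ck_on_scaleR = Ck_on_bilinear[OF _ bounded_bilinear_scaleR]

lemma Ck_on_prod:
  fixes f :: "'i \<Rightarrow> 'a::real_normed_vector \<Rightarrow> real"
  assumes "open S" "\<And>i. i \<in> I \<Longrightarrow> Ck_on k S (f i)"
  shows "Ck_on k S (\<lambda>x. \<Prod>i\<in>I. f i x)"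
  using assms(2) by (induction I rule: infinite_finite_induct) (auto intro!: Ck_on_const Ck_on_mult assms(1))

text \<open>The derivative of 1/f contains 1/f again, but only to one order less, so the induction
  hypothesis for the same \<open>f\<close> suffices.\<close>

lemma Ck_on_inverse:
  fixes f :: "'a::real_normed_vector \<Rightarrow> real"
  assumes "open S" "Ck_on k S f" "\<And>x. x \<in> S \<Longrightarrow> f x \<noteq> 0"
  shows "Ck_on k S (\<lambda>x. inverse (f x))"
  using assms(2)
proof (induction k)
  case 0
  then show ?case using assms(3) by (auto intro: continuous_on_inverse)
next
  case (Suc k)
  show ?case
  proof (rule Ck_on_SucI[where f' = "\<lambda>x v. (-1) * (inverse (f x) * frechet_derivative f (at x) v * inverse (f x))", OF \<open>open S\<close>])
    show "((\<lambda>x. inverse (f x)) has_derivative (\<lambda>v. (-1) * (inverse (f x) * frechet_derivative f (at x) v * inverse (f x)))) (at x)"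
      if "x \<in> S" for x
      using Deriv.has_derivative_inverse[OF assms(3)[OF that] Ck_on_SucD(1)[OF Suc.prems that]] by simp
    show "Ck_on k S (\<lambda>x. (-1) * (inverse (f x) * frechet_derivative f (at x) v * inverse (f x)))" for v
      by (intro Ck_on_mult Ck_on_const Suc.IH \<open>open S\<close> Suc.prems[THEN Ck_on_SucD(2)] Suc.prems[THEN Ck_on_Suc_mono])
  qed
qed

lemma Ck_on_sqrt:
  fixes f :: "'a::real_normed_vector \<Rightarrow> real"
  assumes "open S" "Ck_on k S f" "\<And>x. x \<in> S \<Longrightarrow> 0 < f x"
  shows "Ck_on k S (\<lambda>x. sqrt (f x))"
  using assms(2)
proof (induction k)
  case 0
  then show ?case by (auto intro: continuous_on_real_sqrt)
next
  case (Suc k)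
  show ?case
  proof (rule Ck_on_SucI[where f' = "\<lambda>x v. frechet_derivative f (at x) v * (inverse (sqrt (f x)) * (1/2))", OF \<open>open S\<close>])
    show "((\<lambda>x. sqrt (f x)) has_derivative (\<lambda>v. frechet_derivative f (at x) v * (inverse (sqrt (f x)) * (1/2)))) (at x)"
      if "x \<in> S" for x
      using has_derivative_real_sqrt[OF assms(3)[OF that] Ck_on_SucD(1)[OF Suc.prems that]]
      by (simp add: field_simps)
    have "sqrt (f x) \<noteq> 0" if "x \<in> S" for x using assms(3)[OF that] by simp
    then show "Ck_on k S (\<lambda>x. frechet_derivative f (at x) v * (inverse (sqrt (f x)) * (1/2)))" for v
      by (intro Ck_on_mult Ck_on_const Ck_on_inverse Suc.IH \<open>open S\<close> Suc.prems[THEN Ck_on_SucD(2)] Suc.prems[THEN Ck_on_Suc_mono])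
  qed
qed

section \<open>Symmetry of second derivatives\<close>

lemma frechet_derivative_line:
  assumes "f differentiable at (x + s *\<^sub>R a)"
  shows "((\<lambda>s. f (x + s *\<^sub>R a)) has_vector_derivative frechet_derivative f (at (x + s *\<^sub>R a)) a) (at s)"
proof -
  have "(f has_derivative frechet_derivative f (at (x + s *\<^sub>R a))) (at (x + s *\<^sub>R a))"
    using assms frechet_derivative_works by blast
  then have "((\<lambda>s. f (x + s *\<^sub>R a)) has_derivative (\<lambda>h. frechet_derivative f (at (x + s *\<^sub>R a)) (h *\<^sub>R a))) (at s)"
    by (rule has_derivative_compose[rotated]) (auto intro!: derivative_eq_intros)
  moreover have "linear (frechet_derivative f (at (x + s *\<^sub>R a)))"
    using assms linear_frechet_derivative by blast
  ultimately show ?thesis by (simp add: has_vector_derivative_def linear_scale)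
qed

text \<open>Mean value theorem twice: along \<open>a\<close> for the increment of \<open>f\<close>
  in direction \<open>b\<close>, then along \<open>b\<close> for the derivative of \<open>f\<close>
  in direction \<open>a\<close>. The second difference is symmetric in \<open>a\<close> and
  \<open>b\<close>, so it links the two orders of differentiation.\<close>

lemma second_difference_mean_value:
  fixes f :: "'a::real_normed_vector \<Rightarrow> real"
  assumes S: "\<And>s t. \<lbrakk>0 \<le> s; s \<le> h; 0 \<le> t; t \<le> h\<rbrakk> \<Longrightarrow> x + s *\<^sub>R a + t *\<^sub>R b \<in> S"
    and f: "Ck_on 2 S f" and "0 < h"
  obtains s t where "0 < s" "s < h" "0 < t" "t < h"
    "f (x + h *\<^sub>R a + h *\<^sub>R b) - f (x + h *\<^sub>R a) - f (x + h *\<^sub>R b) + f x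
      = h\<^sup>2 * frechet_derivative (\<lambda>y. frechet_derivative f (at y) a) (at (x + s *\<^sub>R a + t *\<^sub>R b)) b"
proof -
  define fa where "fa = (\<lambda>y. frechet_derivative f (at y) a)"
  have df: "f differentiable at y" and dfa: "fa differentiable at y" if "y \<in> S" for y
    using f that unfolding fa_def by (auto simp: numeral_2_eq_2)
  have line: "x + s *\<^sub>R a \<in> S" "(x + s *\<^sub>R a) + t *\<^sub>R b \<in> S" "(x + t *\<^sub>R b) + s *\<^sub>R a \<in> S"
    if "0 \<le> s" "s \<le> h" "0 \<le> t" "t \<le> h" for s t
    using S[of s 0] S[of s t] that \<open>0 < h\<close> by (auto simp: algebra_simps)
  define g where "g = (\<lambda>s. f ((x + h *\<^sub>R b) + s *\<^sub>R a) - f (x + s *\<^sub>R a))"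
  have g': "(g has_real_derivative fa ((x + h *\<^sub>R b) + s *\<^sub>R a) - fa (x + s *\<^sub>R a)) (at s)"
    if "0 \<le> s" "s \<le> h" for s
    unfolding g_def fa_def has_real_derivative_iff_has_vector_derivative
    using line[of s h] that \<open>0 < h\<close>
    by (intro has_vector_derivative_diff frechet_derivative_line df) simp_all
  obtain s where s: "0 < s" "s < h" "g h - g 0 = (h - 0) * (fa ((x + h *\<^sub>R b) + s *\<^sub>R a) - fa (x + s *\<^sub>R a))"
    using MVT2[OF \<open>0 < h\<close> g'] by metis
  have fa': "((\<lambda>t. fa ((x + s *\<^sub>R a) + t *\<^sub>R b)) has_real_derivative frechet_derivative fa (at ((x + s *\<^sub>R a) + t *\<^sub>R b)) b) (at t)"
    if "0 \<le> t" "t \<le> h" for t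
    unfolding has_real_derivative_iff_has_vector_derivative
    using line[of s t] that s by (intro frechet_derivative_line dfa) simp
  obtain t where t: "0 < t" "t < h" "fa ((x + s *\<^sub>R a) + h *\<^sub>R b) - fa ((x + s *\<^sub>R a) + 0 *\<^sub>R b)
      = (h - 0) * frechet_derivative fa (at ((x + s *\<^sub>R a) + t *\<^sub>R b)) b"
    using MVT2[OF \<open>0 < h\<close> fa'] by metis
  have "f (x + h *\<^sub>R a + h *\<^sub>R b) - f (x + h *\<^sub>R a) - f (x + h *\<^sub>R b) + f x = g h - g 0"
    by (simp add: g_def algebra_simps)
  also have "\<dots> = h * (fa ((x + s *\<^sub>R a) + h *\<^sub>R b) - fa ((x + s *\<^sub>R a) + 0 *\<^sub>R b))"
    using s(3) by (simp add: algebra_simps)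
  also have "\<dots> = h\<^sup>2 * frechet_derivative fa (at (x + s *\<^sub>R a + t *\<^sub>R b)) b"
    unfolding t(3) by (simp add: power2_eq_square)
  finally show thesis using that s t unfolding fa_def by blast
qed

lemma second_derivative_symmetric_real:
  fixes f :: "'a::real_normed_vector \<Rightarrow> real"
  assumes "open S" "x \<in> S" and f: "Ck_on 2 S f"
  shows "frechet_derivative (\<lambda>y. frechet_derivative f (at y) a) (at x) b
    = frechet_derivative (\<lambda>y. frechet_derivative f (at y) b) (at x) a"
proof -
  define fab where "fab = (\<lambda>y. frechet_derivative (\<lambda>y. frechet_derivative f (at y) a) (at y) b)"
  define fba where "fba = (\<lambda>y. frechet_derivative (\<lambda>y. frechet_derivative f (at y) b) (at y) a)"
  have cont: "isCont fab x" "isCont fba x"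
    using f assms(1,2) unfolding fab_def fba_def
    by (auto simp: numeral_2_eq_2 continuous_on_eq_continuous_at)
  have "\<bar>fab x - fba x\<bar> \<le> 2 * e" if "0 < e" for e
  proof -
    obtain d1 where d1: "0 < d1" "\<And>y. dist y x < d1 \<Longrightarrow> \<bar>fab y - fab x\<bar> < e"
      using cont(1) \<open>0 < e\<close> unfolding continuous_at_eps_delta dist_real_def by blast
    obtain d2 where d2: "0 < d2" "\<And>y. dist y x < d2 \<Longrightarrow> \<bar>fba y - fba x\<bar> < e"
      using cont(2) \<open>0 < e\<close> unfolding continuous_at_eps_delta dist_real_def by blast
    obtain d3 where d3: "0 < d3" "\<And>y. dist y x < d3 \<Longrightarrow> y \<in> S"
      using \<open>open S\<close> \<open>x \<in> S\<close> unfolding open_dist by blast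
    define d where "d = min d1 (min d2 d3)"
    have "0 < d" using d1 d2 d3 by (simp add: d_def)
    \<comment> \<open>Small enough for the parallelogram with sides h a and h b to stay within
      \<open>d\<close> of \<open>x\<close>; the summand 1 keeps the denominator positive if
      \<open>a\<close> and \<open>b\<close> vanish.\<close>
    define h where "h = d / (2 * (norm a + norm b + 1))"
    have pos: "0 < norm a + norm b + 1" by (smt (verit) norm_ge_zero)
    have "0 < h" unfolding h_def using \<open>0 < d\<close> pos by simp
    have near: "dist (x + s *\<^sub>R a + t *\<^sub>R b) x < d" if "0 \<le> s" "s \<le> h" "0 \<le> t" "t \<le> h" for s t
    proof -
      have "dist (x + s *\<^sub>R a + t *\<^sub>R b) x \<le> s * norm a + t * norm b"
        using that norm_triangle_ineq[of "s *\<^sub>R a" "t *\<^sub>R b"] by (simp add: dist_norm)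
      also have "\<dots> \<le> h * norm a + h * norm b"
        using that by (intro add_mono mult_right_mono) auto
      also have "\<dots> < h * (2 * (norm a + norm b + 1))"
        using \<open>0 < h\<close> by (simp add: algebra_simps add_strict_increasing)
      also have "\<dots> = d" using pos by (simp add: h_def)
      finally show ?thesis .
    qed
    have near': "dist (x + s *\<^sub>R b + t *\<^sub>R a) x < d" if "0 \<le> s" "s \<le> h" "0 \<le> t" "t \<le> h" for s t
      using near[of t s] that by (simp add: algebra_simps)
    have "x + s *\<^sub>R a + t *\<^sub>R b \<in> S" if "0 \<le> s" "s \<le> h" "0 \<le> t" "t \<le> h" for s t
      using near[OF that] d3 by (simp add: d_def)
    from second_difference_mean_value[OF this f \<open>0 < h\<close>]
    obtain s t where st: "0 < s" "s < h" "0 < t" "t < h"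
      "f (x + h *\<^sub>R a + h *\<^sub>R b) - f (x + h *\<^sub>R a) - f (x + h *\<^sub>R b) + f x = h\<^sup>2 * fab (x + s *\<^sub>R a + t *\<^sub>R b)"
      unfolding fab_def by blast
    have "x + s *\<^sub>R b + t *\<^sub>R a \<in> S" if "0 \<le> s" "s \<le> h" "0 \<le> t" "t \<le> h" for s t
      using near'[OF that] d3 by (simp add: d_def)
    from second_difference_mean_value[OF this f \<open>0 < h\<close>]
    obtain s' t' where st': "0 < s'" "s' < h" "0 < t'" "t' < h"
      "f (x + h *\<^sub>R b + h *\<^sub>R a) - f (x + h *\<^sub>R b) - f (x + h *\<^sub>R a) + f x = h\<^sup>2 * fba (x + s' *\<^sub>R b + t' *\<^sub>R a)"
      unfolding fba_def by blast
    have "h\<^sup>2 * fab (x + s *\<^sub>R a + t *\<^sub>R b) = h\<^sup>2 * fba (x + s' *\<^sub>R b + t' *\<^sub>R a)"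
      using st(5) st'(5) by (simp add: algebra_simps)
    then have "fab (x + s *\<^sub>R a + t *\<^sub>R b) = fba (x + s' *\<^sub>R b + t' *\<^sub>R a)" using \<open>0 < h\<close> by simp
    moreover have "\<bar>fab (x + s *\<^sub>R a + t *\<^sub>R b) - fab x\<bar> < e"
      using d1(2) near[of s t] st by (simp add: d_def)
    moreover have "\<bar>fba (x + s' *\<^sub>R b + t' *\<^sub>R a) - fba x\<bar> < e"
      using d2(2) near'[of s' t'] st' by (simp add: d_def)
    ultimately show ?thesis by linarith
  qed
  from this[of "\<bar>fab x - fba x\<bar> / 4"] have "fab x = fba x" by (cases "fab x = fba x") auto
  then show ?thesis by (simp add: fab_def fba_def)
qed

lemma frechet_derivative_inner_left:
  assumes "f differentiable at x"
  shows "frechet_derivative (\<lambda>y. f y \<bullet> w) (at x) = (\<lambda>v. frechet_derivative f (at x) v \<bullet> w)"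
proof -
  have "(f has_derivative frechet_derivative f (at x)) (at x)"
    using assms frechet_derivative_works by blast
  then have "((\<lambda>y. f y \<bullet> w) has_derivative (\<lambda>v. frechet_derivative f (at x) v \<bullet> w)) (at x)"
    by (rule has_derivative_inner_left)
  then show ?thesis using frechet_derivative_at by metis
qed

lemma second_derivative_symmetric:
  fixes f :: "'a::real_normed_vector \<Rightarrow> 'b::real_inner"
  assumes "open S" "x \<in> S" and f: "Ck_on 2 S f"
  shows "frechet_derivative (\<lambda>y. frechet_derivative f (at y) a) (at x) b
    = frechet_derivative (\<lambda>y. frechet_derivative f (at y) b) (at x) a"
proof -
  have df: "f differentiable at y" and dfa: "(\<lambda>y. frechet_derivative f (at y) a) differentiable at y"
    if "y \<in> S" for y a
    using f that by (auto simp: numeral_2_eq_2)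
  have "frechet_derivative (\<lambda>y. frechet_derivative f (at y) a) (at x) b \<bullet> w
      = frechet_derivative (\<lambda>y. frechet_derivative (\<lambda>y. f y \<bullet> w) (at y) a) (at x) b" for w a b
  proof -
    have "((\<lambda>y. frechet_derivative f (at y) a) has_derivative
        frechet_derivative (\<lambda>y. frechet_derivative f (at y) a) (at x)) (at x)"
      using dfa[OF \<open>x \<in> S\<close>] frechet_derivative_works by blast
    then have "((\<lambda>y. frechet_derivative f (at y) a \<bullet> w) has_derivative
        (\<lambda>v. frechet_derivative (\<lambda>y. frechet_derivative f (at y) a) (at x) v \<bullet> w)) (at x)"
      by (rule has_derivative_inner_left)
    then have "((\<lambda>y. frechet_derivative (\<lambda>y. f y \<bullet> w) (at y) a) has_derivative
        (\<lambda>v. frechet_derivative (\<lambda>y. frechet_derivative f (at y) a) (at x) v \<bullet> w)) (at x)"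
      by (rule has_derivative_transform_within_open[OF _ \<open>open S\<close> \<open>x \<in> S\<close>])
         (simp add: frechet_derivative_inner_left[OF df])
    then show ?thesis using frechet_derivative_at by metis
  qed
  moreover have "frechet_derivative (\<lambda>y. frechet_derivative (\<lambda>y. f y \<bullet> w) (at y) a) (at x) b
      = frechet_derivative (\<lambda>y. frechet_derivative (\<lambda>y. f y \<bullet> w) (at y) b) (at x) a" for w
    by (rule second_derivative_symmetric_real[OF assms(1,2)])
       (rule Ck_on_bounded_linear_compose[OF assms(1) bounded_linear_inner_left f])
  ultimately show ?thesis by (metis vector_eq_ldot inner_commute)
qed


section \<open>Orthonormal frames and diagonal curvature tensors\<close>

lemma sum_lessThan_4: "(\<Sum>i<4. f i) = f 0 + f 1 + f 2 + f (3::nat)"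
  for f :: "nat \<Rightarrow> 'a::comm_monoid_add"
  by (simp add: eval_nat_numeral)

lemma all_less_4: "(\<forall>i<4. P i) \<longleftrightarrow> P 0 \<and> P 1 \<and> P 2 \<and> P (3::nat)"
  by (simp add: eval_nat_numeral All_less_Suc) blast

lemma less_4_cases: "(i::nat) < 4 \<Longrightarrow> i = 0 \<or> i = 1 \<or> i = 2 \<or> i = 3"
  by linarith

text \<open>A locale, because it is interpreted again for the renumbered frame
  \<open>e \<circ> \<tau>\<close> and for the image \<open>\<phi> \<circ> e\<close> of the frame
  under an isometry.\<close>

locale orthonormal_frame =
  fixes e :: "nat \<Rightarrow> 'a::euclidean_space"
  assumes dim4: "DIM('a) = 4"
    and orthonormal: "\<lbrakk>i < 4; j < 4\<rbrakk> \<Longrightarrow> e i \<bullet> e j = (if i = j then 1 else 0)"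
begin

lemma inner_combination: "i < 4 \<Longrightarrow> (\<Sum>j<4. c j *\<^sub>R e j) \<bullet> e i = c i"
  by (simp add: inner_sum_left orthonormal if_distrib cong: if_cong)

text \<open>A non-zero difference \<open>z\<close> orthogonal to all \<open>e i\<close> would give
  five pairwise orthogonal non-zero vectors in dimension 4.\<close>

lemma frame_ext:
  assumes "\<And>i. i < 4 \<Longrightarrow> x \<bullet> e i = y \<bullet> e i" shows "x = y"
proof (rule ccontr)
  assume "x \<noteq> y"
  define z where "z = x - y"
  have z: "z \<noteq> 0" "\<And>i. i < 4 \<Longrightarrow> z \<bullet> e i = 0"
    using \<open>x \<noteq> y\<close> assms by (auto simp: z_def inner_diff_left)
  have ne: "e i \<noteq> 0" if "i < 4" for i using orthonormal[OF that that] by auto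
  have inj: "inj_on e {..<4}"
    by (rule inj_onI) (metis lessThan_iff orthonormal zero_neq_one)
  have nmem: "z \<notin> e ` {..<4}" using z(2) ne by (metis imageE inner_eq_zero_iff lessThan_iff)
  have pw: "pairwise orthogonal (insert z (e ` {..<4}))"
    using z(2) orthonormal by (auto simp: pairwise_def orthogonal_def inner_commute)
  have "0 \<notin> insert z (e ` {..<4})"
    using z(1) ne by force
  from pairwise_orthogonal_independent[OF pw this] have "card (insert z (e ` {..<4})) \<le> 4"
    using independent_bound dim4 by metis
  then show False using inj nmem by (simp add: card_image)
qed

lemma frame_expansion: "(\<Sum>i<4. (x \<bullet> e i) *\<^sub>R e i) = x"
  by (rule frame_ext) (simp add: inner_combination)

lemma inner_frame: "x \<bullet> y = (\<Sum>i<4. (x \<bullet> e i) * (y \<bullet> e i))"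
  by (subst (1) frame_expansion[symmetric, of y]) (simp add: inner_sum_right mult.commute)

lemma linear_frame:
  assumes "linear f" shows "f x = (\<Sum>i<4. (x \<bullet> e i) *\<^sub>R f (e i))"
  by (subst (1) frame_expansion[symmetric, of x]) (simp add: linear_sum[OF assms] linear_scale[OF assms])

text \<open>For symmetric \<open>k\<close> the terms (i, j) and (j, i) combine to k_ij (a_i b_j -
  a_j b_i)(c_i d_j - c_j d_i): the curvature operator is diagonal on the bivectors e_i \<and> e_j,
  with eigenvalues k_ij.\<close>

definition diag_form :: "(nat \<Rightarrow> nat \<Rightarrow> real) \<Rightarrow> 'a tensor4" where
  "diag_form k a b c d =
    (\<Sum>i<4. \<Sum>j<4. k i j * ((a \<bullet> e i) * (b \<bullet> e j) * ((c \<bullet> e i) * (d \<bullet> e j) - (c \<bullet> e j) * (d \<bullet> e i))))"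

definition sec :: "'a tensor4 \<Rightarrow> nat \<Rightarrow> nat \<Rightarrow> real" where
  "sec R i j = R (e i) (e j) (e i) (e j)"

lemma sec_props:
  assumes "algebraic_curvature_tensor R"
  shows "sec R i j = sec R j i" "sec R i i = 0"
proof -
  have *: "R b a c d = - R a b c d" "R a b d c = - R a b c d" for a b c d
    using assms unfolding algebraic_curvature_tensor_def by blast+
  show "sec R i j = sec R j i" unfolding sec_def *(1)[of "e j"] *(2)[of _ _ "e j"] by simp
  show "sec R i i = 0" unfolding sec_def using *(1)[of "e i" "e i" "e i" "e i"] by linarith
qed

lemma curvature_linear:
  assumes "algebraic_curvature_tensor R"
  shows "linear (\<lambda>a. R a b c d)" "linear (\<lambda>b. R a b c d)" "linear (\<lambda>c. R a b c d)" "linear (\<lambda>d. R a b c d)"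
proof -
  note R = assms[unfolded algebraic_curvature_tensor_def]
  show "linear (\<lambda>a. R a b c d)" using conjunct1[OF R] by (blast dest: spec)
  show "linear (\<lambda>b. R a b c d)" using conjunct1[OF conjunct2[OF R]] by (blast dest: spec)
  show "linear (\<lambda>c. R a b c d)" using conjunct1[OF conjunct2[OF conjunct2[OF R]]] by (blast dest: spec)
  show "linear (\<lambda>d. R a b c d)" using conjunct1[OF conjunct2[OF conjunct2[OF conjunct2[OF R]]]] by (blast dest: spec)
qed

lemma curvature_frame:
  assumes "algebraic_curvature_tensor R"
  shows "R a b c d = (\<Sum>i<4. (a \<bullet> e i) * R (e i) b c d)"
    and "R a b c d = (\<Sum>i<4. (b \<bullet> e i) * R a (e i) c d)"
    and "R a b c d = (\<Sum>i<4. (c \<bullet> e i) * R a b (e i) d)"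
    and "R a b c d = (\<Sum>i<4. (d \<bullet> e i) * R a b c (e i))"
proof -
  show "R a b c d = (\<Sum>i<4. (a \<bullet> e i) * R (e i) b c d)"
    by (rule linear_frame[OF curvature_linear(1)[OF assms], unfolded real_scaleR_def])
  show "R a b c d = (\<Sum>i<4. (b \<bullet> e i) * R a (e i) c d)"
    by (rule linear_frame[OF curvature_linear(2)[OF assms], unfolded real_scaleR_def])
  show "R a b c d = (\<Sum>i<4. (c \<bullet> e i) * R a b (e i) d)"
    by (rule linear_frame[OF curvature_linear(3)[OF assms], unfolded real_scaleR_def])
  show "R a b c d = (\<Sum>i<4. (d \<bullet> e i) * R a b c (e i))"
    by (rule linear_frame[OF curvature_linear(4)[OF assms], unfolded real_scaleR_def])
qed

lemma diagonal_tensor_eq_diag_form: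
  assumes R: "algebraic_curvature_tensor R" and diag: "diagonal_tensor e R"
  shows "R = diag_form (sec R)"
proof (intro ext)
  fix a b c d
  have anti: "R b a c d = - R a b c d" "R a b d c = - R a b c d" for a b c d
    using R unfolding algebraic_curvature_tensor_def by blast+
  have zero: "R a a c d = 0" for a c d using anti(1)[of a a c d] by linarith
  have comp: "R (e i) (e j) (e k) (e l) = sec R i j * ((if k = i \<and> l = j then 1 else 0) - (if k = j \<and> l = i then 1 else 0))"
    if "i < 4" "j < 4" "k < 4" "l < 4" for i j k l
  proof (cases "{i, j} = {k, l}")
    case True
    then consider "k = i" "l = j" | "k = j" "l = i" unfolding doubleton_eq_iff by blast
    then show ?thesis
    proof cases
      case 1
      show ?thesis unfolding 1 by (cases "i = j") (simp_all add: sec_def zero)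
    next
      case 2
      show ?thesis unfolding 2
        by (cases "i = j") (simp_all add: sec_def zero anti(2)[of "e i" "e j" "e j" "e i"])
    qed
  next
    case False
    then have "R (e i) (e j) (e k) (e l) = 0"
      using diag that unfolding diagonal_tensor_def by blast
    moreover have "\<not> (k = i \<and> l = j)" "\<not> (k = j \<and> l = i)"
      using False by blast+
    ultimately show ?thesis by (simp only: if_False diff_self mult_zero_right)
  qed
  have ij: "R (e i) (e j) c d = sec R i j * ((c \<bullet> e i) * (d \<bullet> e j) - (c \<bullet> e j) * (d \<bullet> e i))"
    if "i < 4" "j < 4" for i j
  proof -
    have "R (e i) (e j) c d = (\<Sum>k<4. (c \<bullet> e k) * (\<Sum>l<4. (d \<bullet> e l) * R (e i) (e j) (e k) (e l)))"
      unfolding curvature_frame(3)[OF R, of _ _ c]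
      unfolding curvature_frame(4)[OF R, of _ _ _ d] ..
    also have "\<dots> = (\<Sum>k<4. (c \<bullet> e k) * (\<Sum>l<4. (d \<bullet> e l) * (sec R i j *
        ((if k = i \<and> l = j then 1 else 0) - (if k = j \<and> l = i then 1 else 0)))))"
      using that comp by simp
    also have "\<dots> = sec R i j * ((c \<bullet> e i) * (d \<bullet> e j) - (c \<bullet> e j) * (d \<bullet> e i))"
    proof -
      have "(\<Sum>l<4. (d \<bullet> e l) * (sec R i j * ((if k = i \<and> l = j then 1 else 0) - (if k = j \<and> l = i then 1 else 0))))
        = sec R i j * ((if k = i then d \<bullet> e j else 0) - (if k = j then d \<bullet> e i else 0))" for k
        using less_4_cases[OF that(1)] less_4_cases[OF that(2)]
        by (elim disjE; simp add: sum_lessThan_4 algebra_simps)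
      moreover have "(\<Sum>k<4. (c \<bullet> e k) * (sec R i j * ((if k = i then d \<bullet> e j else 0) - (if k = j then d \<bullet> e i else 0))))
        = sec R i j * ((c \<bullet> e i) * (d \<bullet> e j) - (c \<bullet> e j) * (d \<bullet> e i))"
        using less_4_cases[OF that(1)] less_4_cases[OF that(2)]
        by (elim disjE; simp add: sum_lessThan_4 algebra_simps)
      ultimately show ?thesis by simp
    qed
    finally show ?thesis .
  qed
  have "R a b c d = (\<Sum>i<4. (a \<bullet> e i) * (\<Sum>j<4. (b \<bullet> e j) * R (e i) (e j) c d))"
    unfolding curvature_frame(1)[OF R, of a]
    unfolding curvature_frame(2)[OF R, of _ b] ..
  also have "\<dots> = diag_form (sec R) a b c d"
    unfolding diag_form_def by (simp add: ij sum_distrib_left mult_ac)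
  finally show "R a b c d = diag_form (sec R) a b c d" .
qed

lemma diagonal_curvature_tensorD:
  assumes "diagonal_curvature_tensor e R w t s"
  shows "R = diag_form (sec R)" "sec R i j = sec R j i" "sec R i i = 0"
    "sec R 0 1 = w$1 + t$1 + s/12" "sec R 0 2 = w$2 + t$2 + s/12" "sec R 0 3 = w$3 + t$3 + s/12"
    "sec R 2 3 = w$1 - t$1 + s/12" "sec R 1 3 = w$2 - t$2 + s/12" "sec R 1 2 = w$3 - t$3 + s/12"
    "w$1 + w$2 + w$3 = 0"
proof -
  have R: "algebraic_curvature_tensor R" and D: "diagonal_tensor e R"
    using assms unfolding diagonal_curvature_tensor_def by blast+
  show "R = diag_form (sec R)" by (rule diagonal_tensor_eq_diag_form[OF R D])
  show "sec R i j = sec R j i" "sec R i i = 0" for i j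
    by (rule sec_props[OF R])+
  show "sec R 0 1 = w$1 + t$1 + s/12" "sec R 0 2 = w$2 + t$2 + s/12" "sec R 0 3 = w$3 + t$3 + s/12"
    "sec R 2 3 = w$1 - t$1 + s/12" "sec R 1 3 = w$2 - t$2 + s/12" "sec R 1 2 = w$3 - t$3 + s/12"
    "w$1 + w$2 + w$3 = 0"
    using assms unfolding diagonal_curvature_tensor_def sec_props(1)[OF R, of 1 3] unfolding sec_def by blast+
qed

end


section \<open>Separating coordinates of product form\<close>

lemma prod_UNIV_3: "prod f (UNIV :: 3 set) = f 1 * f 2 * f 3"
  for f :: "3 \<Rightarrow> 'a::comm_monoid_mult"
  unfolding UNIV_3 by (simp add: mult.assoc)

definition affine_product :: "('i \<Rightarrow> 3 \<Rightarrow> real) \<Rightarrow> ('i \<Rightarrow> 3 \<Rightarrow> real) \<Rightarrow> 'i \<Rightarrow> real^3 \<Rightarrow> real" where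
  "affine_product \<alpha> \<beta> i z = (\<Prod>j\<in>UNIV. \<alpha> i j + \<beta> i j * z$j)"

text \<open>The logarithmic derivative of \<open>affine_product \<alpha> \<beta> i\<close> in the
  j-th variable. For \<psi>_i = \<plusminus> sqrt y_i the j-th coordinate vector has the components
  \<psi>_i d_ij / 2.\<close>

definition log_slope :: "('i \<Rightarrow> 3 \<Rightarrow> real) \<Rightarrow> ('i \<Rightarrow> 3 \<Rightarrow> real) \<Rightarrow> 'i \<Rightarrow> 3 \<Rightarrow> real^3 \<Rightarrow> real" where
  "log_slope \<alpha> \<beta> i j z = \<beta> i j / (\<alpha> i j + \<beta> i j * z$j)"

text \<open>The product is affine in each variable separately, so a unit step changes it by exactly
  its partial derivative. Identities between such products thus yield identities between their
  derivatives by evaluation at shifted points.\<close>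

lemma affine_product_step:
  assumes "affine_product \<alpha> \<beta> i z \<noteq> 0"
  shows "affine_product \<alpha> \<beta> i (z + axis j 1) = affine_product \<alpha> \<beta> i z * (1 + log_slope \<alpha> \<beta> i j z)"
    and "j \<noteq> k \<Longrightarrow> affine_product \<alpha> \<beta> i (z + axis j 1 + axis k 1)
      = affine_product \<alpha> \<beta> i z * (1 + log_slope \<alpha> \<beta> i j z) * (1 + log_slope \<alpha> \<beta> i k z)"
proof -
  define l where "l = (\<lambda>j. \<alpha> i j + \<beta> i j * z$j)"
  have l: "l 1 \<noteq> 0" "l 2 \<noteq> 0" "l 3 \<noteq> 0" and y: "affine_product \<alpha> \<beta> i z = l 1 * l 2 * l 3"
    using assms unfolding affine_product_def prod_UNIV_3 l_def by auto
  have s: "\<alpha> i m + \<beta> i m * (z + axis j 1)$m = (if m = j then l m * (1 + log_slope \<alpha> \<beta> i j z) else l m)"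
    for m j
  proof (cases "m = j")
    case True
    have "l m \<noteq> 0" using exhaust_3[of m] l by metis
    then have "l m * (1 + \<beta> i m / l m) = l m + \<beta> i m" by (simp add: distrib_left)
    then show ?thesis using True by (simp add: axis_def log_slope_def l_def distrib_left)
  qed (simp add: axis_def l_def)
  show "affine_product \<alpha> \<beta> i (z + axis j 1) = affine_product \<alpha> \<beta> i z * (1 + log_slope \<alpha> \<beta> i j z)"
    unfolding y unfolding affine_product_def prod_UNIV_3 s using exhaust_3[of j]
    by (elim disjE) (simp_all add: mult_ac)
  show "affine_product \<alpha> \<beta> i (z + axis j 1 + axis k 1)
      = affine_product \<alpha> \<beta> i z * (1 + log_slope \<alpha> \<beta> i j z) * (1 + log_slope \<alpha> \<beta> i k z)" if "j \<noteq> k"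
  proof -
    have t: "\<alpha> i m + \<beta> i m * (z + axis j 1 + axis k 1)$m = (if m = k then l m * (1 + log_slope \<alpha> \<beta> i k z)
      else if m = j then l m * (1 + log_slope \<alpha> \<beta> i j z) else l m)" for m
      using s[of m j] s[of m k] that by (cases "m = k"; cases "m = j"; simp add: axis_def)
    show ?thesis
      unfolding y unfolding affine_product_def prod_UNIV_3 t using exhaust_3[of j] exhaust_3[of k] that
      by (elim disjE) (simp_all add: mult_ac)
  qed
qed

lemma has_derivative_affine_product:
  assumes "affine_product \<alpha> \<beta> i z \<noteq> 0"
  shows "(affine_product \<alpha> \<beta> i has_derivative
    (\<lambda>v. affine_product \<alpha> \<beta> i z * (\<Sum>j\<in>UNIV. log_slope \<alpha> \<beta> i j z * v$j))) (at z)"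
proof -
  define l where "l = (\<lambda>j. \<alpha> i j + \<beta> i j * z$j)"
  have l: "l 1 \<noteq> 0" "l 2 \<noteq> 0" "l 3 \<noteq> 0" and y: "affine_product \<alpha> \<beta> i z = l 1 * l 2 * l 3"
    using assms unfolding affine_product_def prod_UNIV_3 l_def by auto
  have d: "((\<lambda>z. \<alpha> i j + \<beta> i j * z$j) has_derivative (\<lambda>v. \<beta> i j * v$j)) (at z)" for j
    by (rule has_derivative_eq_rhs[OF has_derivative_add[OF has_derivative_const has_derivative_mult_right[OF
      bounded_linear_imp_has_derivative[OF bounded_linear_vec_nth]]]]) simp
  have eq: "affine_product \<alpha> \<beta> i = (\<lambda>z. (\<alpha> i 1 + \<beta> i 1 * z$1) * (\<alpha> i 2 + \<beta> i 2 * z$2) * (\<alpha> i 3 + \<beta> i 3 * z$3))"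
    unfolding affine_product_def prod_UNIV_3 ..
  have b: "log_slope \<alpha> \<beta> i j z * l j = \<beta> i j" for j
    using l exhaust_3[of j] by (auto simp: log_slope_def l_def)
  have "(affine_product \<alpha> \<beta> i has_derivative
      (\<lambda>v. (l 1 * l 2) * (\<beta> i 3 * v$3) + (l 1 * (\<beta> i 2 * v$2) + (\<beta> i 1 * v$1) * l 2) * l 3)) (at z)"
    unfolding l_def eq by (rule has_derivative_mult[OF has_derivative_mult[OF d d] d])
  then show ?thesis
  proof (rule has_derivative_eq_rhs, intro ext)
    fix v :: "real^3"
    show "(l 1 * l 2) * (\<beta> i 3 * v$3) + (l 1 * (\<beta> i 2 * v$2) + (\<beta> i 1 * v$1) * l 2) * l 3
      = affine_product \<alpha> \<beta> i z * (\<Sum>j\<in>UNIV. log_slope \<alpha> \<beta> i j z * v$j)"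
      unfolding y sum_3 b[of 1, symmetric] b[of 2, symmetric] b[of 3, symmetric] by algebra
  qed
qed

lemma Ck_on_affine_product:
  assumes "open S" shows "Ck_on k S (affine_product \<alpha> \<beta> i)"
  unfolding affine_product_def[abs_def]
  by (intro Ck_on_prod Ck_on_add Ck_on_mult Ck_on_const Ck_on_bounded_linear assms bounded_linear_vec_nth)

text \<open>For \<open>x\<^sub>i\<^sup>2 = Y\<^sub>i\<close>, this says that \<open>v\<^sub>i = x\<^sub>i d\<^sub>i\<close> is an eigenvector, up to a multiple of \<open>x\<close>.\<close>

definition eigen_direction :: "(nat \<Rightarrow> nat \<Rightarrow> real) \<Rightarrow> (nat \<Rightarrow> real) \<Rightarrow> (nat \<Rightarrow> real) \<Rightarrow> bool" where
  "eigen_direction k Y d \<longleftrightarrow> (\<exists>lam \<mu>. \<forall>m<4. (\<Sum>i<4. k i m * Y i * (d m - d i)) = lam * d m + \<mu>)"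

context orthonormal_frame
begin

text \<open>Points off the coordinate hyperplanes form the open and dense set on which integrability
  is verified; there each x_i is a smooth function of x_i^2 once its sign is fixed.\<close>

definition separable :: "(nat \<Rightarrow> nat \<Rightarrow> real) \<Rightarrow> bool" where
  "separable k \<longleftrightarrow> (\<forall>x\<in>unit_sphere. (\<forall>i<4. x \<bullet> e i \<noteq> 0) \<longrightarrow>
    (\<exists>D \<psi>. coordinate_parametrisation D \<psi> \<and> x \<in> \<psi> ` D \<and>
      (\<forall>u\<in>D. \<forall>j. eigenvector_at (\<lambda>x v w. diag_form k x v x w) (\<psi> u) (coordinate_vector \<psi> u j))))"

text \<open>In the frame, the form becomes \<Sum>_m (x_m w_m / 2) \<Sum>_i k_im x_i^2 (d_m - d_i).
  The constant \<mu> contributes a multiple of x \<bullet> w, which is zero for tangent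
  \<open>w\<close>.\<close>

lemma diag_form_eigen:
  assumes k: "\<And>i m. k i m = k m i"
    and eig: "\<And>m. m < 4 \<Longrightarrow> (\<Sum>i<4. k i m * (x \<bullet> e i)\<^sup>2 * (d m - d i)) = lam * d m + \<mu>"
    and v: "\<And>i. i < 4 \<Longrightarrow> v \<bullet> e i = (x \<bullet> e i) * d i / 2"
    and w: "x \<bullet> w = 0"
  shows "diag_form k x v x w = lam * (v \<bullet> w)"
proof -
  define X where "X = (\<lambda>i. x \<bullet> e i)"
  define W where "W = (\<lambda>i. w \<bullet> e i)"
  have "diag_form k x v x w = (\<Sum>i<4. \<Sum>m<4. k i m * (X i * (X m * d m / 2) * (X i * W m - X m * W i)))"
    by (simp add: diag_form_def v X_def W_def)
  also have "\<dots> = (\<Sum>i<4. \<Sum>m<4. k i m * (X i)\<^sup>2 * X m * W m * d m / 2)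
      - (\<Sum>i<4. \<Sum>m<4. k i m * (X m)\<^sup>2 * X i * W i * d m / 2)"
    unfolding sum_subtractf[symmetric] by (intro sum.cong refl) (simp add: power2_eq_square field_simps)
  also have "(\<Sum>i<4. \<Sum>m<4. k i m * (X i)\<^sup>2 * X m * W m * d m / 2)
      = (\<Sum>m<4. \<Sum>i<4. k i m * (X i)\<^sup>2 * X m * W m * d m / 2)"
    by (rule sum.swap)
  also have "(\<Sum>i<4. \<Sum>m<4. k i m * (X m)\<^sup>2 * X i * W i * d m / 2)
      = (\<Sum>m<4. \<Sum>i<4. k i m * (X i)\<^sup>2 * X m * W m * d i / 2)"
    by (simp only: k)
  also have "(\<Sum>m<4. \<Sum>i<4. k i m * (X i)\<^sup>2 * X m * W m * d m / 2) - (\<Sum>m<4. \<Sum>i<4. k i m * (X i)\<^sup>2 * X m * W m * d i / 2)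
      = (\<Sum>m<4. X m * W m / 2 * (\<Sum>i<4. k i m * (X i)\<^sup>2 * (d m - d i)))"
    unfolding sum_subtractf[symmetric] sum_distrib_left by (intro sum.cong refl) (simp add: algebra_simps)
  also have "\<dots> = (\<Sum>m<4. X m * W m / 2 * (lam * d m + \<mu>))"
    using eig by (simp add: X_def)
  also have "\<dots> = (\<Sum>m<4. lam * (X m * d m / 2 * W m) + \<mu> / 2 * (X m * W m))"
    by (intro sum.cong refl) (simp add: algebra_simps)
  also have "\<dots> = lam * (\<Sum>m<4. (v \<bullet> e m) * W m) + \<mu> / 2 * (x \<bullet> w)"
    unfolding sum.distrib sum_distrib_left[symmetric] by (simp add: v X_def W_def inner_frame[of x w])
  also have "(\<Sum>m<4. (v \<bullet> e m) * W m) = v \<bullet> w"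
    by (simp add: inner_frame[of v w] W_def)
  finally show ?thesis using w by simp
qed

text \<open>The coordinates \<open>\<psi>\<^sub>i = \<plusminus> sqrt y\<^sub>i\<close> with \<open>y\<^sub>i\<close> a product of affine functions of one variable each.  As
  \<open>\<Sum> y\<^sub>i = 1\<close> holds identically, its second differences show that the coordinate vectors are orthogonal.\<close>

lemma separable_affine_product:
  fixes \<alpha> \<beta> :: "nat \<Rightarrow> 3 \<Rightarrow> real" and Z :: "(real^3) set"
  defines "y \<equiv> affine_product \<alpha> \<beta>" and "d \<equiv> log_slope \<alpha> \<beta>"
  defines "D \<equiv> {z \<in> Z. \<forall>i<4. 0 < y i z}"
  assumes k: "\<And>i m. k i m = k m i"
    and "open Z"
    and sum1: "\<And>z. (\<Sum>i<4. y i z) = 1"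
    and inj: "\<And>z z'. \<lbrakk>z \<in> D; z' \<in> D; \<And>i. i < 4 \<Longrightarrow> y i z = y i z'\<rbrakk> \<Longrightarrow> z = z'"
    and surj: "\<And>q. \<lbrakk>\<And>i. i < 4 \<Longrightarrow> 0 < q i; (\<Sum>i<4. q i) = 1\<rbrakk> \<Longrightarrow> \<exists>z\<in>Z. \<forall>i<4. y i z = q i"
    and nondegenerate: "\<And>j. \<exists>i<4. \<beta> i j \<noteq> 0"
    and eig: "\<And>z j. \<lbrakk>z \<in> D; (\<Sum>i<4. y i z * d i j z) = 0\<rbrakk> \<Longrightarrow>
      eigen_direction k (\<lambda>i. y i z) (\<lambda>i. d i j z)"
  shows "separable k"
  unfolding separable_def
proof (intro ballI impI)
  fix x :: 'a assume x: "x \<in> unit_sphere" "\<forall>i<4. x \<bullet> e i \<noteq> 0"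
  \<comment> \<open>The chart covers the whole open orthant of the sphere that contains x.\<close>
  define s where "s = (\<lambda>i. sgn (x \<bullet> e i))"
  have s2: "s i * s i = 1" if "i < 4" for i using x(2) that by (simp add: s_def sgn_if)
  define \<psi> where "\<psi> = (\<lambda>z. \<Sum>i<4. (s i * sqrt (y i z)) *\<^sub>R e i)"
  define P where "P = (\<lambda>z j. \<Sum>i<4. (s i * sqrt (y i z) * d i j z / 2) *\<^sub>R e i)"
  have pos: "0 < y i z" if "z \<in> D" "i < 4" for i z using that by (simp add: D_def)
  have \<psi>e: "\<psi> z \<bullet> e i = s i * sqrt (y i z)" if "i < 4" for z i
    using that by (simp add: \<psi>_def inner_combination)
  have Pe: "P z j \<bullet> e i = s i * sqrt (y i z) * d i j z / 2" if "i < 4" for z i j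
    using that by (simp add: P_def inner_combination)
  have \<psi>sq: "(\<psi> z \<bullet> e i)\<^sup>2 = y i z" if "z \<in> D" "i < 4" for z i
    using pos[OF that] s2[OF that(2)] by (simp add: \<psi>e that power_mult_distrib) (simp add: power2_eq_square)
  have cont: "continuous_on UNIV (y i)" for i
    unfolding y_def using Ck_on_affine_product[of UNIV 0] by simp
  have "open D"
  proof -
    have "D = Z \<inter> (\<Inter>i\<in>{..<4}. {z. 0 < y i z})" by (auto simp: D_def)
    then show ?thesis
      using \<open>open Z\<close> by (auto intro!: open_INT open_Int open_Collect_less continuous_on_const cont)
  qed
  have smooth: "smooth_on D \<psi>"
    unfolding smooth_on_def \<psi>_def y_def
    using pos by (auto intro!: Ck_on_sum Ck_on_scaleR Ck_on_mult Ck_on_const Ck_on_sqrt Ck_on_affine_product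
        \<open>open D\<close> simp: y_def)
  have D\<psi>: "(\<psi> has_derivative (\<lambda>v. \<Sum>j\<in>UNIV. v$j *\<^sub>R P z j)) (at z)" if "z \<in> D" for z
  proof -
    have "((\<lambda>z. (s i * sqrt (y i z)) *\<^sub>R e i) has_derivative
      (\<lambda>v. \<Sum>j\<in>UNIV. (v$j * (s i * sqrt (y i z) * d i j z / 2)) *\<^sub>R e i)) (at z)" if "i < 4" for i
    proof -
      have p: "0 < y i z" using pos \<open>z \<in> D\<close> that by blast
      then have ne: "affine_product \<alpha> \<beta> i z \<noteq> 0" by (simp add: y_def)
      have "((\<lambda>z. (s i * sqrt (y i z)) *\<^sub>R e i) has_derivative
        (\<lambda>v. (s i * ((y i z * (\<Sum>j\<in>UNIV. d i j z * v$j)) * (1 / (sqrt (y i z) * 2)))) *\<^sub>R e i)) (at z)"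
        using has_derivative_real_sqrt[where g = "y i", OF p has_derivative_affine_product[OF ne, folded y_def d_def]]
        by (intro has_derivative_scaleR_left has_derivative_mult_right) (simp only: divide_inverse mult_1_left inverse_mult_distrib)
      moreover have "s i * ((y i z * (\<Sum>j\<in>UNIV. d i j z * v$j)) * (1 / (sqrt (y i z) * 2)))
        = (\<Sum>j\<in>UNIV. v$j * (s i * sqrt (y i z) * d i j z / 2))" for v :: "real^3"
      proof -
        have r: "y i z * (1 / (sqrt (y i z) * 2)) = sqrt (y i z) / 2"
          using p real_div_sqrt[of "y i z"] by simp
        have "s i * ((y i z * (\<Sum>j\<in>UNIV. d i j z * v$j)) * (1 / (sqrt (y i z) * 2)))
          = s i * (y i z * (1 / (sqrt (y i z) * 2))) * (\<Sum>j\<in>UNIV. d i j z * v$j)"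
          by (simp only: mult_ac)
        also have "\<dots> = s i * (sqrt (y i z) / 2) * (\<Sum>j\<in>UNIV. d i j z * v$j)" by (simp only: r)
        also have "\<dots> = (\<Sum>j\<in>UNIV. v$j * (s i * sqrt (y i z) * d i j z / 2))"
          by (simp add: sum_distrib_left mult_ac)
        finally show ?thesis .
      qed
      ultimately show ?thesis by (simp add: scaleR_left.sum)
    qed
    then have "(\<psi> has_derivative (\<lambda>v. \<Sum>i<4. \<Sum>j\<in>UNIV. (v$j * (s i * sqrt (y i z) * d i j z / 2)) *\<^sub>R e i)) (at z)"
      unfolding \<psi>_def by (intro has_derivative_sum) auto
    moreover have "(\<Sum>i<4. \<Sum>j\<in>UNIV. (v$j * (s i * sqrt (y i z) * d i j z / 2)) *\<^sub>R e i)
      = (\<Sum>j\<in>UNIV. v$j *\<^sub>R P z j)" for v :: "real^3"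
      unfolding P_def by (subst sum.swap) (simp add: scaleR_sum_right)
    ultimately show ?thesis by simp
  qed
  have fd: "frechet_derivative \<psi> (at z) = (\<lambda>v. \<Sum>j\<in>UNIV. v$j *\<^sub>R P z j)" if "z \<in> D" for z
    using frechet_derivative_at[OF D\<psi>[OF that]] by simp
  have cv: "coordinate_vector \<psi> z j = P z j" if "z \<in> D" for z j
  proof -
    have "coordinate_vector \<psi> z j = (\<Sum>i\<in>UNIV. if i = j then P z i else 0)"
      unfolding coordinate_vector_def fd[OF that] by (intro sum.cong) (auto simp: axis_def)
    then show ?thesis by simp
  qed
  have sum_d: "(\<Sum>i<4. y i z * d i j z) = 0" if "z \<in> D" for z j
  proof -
    have "(\<Sum>i<4. y i (z + axis j 1)) = (\<Sum>i<4. y i z * (1 + d i j z))"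
      using affine_product_step(1)[of \<alpha> \<beta> _ z j] pos[OF that] unfolding y_def d_def
      by (intro sum.cong) (auto simp: less_imp_neq[symmetric])
    then show ?thesis using sum1[of z] sum1[of "z + axis j 1"] by (simp add: algebra_simps sum.distrib)
  qed
  have sum_dd: "(\<Sum>i<4. y i z * d i j z * d i l z) = 0" if "z \<in> D" "j \<noteq> l" for z j l
  proof -
    have "(\<Sum>i<4. y i (z + axis j 1 + axis l 1)) = (\<Sum>i<4. y i z * (1 + d i j z) * (1 + d i l z))"
      using affine_product_step(2)[of \<alpha> \<beta> _ z j l] pos[OF that(1)] that(2) unfolding y_def d_def
      by (intro sum.cong) (auto simp: less_imp_neq[symmetric])
    also have "\<dots> = (\<Sum>i<4. y i z) + (\<Sum>i<4. y i z * d i j z) + (\<Sum>i<4. y i z * d i l z) + (\<Sum>i<4. y i z * d i j z * d i l z)"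
      by (simp add: algebra_simps sum.distrib)
    finally show ?thesis using sum1[of z] sum1[of "z + axis j 1 + axis l 1"] sum_d[OF that(1)] by simp
  qed
  have P_orth: "P z j \<bullet> P z l = 0" if "z \<in> D" "j \<noteq> l" for z j l
  proof -
    have "P z j \<bullet> P z l = (\<Sum>i<4. (\<psi> z \<bullet> e i)\<^sup>2 * d i j z * d i l z / 4)"
      unfolding inner_frame[of "P z j" "P z l"] by (intro sum.cong) (auto simp: Pe \<psi>e power2_eq_square)
    also have "\<dots> = (\<Sum>i<4. y i z * d i j z * d i l z) / 4"
      unfolding sum_divide_distrib by (intro sum.cong) (auto simp: \<psi>sq that)
    finally show ?thesis using sum_dd[OF that] by simp
  qed
  have \<psi>P: "\<psi> z \<bullet> P z j = 0" if "z \<in> D" for z j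
  proof -
    have "\<psi> z \<bullet> P z j = (\<Sum>i<4. (\<psi> z \<bullet> e i)\<^sup>2 * d i j z / 2)"
      unfolding inner_frame[of "\<psi> z" "P z j"] by (intro sum.cong) (auto simp: Pe \<psi>e power2_eq_square)
    also have "\<dots> = (\<Sum>i<4. y i z * d i j z) / 2"
      unfolding sum_divide_distrib by (intro sum.cong) (auto simp: \<psi>sq that)
    finally show ?thesis using sum_d[OF that] by simp
  qed
  have P_nonzero: "P z j \<noteq> 0" if z: "z \<in> D" for z j
  proof
    assume "P z j = 0"
    obtain i where i: "i < 4" "\<beta> i j \<noteq> 0" using nondegenerate by blast
    have "\<alpha> i j + \<beta> i j * z$j \<noteq> 0"
      using pos[OF z i(1)] unfolding y_def affine_product_def
      by (metis UNIV_I finite less_irrefl prod_zero_iff)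
    then have "d i j z \<noteq> 0" using i by (simp add: d_def log_slope_def)
    moreover have "s i * sqrt (y i z) * d i j z / 2 = 0" using Pe[OF i(1), of z j] \<open>P z j = 0\<close> by simp
    ultimately show False using pos[OF z i(1)] s2[OF i(1)] by auto
  qed
  have \<psi>_norm: "norm (\<psi> z) = 1" if "z \<in> D" for z
  proof -
    have "\<psi> z \<bullet> \<psi> z = (\<Sum>i<4. y i z)"
      unfolding inner_frame[of "\<psi> z" "\<psi> z"] using \<psi>sq[OF that] by (simp add: power2_eq_square)
    then show ?thesis using sum1 by (simp add: norm_eq_sqrt_inner)
  qed
  \<comment> \<open>The image is described by inequalities, from which its openness in the sphere is
    immediate.\<close>
  have image: "\<psi> ` D = {v \<in> unit_sphere. \<forall>i<4. 0 < s i * (v \<bullet> e i)}"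
  proof (intro equalityI subsetI)
    fix v assume "v \<in> \<psi> ` D"
    then obtain z where z: "z \<in> D" "v = \<psi> z" by blast
    have "0 < s i * (v \<bullet> e i)" if "i < 4" for i
    proof -
      have "s i * (v \<bullet> e i) = s i * s i * sqrt (y i z)" by (simp add: z \<psi>e that)
      then show ?thesis using s2[OF that] pos[OF z(1) that] by simp
    qed
    then show "v \<in> {v \<in> unit_sphere. \<forall>i<4. 0 < s i * (v \<bullet> e i)}" using \<psi>_norm z by simp
  next
    fix v assume "v \<in> {v \<in> unit_sphere. \<forall>i<4. 0 < s i * (v \<bullet> e i)}"
    then have v: "norm v = 1" "\<And>i. i < 4 \<Longrightarrow> 0 < s i * (v \<bullet> e i)" by auto
    have "(\<Sum>i<4. (v \<bullet> e i)\<^sup>2) = 1"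
      using inner_frame[of v v] v(1) by (simp add: power2_eq_square norm_eq_sqrt_inner)
    moreover have "0 < (v \<bullet> e i)\<^sup>2" if "i < 4" for i using v(2)[OF that] by auto
    ultimately obtain z where z: "z \<in> Z" "\<And>i. i < 4 \<Longrightarrow> y i z = (v \<bullet> e i)\<^sup>2"
      using surj[of "\<lambda>i. (v \<bullet> e i)\<^sup>2"] by blast
    have "z \<in> D" using z \<open>\<And>i. i < 4 \<Longrightarrow> 0 < (v \<bullet> e i)\<^sup>2\<close> by (simp add: D_def)
    moreover have "\<psi> z = v"
    proof (rule frame_ext)
      fix i :: nat assume i: "i < 4"
      have "s i * \<bar>v \<bullet> e i\<bar> = v \<bullet> e i"
        using v(2)[OF i] s2[OF i] by (auto simp: s_def sgn_if abs_if zero_less_mult_iff split: if_splits)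
      then show "\<psi> z \<bullet> e i = v \<bullet> e i" by (simp add: \<psi>e i z(2))
    qed
    ultimately show "v \<in> \<psi> ` D" by blast
  qed
  have "coordinate_parametrisation D \<psi>"
    unfolding coordinate_parametrisation_def
  proof (intro conjI ballI)
    show "inj_on \<psi> D"
      by (rule inj_onI, rule inj) (metis \<psi>sq)+
    show "inj (frechet_derivative \<psi> (at z))" if z: "z \<in> D" for z
    proof (rule injI)
      fix v w assume eq: "frechet_derivative \<psi> (at z) v = frechet_derivative \<psi> (at z) w"
      have "v$l = w$l" for l
      proof -
        have "(\<Sum>j\<in>UNIV. v$j *\<^sub>R P z j) \<bullet> P z l = (v$l) * (P z l \<bullet> P z l)" for v :: "real^3"
        proof -
          have "(\<Sum>j\<in>UNIV. v$j *\<^sub>R P z j) \<bullet> P z l = (\<Sum>j\<in>UNIV. if j = l then (v$l) * (P z l \<bullet> P z l) else 0)"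
            unfolding inner_sum_left by (intro sum.cong) (auto simp: P_orth[OF z])
          then show ?thesis by simp
        qed
        then have "(v$l) * (P z l \<bullet> P z l) = (w$l) * (P z l \<bullet> P z l)"
          using eq unfolding fd[OF z] by metis
        then show ?thesis using P_nonzero[OF z] by simp
      qed
      then show "v = w" by (simp add: vec_eq_iff)
    qed
    have "open {v. \<forall>i<4. 0 < s i * (v \<bullet> e i)}"
    proof -
      have "{v. \<forall>i<4. 0 < s i * (v \<bullet> e i)} = (\<Inter>i\<in>{..<4}. {v. 0 < s i * (v \<bullet> e i)})" by auto
      then show ?thesis by (auto intro!: open_INT open_Collect_less continuous_intros)
    qed
    then show "openin (top_of_set unit_sphere) (\<psi> ` D)"
      unfolding image openin_open by (intro exI[of _ "{v. \<forall>i<4. 0 < s i * (v \<bullet> e i)}"]) blast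
  qed (use \<open>open D\<close> smooth in auto)
  moreover have "x \<in> \<psi> ` D"
    unfolding image using x by (auto simp: s_def sgn_if linorder_neq_iff)
  moreover have "eigenvector_at (\<lambda>x v w. diag_form k x v x w) (\<psi> z) (coordinate_vector \<psi> z j)" if z: "z \<in> D" for z j
  proof -
    obtain lam \<mu> where "\<And>m. m < 4 \<Longrightarrow> (\<Sum>i<4. k i m * y i z * (d m j z - d i j z)) = lam * d m j z + \<mu>"
      using eig[OF z sum_d[OF z]] unfolding eigen_direction_def by blast
    then have "diag_form k (\<psi> z) (P z j) (\<psi> z) w = lam * (P z j \<bullet> w)" if "w \<in> tangent_space (\<psi> z)" for w
      using that \<psi>sq[OF z] by (intro diag_form_eigen[OF k, where d = "\<lambda>i. d i j z" and \<mu> = \<mu>])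
        (auto simp: Pe \<psi>e tangent_space_def)
    then show ?thesis
      unfolding eigenvector_at_def cv[OF z] using \<psi>P[OF z] P_nonzero[OF z] by (auto simp: tangent_space_def)
  qed
  ultimately show "\<exists>D \<psi>. coordinate_parametrisation D \<psi> \<and> x \<in> \<psi> ` D \<and>
      (\<forall>u\<in>D. \<forall>j. eigenvector_at (\<lambda>x v w. diag_form k x v x w) (\<psi> u) (coordinate_vector \<psi> u j))"
    by blast
qed

end


section \<open>Elliptic coordinates on the squares of the Cartesian coordinates\<close>

text \<open>Lagrange interpolation of the monic quadratic (t - z1)(t - z2) at the nodes a, b, c: the
  sum is its leading coefficient.\<close>

lemma lagrange_quadratic:
  fixes a b c z1 z2 :: real
  assumes "a \<noteq> b" "a \<noteq> c" "b \<noteq> c"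
  shows "(a - z1) * (a - z2) / ((a - b) * (a - c)) + (b - z1) * (b - z2) / ((b - a) * (b - c))
    + (c - z1) * (c - z2) / ((c - a) * (c - b)) = 1"
proof -
  have signs: "(b - a) * (b - c) = - ((a - b) * (b - c))" "(c - a) * (c - b) = (a - c) * (b - c)"
    by algebra+
  have "(a - z1) * (a - z2) * (b - c) - (b - z1) * (b - z2) * (a - c) + (c - z1) * (c - z2) * (a - b)
    = (a - b) * (a - c) * (b - c)" by algebra
  moreover have "u / (p * q) + v / - (p * r) + w / (q * r) = (u * r - v * q + w * p) / (p * q * r)"
    if "p \<noteq> 0" "q \<noteq> 0" "r \<noteq> 0" for u v w p q r :: real
    using that by (simp add: field_simps)
  ultimately show ?thesis unfolding signs using assms by simp
qed

text \<open>The leading coefficient of the monic cubic (t - z1)(t - z2)(t - z3), interpolated at the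
  nodes a, b, c, d.\<close>

lemma lagrange_cubic:
  fixes a b c d z1 z2 z3 :: real
  assumes "a \<noteq> b" "a \<noteq> c" "a \<noteq> d" "b \<noteq> c" "b \<noteq> d" "c \<noteq> d"
  shows "(a - z1) * (a - z2) * (a - z3) / ((a - b) * (a - c) * (a - d))
    + (b - z1) * (b - z2) * (b - z3) / ((b - a) * (b - c) * (b - d))
    + (c - z1) * (c - z2) * (c - z3) / ((c - a) * (c - b) * (c - d))
    + (d - z1) * (d - z2) * (d - z3) / ((d - a) * (d - b) * (d - c)) = 1"
proof -
  have signs: "(b - a) * (b - c) * (b - d) = - ((a - b) * (b - c) * (b - d))"
    "(c - a) * (c - b) * (c - d) = (a - c) * (b - c) * (c - d)"
    "(d - a) * (d - b) * (d - c) = - ((a - d) * (b - d) * (c - d))" by algebra+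
  have "(a - z1) * (a - z2) * (a - z3) * ((b - c) * (b - d) * (c - d))
      - (b - z1) * (b - z2) * (b - z3) * ((a - c) * (a - d) * (c - d))
      + (c - z1) * (c - z2) * (c - z3) * ((a - b) * (a - d) * (b - d))
      - (d - z1) * (d - z2) * (d - z3) * ((a - b) * (a - c) * (b - c))
      = (a - b) * (a - c) * (a - d) * (b - c) * (b - d) * (c - d)" by algebra
  moreover have "t / (p * q * r) + u / - (p * k * l) + v / (q * k * m) + w / - (r * l * m)
      = (t * (k * l * m) - u * (q * r * m) + v * (p * r * l) - w * (p * q * k)) / (p * q * r * k * l * m)"
    if "p \<noteq> 0" "q \<noteq> 0" "r \<noteq> 0" "k \<noteq> 0" "l \<noteq> 0" "m \<noteq> 0" for p q r k l m t u v w :: real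
    using that by (simp add: divide_simps) algebra
  ultimately show ?thesis unfolding signs using assms by simp
qed

text \<open>\<open>z\<^sub>1, z\<^sub>2\<close> are the roots of the monic polynomial
  \<open>p(t) = q\<^sub>a (t - b)(t - c) + q\<^sub>b (t - a)(t - c) + q\<^sub>c (t - a)(t - b)\<close>.
  They are real and distinct because \<open>p(a) p(b) p(c) < 0\<close>.\<close>

lemma elliptic_roots_quadratic:
  fixes a b c qa qb qc :: real
  assumes "a \<noteq> b" "a \<noteq> c" "b \<noteq> c" and q: "0 < qa" "0 < qb" "0 < qc" "qa + qb + qc = 1"
  obtains z1 z2 where "z1 < z2" "(a - z1) * (a - z2) = qa * ((a - b) * (a - c))"
    "(b - z1) * (b - z2) = qb * ((b - a) * (b - c))" "(c - z1) * (c - z2) = qc * ((c - a) * (c - b))"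
proof -
  define S where "S = qa * (b + c) + qb * (a + c) + qc * (a + b)"
  define Q where "Q = qa * b * c + qb * a * c + qc * a * b"
  define p where "p = (\<lambda>t. t^2 - S * t + Q)"
  have p: "p t = qa * ((t - b) * (t - c)) + qb * ((t - a) * (t - c)) + qc * ((t - a) * (t - b))" for t
    using q(4) unfolding p_def S_def Q_def by algebra
  have pv: "p a = qa * ((a - b) * (a - c))" "p b = qb * ((b - a) * (b - c))" "p c = qc * ((c - a) * (c - b))"
    unfolding p by algebra+
  have "p a * p b * p c = - (qa * qb * qc * ((a - b) * (a - c) * (b - c))\<^sup>2)"
    unfolding pv by algebra
  also have "\<dots> < 0" using assms by simp
  finally obtain t where "p t < 0" by (metis mult_nonneg_nonneg not_le)
  have "(S\<^sup>2 - 4 * Q) / 4 = (t - S / 2)^2 + - p t" by (simp add: p_def power2_eq_square field_simps)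
  also have "0 < \<dots>" using \<open>p t < 0\<close> by (intro add_nonneg_pos) simp_all
  finally have D: "0 < S\<^sup>2 - 4 * Q" by simp
  define r where "r = sqrt (S\<^sup>2 - 4 * Q)"
  have r: "0 < r" "r^2 = S\<^sup>2 - 4 * Q" using D by (auto simp: r_def)
  have f: "(t - (S - r) / 2) * (t - (S + r) / 2) = p t" for t
  proof -
    have "(t - (S - r) / 2) * (t - (S + r) / 2) = t^2 - S * t + (S\<^sup>2 - r^2) / 4"
      by (simp add: power2_eq_square field_simps)
    then show ?thesis using r(2) by (simp add: p_def)
  qed
  show thesis by (rule that[of "(S - r) / 2" "(S + r) / 2"]) (use r f pv in auto)
qed

lemma quadratic_three_roots:
  fixes A B C :: real
  assumes "A * a^2 + B * a + C = 0" "A * b^2 + B * b + C = 0" "A * c^2 + B * c + C = 0"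
    and "a \<noteq> b" "a \<noteq> c" "b \<noteq> c"
  shows "A = 0 \<and> B = 0 \<and> C = 0"
proof -
  have "(a - b) * (A * (a + b) + B) = 0" "(a - c) * (A * (a + c) + B) = 0"
    using assms(1-3) by algebra+
  then have ab: "A * (a + b) + B = 0" "A * (a + c) + B = 0" using assms by auto
  then have "A * (b - c) = 0" by algebra
  then show ?thesis using assms ab by auto
qed

text \<open>The monic cubic \<open>p\<close> with \<Sum> q_i \<Prod>_{m \<noteq> i} (t - a_m) as its
  value alternates in sign at a < b < c < d, hence has a root in each gap. It equals (t - z1)(t -
  z2)(t - z3), because the difference of the two is a quadratic with three roots.\<close>

lemma elliptic_roots_cubic:
  fixes a b c d qa qb qc qd :: real
  assumes ord: "a < b" "b < c" "c < d" and q: "0 < qa" "0 < qb" "0 < qc" "0 < qd" "qa + qb + qc + qd = 1"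
  obtains z1 z2 z3 where "z1 < z2" "z2 < z3"
    "(a - z1) * (a - z2) * (a - z3) = qa * ((a - b) * (a - c) * (a - d))"
    "(b - z1) * (b - z2) * (b - z3) = qb * ((b - a) * (b - c) * (b - d))"
    "(c - z1) * (c - z2) * (c - z3) = qc * ((c - a) * (c - b) * (c - d))"
    "(d - z1) * (d - z2) * (d - z3) = qd * ((d - a) * (d - b) * (d - c))"
proof -
  define p where "p = (\<lambda>t. qa * ((t - b) * (t - c) * (t - d)) + qb * ((t - a) * (t - c) * (t - d))
    + qc * ((t - a) * (t - b) * (t - d)) + qd * ((t - a) * (t - b) * (t - c)))"
  have pv: "p a = qa * ((a - b) * (a - c) * (a - d))" "p b = qb * ((b - a) * (b - c) * (b - d))"
    "p c = qc * ((c - a) * (c - b) * (c - d))" "p d = qd * ((d - a) * (d - b) * (d - c))"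
    unfolding p_def by algebra+
  have sg: "p a < 0" "0 < p b" "p c < 0" "0 < p d"
    unfolding pv using ord q by (auto simp: mult_less_0_iff zero_less_mult_iff)
  have cont: "continuous_on S p" for S unfolding p_def by (intro continuous_intros)
  obtain z1 where z1: "a \<le> z1" "z1 \<le> b" "p z1 = 0" using IVT'[of p a 0 b] cont sg ord by force
  obtain z2 where z2: "b \<le> z2" "z2 \<le> c" "p z2 = 0" using IVT2'[of p c 0 b] cont sg ord by force
  obtain z3 where z3: "c \<le> z3" "z3 \<le> d" "p z3 = 0" using IVT'[of p c 0 d] cont sg ord by force
  have "z1 \<noteq> b" "z2 \<noteq> b" "z2 \<noteq> c" "z3 \<noteq> c" using sg z1 z2 z3 by auto
  then have lt: "z1 < z2" "z2 < z3" using z1 z2 z3 by auto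
  define S where "S = qa * (b + c + d) + qb * (a + c + d) + qc * (a + b + d) + qd * (a + b + c)"
  define Q where "Q = qa * (b*c + b*d + c*d) + qb * (a*c + a*d + c*d) + qc * (a*b + a*d + b*d) + qd * (a*b + a*c + b*c)"
  define T where "T = qa * (b*c*d) + qb * (a*c*d) + qc * (a*b*d) + qd * (a*b*c)"
  have p: "p t = t^3 - S * t^2 + Q * t - T" for t
    using q(5) unfolding p_def S_def Q_def T_def by algebra
  have diff: "p t - (t - z1) * (t - z2) * (t - z3)
      = (z1 + z2 + z3 - S) * t^2 + (Q - z1*z2 - z1*z3 - z2*z3) * t + (z1*z2*z3 - T)" for t
    unfolding p by algebra
  have "z1 + z2 + z3 - S = 0 \<and> Q - z1*z2 - z1*z3 - z2*z3 = 0 \<and> z1*z2*z3 - T = 0"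
    by (rule quadratic_three_roots[of _ z1 _ _ z2 z3])
       (use diff[of z1] diff[of z2] diff[of z3] z1 z2 z3 lt in auto)
  then have "(t - z1) * (t - z2) * (t - z3) = p t" for t using diff[of t] by simp
  then show thesis using that[of z1 z2 z3] lt pv by metis
qed

lemma roots_quadratic_unique:
  fixes a b z1 z2 w1 w2 :: real
  assumes "(a - z1) * (a - z2) = (a - w1) * (a - w2)" "(b - z1) * (b - z2) = (b - w1) * (b - w2)"
    and "a \<noteq> b" "z1 < z2" "w1 < w2"
  shows "z1 = w1 \<and> z2 = w2"
proof -
  have "(a - b) * (z1 + z2 - w1 - w2) = 0" using assms(1,2) by algebra
  then have s: "z1 + z2 = w1 + w2" using \<open>a \<noteq> b\<close> by simp
  then have "z1 * z2 = w1 * w2" using assms(1) by algebra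
  then have "(z1 - w1) * (z1 - w2) = 0" "(z2 - w1) * (z2 - w2) = 0" using s by algebra+
  then show ?thesis using s assms(4,5) by auto
qed

lemma roots_cubic_unique:
  fixes a b c z1 z2 z3 w1 w2 w3 :: real
  assumes "(a - z1) * (a - z2) * (a - z3) = (a - w1) * (a - w2) * (a - w3)"
    "(b - z1) * (b - z2) * (b - z3) = (b - w1) * (b - w2) * (b - w3)"
    "(c - z1) * (c - z2) * (c - z3) = (c - w1) * (c - w2) * (c - w3)"
    and "a \<noteq> b" "a \<noteq> c" "b \<noteq> c" and lt: "z1 < z2" "z2 < z3" "w1 < w2" "w2 < w3"
  shows "z1 = w1 \<and> z2 = w2 \<and> z3 = w3"
proof -
  have diff: "(t - z1) * (t - z2) * (t - z3) - (t - w1) * (t - w2) * (t - w3)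
      = (w1 + w2 + w3 - z1 - z2 - z3) * t^2 + (z1*z2 + z1*z3 + z2*z3 - w1*w2 - w1*w3 - w2*w3) * t
        + (w1*w2*w3 - z1*z2*z3)" for t by algebra
  have "w1 + w2 + w3 - z1 - z2 - z3 = 0 \<and> z1*z2 + z1*z3 + z2*z3 - w1*w2 - w1*w3 - w2*w3 = 0 \<and> w1*w2*w3 - z1*z2*z3 = 0"
    by (rule quadratic_three_roots[of _ a _ _ b c])
       (use diff[of a] diff[of b] diff[of c] assms in auto)
  then have eq: "(t - z1) * (t - z2) * (t - z3) = (t - w1) * (t - w2) * (t - w3)" for t
    using diff[of t] by simp
  have "z1 \<in> {w1, w2, w3}" "z2 \<in> {w1, w2, w3}" "z3 \<in> {w1, w2, w3}"
    using eq[of z1] eq[of z2] eq[of z3] by auto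
  then show ?thesis using lt by auto
qed

section \<open>Coordinate systems on the three-sphere\<close>

text \<open>Serves as a table of four parameters and, with distinct entries below 4, as a
  renumbering of the frame.\<close>

definition vec4 :: "'b \<Rightarrow> 'b \<Rightarrow> 'b \<Rightarrow> 'b \<Rightarrow> nat \<Rightarrow> 'b" where
  "vec4 a b c d i = (if i = 0 then a else if i = 1 then b else if i = 2 then c else d)"

lemma vec4_simps [simp]:
  "vec4 a b c d 0 = a" "vec4 a b c d (Suc 0) = b" "vec4 a b c d 2 = c" "vec4 a b c d 3 = d"
  by (simp_all add: vec4_def)

lemma bij_vec4:
  assumes "distinct [p, q, r, s]" "p < 4" "q < 4" "r < 4" "s < (4::nat)"
  shows "bij_betw (vec4 p q r s) {..<4} {..<4}"
proof -
  have "inj_on (vec4 p q r s) {..<4}"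
  proof (rule inj_onI)
    fix x y assume "x \<in> {..<4::nat}" "y \<in> {..<4::nat}" "vec4 p q r s x = vec4 p q r s y"
    then show "x = y"
      using assms by (auto dest!: less_4_cases)
  qed
  moreover have "vec4 p q r s ` {..<4} \<subseteq> {..<4}" using assms by (auto simp: vec4_def)
  ultimately show ?thesis by (simp add: bij_betw_def endo_inj_surj)
qed

lemma orthonormal_frame_permute:
  assumes "orthonormal_frame e" "bij_betw \<tau> {..<4} {..<4}"
  shows "orthonormal_frame (e \<circ> \<tau>)"
proof -
  interpret orthonormal_frame e by (rule assms)
  show ?thesis
  proof
    fix i j :: nat assume ij: "i < 4" "j < 4"
    then have "\<tau> i < 4" "\<tau> j < 4" "\<tau> i = \<tau> j \<longleftrightarrow> i = j"
      using assms(2) by (auto simp: bij_betw_def inj_on_def)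
    then show "(e \<circ> \<tau>) i \<bullet> (e \<circ> \<tau>) j = (if i = j then 1 else 0)" by (simp add: orthonormal)
  qed (rule dim4)
qed

context orthonormal_frame
begin

lemma diag_form_permute:
  assumes "bij_betw \<tau> {..<4} {..<4}"
  shows "orthonormal_frame.diag_form (e \<circ> \<tau>) (\<lambda>i j. k (\<tau> i) (\<tau> j)) = diag_form k"
proof (intro ext)
  interpret p: orthonormal_frame "e \<circ> \<tau>"
    by (rule orthonormal_frame_permute[OF _ assms]) unfold_locales
  fix a b c d
  define f where "f = (\<lambda>i j. k i j * ((a \<bullet> e i) * (b \<bullet> e j) * ((c \<bullet> e i) * (d \<bullet> e j) - (c \<bullet> e j) * (d \<bullet> e i))))"
  have "p.diag_form (\<lambda>i j. k (\<tau> i) (\<tau> j)) a b c d = (\<Sum>i<4. \<Sum>j<4. f (\<tau> i) (\<tau> j))"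
    by (simp add: p.diag_form_def f_def)
  also have "\<dots> = (\<Sum>i<4. \<Sum>j<4. f (\<tau> i) j)"
    by (intro sum.cong refl sum.reindex_bij_betw[OF assms])
  also have "\<dots> = (\<Sum>i<4. \<Sum>j<4. f i j)"
    by (rule sum.reindex_bij_betw[OF assms, of "\<lambda>i. \<Sum>j<4. f i j"])
  finally show "p.diag_form (\<lambda>i j. k (\<tau> i) (\<tau> j)) a b c d = diag_form k a b c d"
    by (simp add: diag_form_def f_def)
qed

lemma separable_permute:
  assumes "bij_betw \<tau> {..<4} {..<4}"
    and "orthonormal_frame.separable (e \<circ> \<tau>) (\<lambda>i j. k (\<tau> i) (\<tau> j))"
  shows "separable k"
proof -
  interpret p: orthonormal_frame "e \<circ> \<tau>"
    by (rule orthonormal_frame_permute[OF _ assms(1)]) unfold_locales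
  have "(\<forall>i<4. x \<bullet> (e \<circ> \<tau>) i \<noteq> 0)" if "\<forall>i<4. x \<bullet> e i \<noteq> 0" for x
    using that assms(1) by (auto simp: bij_betw_def)
  then show ?thesis
    using assms(2) unfolding p.separable_def separable_def diag_form_permute[OF assms(1)] by blast
qed

end


text \<open>Partial fractions: d_i = 1/(z - a_i) gives d_m - d_i = (a_m - a_i) d_i d_m, and k_im
  turns the coefficient a_m - a_i into F_m - F_i. The sum splits into d_m F_m \<Sum> Y_i d_i, which
  vanishes, and -d_m \<Sum> Y_i d_i F_i, which exhibits the eigenvalue.\<close>

lemma elliptic_direction:
  fixes Y d a F :: "nat \<Rightarrow> real"
  assumes F: "\<And>i m. \<lbrakk>i < 4; m < 4\<rbrakk> \<Longrightarrow> k i m * (a m - a i) = F m - F i"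
    and d: "\<And>i. i < 4 \<Longrightarrow> d i * (a i - z) = -1"
    and Yd: "(\<Sum>i<4. Y i * d i) = 0"
  shows "eigen_direction k Y d"
  unfolding eigen_direction_def
proof (rule exI[of _ "- (\<Sum>i<4. Y i * d i * F i)"], rule exI[of _ 0], intro allI impI)
  fix m :: nat assume m: "m < 4"
  have "k i m * Y i * (d m - d i) = d m * (F m * (Y i * d i) - Y i * d i * F i)" if "i < 4" for i
  proof -
    have "d m - d i = (a m - a i) * d i * d m" using d[OF that] d[OF m] by algebra
    then have "k i m * Y i * (d m - d i) = (k i m * (a m - a i)) * Y i * d i * d m" by simp
    then show ?thesis unfolding F[OF that m] by (simp add: algebra_simps)
  qed
  then have "(\<Sum>i<4. k i m * Y i * (d m - d i)) = d m * (F m * (\<Sum>i<4. Y i * d i) - (\<Sum>i<4. Y i * d i * F i))"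
    by (simp add: sum_distrib_left sum_subtractf right_diff_distrib)
  then show "(\<Sum>i<4. k i m * Y i * (d m - d i)) = - (\<Sum>i<4. Y i * d i * F i) * d m + 0"
    unfolding Yd by simp
qed

text \<open>The same computation on the indices 1, 2, 3. Index 0 is coupled to them only by the
  common value \<kappa>, so it just adds \<kappa> Y_0 to the eigenvalue.\<close>

lemma elliptic_direction_cone:
  fixes Y d b F :: "nat \<Rightarrow> real"
  assumes k: "k 1 0 = \<kappa>" "k 2 0 = \<kappa>" "k 3 0 = \<kappa>" "k 0 1 = \<kappa>" "k 0 2 = \<kappa>" "k 0 3 = \<kappa>"
    and F: "\<And>i m. \<lbrakk>i \<in> {1,2,3}; m \<in> {1,2,3}\<rbrakk> \<Longrightarrow> k i m * (b m - b i) = F m - F i"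
    and d: "d 0 = 0" "\<And>i. i \<in> {1,2,3} \<Longrightarrow> d i * (b i - z) = -1"
    and Yd: "(\<Sum>i<4. Y i * d i) = 0"
  shows "eigen_direction k Y d"
  unfolding eigen_direction_def
proof (rule exI[of _ "\<kappa> * Y 0 - (Y 1 * d 1 * F 1 + Y 2 * d 2 * F 2 + Y 3 * d 3 * F 3)"], rule exI[of _ 0], intro allI impI)
  fix m :: nat assume m: "m < 4"
  have Yd': "Y 1 * d 1 + Y 2 * d 2 + Y 3 * d 3 = 0" using Yd d(1) by (simp add: sum_lessThan_4)
  show "(\<Sum>i<4. k i m * Y i * (d m - d i))
    = (\<kappa> * Y 0 - (Y 1 * d 1 * F 1 + Y 2 * d 2 * F 2 + Y 3 * d 3 * F 3)) * d m + 0"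
  proof (cases "m = 0")
    case True
    have "\<kappa> * (Y 1 * d 1 + Y 2 * d 2 + Y 3 * d 3) = 0" unfolding Yd' by simp
    then show ?thesis using True d(1) k by (simp add: sum_lessThan_4 algebra_simps)
  next
    case False
    then have m: "m \<in> {1,2,3}" using m by auto
    have "k i m * Y i * (d m - d i) = d m * (F m * (Y i * d i) - Y i * d i * F i)" if "i \<in> {1,2,3}" for i
    proof -
      have "d m - d i = (a - c) * d i * d m" if "d i * c = -1" "d m * a = -1" for a c
        using that by algebra
      from this[OF d(2)[OF that] d(2)[OF m]]
      have "k i m * Y i * (d m - d i) = (k i m * (b m - b i)) * Y i * d i * d m" by simp
      then show ?thesis unfolding F[OF that m] by (simp add: algebra_simps)
    qed
    note t = this[of 1] this[of 2] this[of 3]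
    have "k 0 m = \<kappa>" using m k by auto
    then have "(\<Sum>i<4. k i m * Y i * (d m - d i)) = d m * (\<kappa> * Y 0 + F m * (Y 1 * d 1 + Y 2 * d 2 + Y 3 * d 3)
      - (Y 1 * d 1 * F 1 + Y 2 * d 2 * F 2 + Y 3 * d 3 * F 3))"
      using t d(1) by (simp add: sum_lessThan_4 algebra_simps)
    then show ?thesis unfolding Yd' by (simp add: algebra_simps)
  qed
qed

text \<open>Directions in which the coordinates move in blocks: latitude from e_0; latitude between
  the planes e_0, e_1 and e_2, e_3; rotation in the plane e_2, e_3; rotation in the plane e_0, e_1;
  latitude from e_1 inside the sphere orthogonal to e_0.\<close>

lemma block_direction:
  fixes Y d :: "nat \<Rightarrow> real"
  assumes k: "\<And>i m. k i m = k m i" and Yd: "(\<Sum>i<4. Y i * d i) = 0"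
  shows
    "\<lbrakk>k 0 1 = \<kappa>; k 0 2 = \<kappa>; k 0 3 = \<kappa>; d 2 = d 1; d 3 = d 1\<rbrakk> \<Longrightarrow>
      eigen_direction k Y d"
    "\<lbrakk>k 0 2 = \<kappa>; k 0 3 = \<kappa>; k 1 2 = \<kappa>; k 1 3 = \<kappa>; d 1 = d 0; d 3 = d 2\<rbrakk> \<Longrightarrow> eigen_direction k Y d"
    "\<lbrakk>k 0 2 = k 0 3; k 1 2 = k 1 3; d 0 = 0; d 1 = 0\<rbrakk> \<Longrightarrow> eigen_direction k Y d"
    "\<lbrakk>k 0 2 = k 1 2; k 0 3 = k 1 3; d 2 = 0; d 3 = 0\<rbrakk> \<Longrightarrow> eigen_direction k Y d"
    "\<lbrakk>k 0 1 = \<kappa>; k 0 2 = \<kappa>; k 0 3 = \<kappa>; k 1 2 = k 1 3; d 0 = 0; d 3 = d 2\<rbrakk> \<Longrightarrow> eigen_direction k Y d"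
proof -
  have Yd: "Y 0 * d 0 + Y 1 * d 1 + Y 2 * d 2 + Y 3 * d 3 = 0" using Yd by (simp add: sum_lessThan_4)
  have k': "k 1 0 = k 0 1" "k 2 0 = k 0 2" "k 3 0 = k 0 3" "k 2 1 = k 1 2" "k 3 1 = k 1 3" "k 3 2 = k 2 3"
    by (rule k)+
  have E: "eigen_direction k Y d" if "\<exists>lam.
      k 0 1 * Y 1 * (d 0 - d 1) + k 0 2 * Y 2 * (d 0 - d 2) + k 0 3 * Y 3 * (d 0 - d 3) = lam * d 0 \<and>
      k 0 1 * Y 0 * (d 1 - d 0) + k 1 2 * Y 2 * (d 1 - d 2) + k 1 3 * Y 3 * (d 1 - d 3) = lam * d 1 \<and>
      k 0 2 * Y 0 * (d 2 - d 0) + k 1 2 * Y 1 * (d 2 - d 1) + k 2 3 * Y 3 * (d 2 - d 3) = lam * d 2 \<and>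
      k 0 3 * Y 0 * (d 3 - d 0) + k 1 3 * Y 1 * (d 3 - d 1) + k 2 3 * Y 2 * (d 3 - d 2) = lam * d 3"
  proof -
    from that obtain lam where
      "k 0 1 * Y 1 * (d 0 - d 1) + k 0 2 * Y 2 * (d 0 - d 2) + k 0 3 * Y 3 * (d 0 - d 3) = lam * d 0"
      "k 0 1 * Y 0 * (d 1 - d 0) + k 1 2 * Y 2 * (d 1 - d 2) + k 1 3 * Y 3 * (d 1 - d 3) = lam * d 1"
      "k 0 2 * Y 0 * (d 2 - d 0) + k 1 2 * Y 1 * (d 2 - d 1) + k 2 3 * Y 3 * (d 2 - d 3) = lam * d 2"
      "k 0 3 * Y 0 * (d 3 - d 0) + k 1 3 * Y 1 * (d 3 - d 1) + k 2 3 * Y 2 * (d 3 - d 2) = lam * d 3"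
      by blast
    then show ?thesis
      unfolding eigen_direction_def all_less_4 sum_lessThan_4 k'
      by (intro exI[of _ lam] exI[of _ 0]) simp
  qed
  show "eigen_direction k Y d" if "k 0 1 = \<kappa>" "k 0 2 = \<kappa>" "k 0 3 = \<kappa>" "d 2 = d 1" "d 3 = d 1"
    by (rule E, rule exI[of _ "\<kappa> * (Y 0 + Y 1 + Y 2 + Y 3)"])
       (use Yd in \<open>unfold that, intro conjI; algebra\<close>)
  show "eigen_direction k Y d" if "k 0 2 = \<kappa>" "k 0 3 = \<kappa>" "k 1 2 = \<kappa>" "k 1 3 = \<kappa>" "d 1 = d 0" "d 3 = d 2"
    by (rule E, rule exI[of _ "\<kappa> * (Y 0 + Y 1 + Y 2 + Y 3)"])
       (use Yd in \<open>unfold that, intro conjI; algebra\<close>)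
  show "eigen_direction k Y d" if "k 0 2 = k 0 3" "k 1 2 = k 1 3" "d 0 = 0" "d 1 = 0"
    by (rule E, rule exI[of _ "k 0 3 * Y 0 + k 1 3 * Y 1 + k 2 3 * (Y 2 + Y 3)"])
       (use Yd in \<open>unfold that, intro conjI; algebra\<close>)
  show "eigen_direction k Y d" if "k 0 2 = k 1 2" "k 0 3 = k 1 3" "d 2 = 0" "d 3 = 0"
    by (rule E, rule exI[of _ "k 1 2 * Y 2 + k 1 3 * Y 3 + k 0 1 * (Y 0 + Y 1)"])
       (use Yd in \<open>unfold that, intro conjI; algebra\<close>)
  show "eigen_direction k Y d" if "k 0 1 = \<kappa>" "k 0 2 = \<kappa>" "k 0 3 = \<kappa>" "k 1 2 = k 1 3" "d 0 = 0" "d 3 = d 2"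
    by (rule E, rule exI[of _ "\<kappa> * Y 0 + k 1 3 * (Y 1 + Y 2 + Y 3)"])
       (use Yd in \<open>unfold that, intro conjI; algebra\<close>)
qed

lemma log_slope_factor:
  assumes "affine_product \<alpha> \<beta> i z \<noteq> 0" "\<alpha> i j + \<beta> i j * z$j = c * (a - z$j)" "\<beta> i j = - c"
  shows "log_slope \<alpha> \<beta> i j z * (a - z$j) = -1"
proof -
  have "\<alpha> i j + \<beta> i j * z$j \<noteq> 0"
    using assms(1) unfolding affine_product_def by (metis UNIV_I finite prod_zero_iff)
  then show ?thesis using assms(2,3) by (auto simp: log_slope_def)
qed

section \<open>Elliptic, rotational elliptic, toroidal, spherical and conical coordinates\<close>

context orthonormal_frame
begin

text \<open>Elliptic coordinates: the z_j are the zeros of \<Sum> x_i^2 / (t - a_i), and conversely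
  x_i^2 = \<Prod>_j (a_i - z_j) / p_i with p_i = \<Prod>_{m \<noteq> i} (a_i - a_m).\<close>

lemma separable_elliptic_distinct:
  fixes a F :: "nat \<Rightarrow> real"
  assumes k: "\<And>i m. k i m = k m i" and ord: "a 0 < a 1" "a 1 < a 2" "a 2 < a 3"
    and F: "\<And>i m. \<lbrakk>i < 4; m < 4\<rbrakk> \<Longrightarrow> k i m * (a m - a i) = F m - F i"
  shows "separable k"
proof -
  define p where "p = vec4 ((a 0 - a 1) * (a 0 - a 2) * (a 0 - a 3)) ((a 1 - a 0) * (a 1 - a 2) * (a 1 - a 3))
    ((a 2 - a 0) * (a 2 - a 1) * (a 2 - a 3)) ((a 3 - a 0) * (a 3 - a 1) * (a 3 - a 2))"
  have p: "p i \<noteq> 0" if "i < 4" for i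
    using less_4_cases[OF that] ord by (elim disjE) (simp_all add: p_def)
  define c where "c = (\<lambda>i. 1 / p i)"
  \<comment> \<open>The normalisation 1/p_i is carried by the factor of the first
    coordinate.\<close>
  define \<alpha> :: "nat \<Rightarrow> 3 \<Rightarrow> real" where "\<alpha> = (\<lambda>i j. if j = 1 then c i * a i else a i)"
  define \<beta> :: "nat \<Rightarrow> 3 \<Rightarrow> real" where "\<beta> = (\<lambda>i j. if j = 1 then - c i else -1)"
  have y: "affine_product \<alpha> \<beta> i z = (a i - z$1) * (a i - z$2) * (a i - z$3) / p i" for i z
  proof -
    have "\<alpha> i 1 + \<beta> i 1 * z$1 = (a i - z$1) / p i"
      by (simp add: \<alpha>_def \<beta>_def c_def diff_divide_distrib)
    then show ?thesis unfolding affine_product_def prod_UNIV_3 by (simp add: \<alpha>_def \<beta>_def)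
  qed
  show ?thesis
  proof (rule separable_affine_product[where Z = "{z. z$1 < z$2 \<and> z$2 < z$3}" and \<alpha> = \<alpha> and \<beta> = \<beta>, OF k])
    show "open {z :: real^3. z$1 < z$2 \<and> z$2 < z$3}"
      by (intro open_Collect_conj open_Collect_less continuous_intros)
    show "(\<Sum>i<4. affine_product \<alpha> \<beta> i z) = 1" for z
      unfolding y sum_lessThan_4
      using lagrange_cubic[of "a 0" "a 1" "a 2" "a 3" "z$1" "z$2" "z$3"] ord by (simp add: p_def)
    show "z = z'" if "z \<in> {z \<in> {z. z$1 < z$2 \<and> z$2 < z$3}. \<forall>i<4. 0 < affine_product \<alpha> \<beta> i z}"
      "z' \<in> {z \<in> {z. z$1 < z$2 \<and> z$2 < z$3}. \<forall>i<4. 0 < affine_product \<alpha> \<beta> i z}"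
      "\<And>i. i < 4 \<Longrightarrow> affine_product \<alpha> \<beta> i z = affine_product \<alpha> \<beta> i z'" for z z'
    proof -
      have eq: "(a i - z$1) * (a i - z$2) * (a i - z$3) = (a i - z'$1) * (a i - z'$2) * (a i - z'$3)" if "i < 4" for i
        using \<open>\<And>i. i < 4 \<Longrightarrow> affine_product \<alpha> \<beta> i z = affine_product \<alpha> \<beta> i z'\<close>[OF that] p[OF that]
        unfolding y by simp
      have "z$1 = z'$1 \<and> z$2 = z'$2 \<and> z$3 = z'$3"
        by (rule roots_cubic_unique[OF eq[of 0] eq[of 1] eq[of 2]]) (use that ord in auto)
      then show "z = z'" by (simp add: vec_eq_iff forall_3)
    qed
    show "\<exists>z\<in>{z. z$1 < z$2 \<and> z$2 < z$3}. \<forall>i<4. affine_product \<alpha> \<beta> i z = q i"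
      if q: "\<And>i. i < 4 \<Longrightarrow> 0 < q i" "(\<Sum>i<4. q i) = 1" for q
    proof -
      obtain z1 z2 z3 where z: "z1 < z2" "z2 < z3"
        "(a 0 - z1) * (a 0 - z2) * (a 0 - z3) = q 0 * ((a 0 - a 1) * (a 0 - a 2) * (a 0 - a 3))"
        "(a 1 - z1) * (a 1 - z2) * (a 1 - z3) = q 1 * ((a 1 - a 0) * (a 1 - a 2) * (a 1 - a 3))"
        "(a 2 - z1) * (a 2 - z2) * (a 2 - z3) = q 2 * ((a 2 - a 0) * (a 2 - a 1) * (a 2 - a 3))"
        "(a 3 - z1) * (a 3 - z2) * (a 3 - z3) = q 3 * ((a 3 - a 0) * (a 3 - a 1) * (a 3 - a 2))"
        using elliptic_roots_cubic[OF ord, of "q 0" "q 1" "q 2" "q 3"] q(1)[of 0] q(1)[of 1] q(1)[of 2] q(1)[of 3] q(2)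
        by (auto simp: sum_lessThan_4)
      have "affine_product \<alpha> \<beta> i (vector [z1, z2, z3]) = q i" if "i < 4" for i
      proof -
        have "(a i - z1) * (a i - z2) * (a i - z3) = q i * p i"
          using less_4_cases[OF that] z by (elim disjE) (simp_all add: p_def)
        then show ?thesis using p[OF that] by (simp add: y)
      qed
      then show ?thesis using z by (intro bexI[of _ "vector [z1, z2, z3]"]) auto
    qed
    show "\<exists>i<4. \<beta> i j \<noteq> 0" for j
      using p[of 0] by (intro exI[of _ 0]) (simp add: \<beta>_def c_def)
    fix z j assume z: "z \<in> {z \<in> {z. z$1 < z$2 \<and> z$2 < z$3}. \<forall>i<4. 0 < affine_product \<alpha> \<beta> i z}"
      and Yd: "(\<Sum>i<4. affine_product \<alpha> \<beta> i z * log_slope \<alpha> \<beta> i j z) = 0"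
    have "log_slope \<alpha> \<beta> i j z * (a i - z$j) = -1" if "i < 4" for i
      by (rule log_slope_factor[where c = "if j = 1 then c i else 1"])
         (use z that in \<open>auto simp: \<alpha>_def \<beta>_def algebra_simps\<close>)
    from elliptic_direction[where F = F and a = a, OF F this Yd]
    show "eigen_direction k (\<lambda>i. affine_product \<alpha> \<beta> i z) (\<lambda>i. log_slope \<alpha> \<beta> i j z)" by simp
  qed
qed

text \<open>With a_3 = a_2, the sum x_2^2 + x_3^2 plays the part of a single square in elliptic
  coordinates for three parameters, and z_3 is the share of x_2^2 in it. The double parameter may
  lie outside or between the other two, so oblate and prolate coordinates are treated
  together.\<close>

lemma separable_oblate:
  fixes a F :: "nat \<Rightarrow> real"
  assumes k: "\<And>i m. k i m = k m i" and a: "a 0 \<noteq> a 1" "a 0 \<noteq> a 2" "a 1 \<noteq> a 2" "a 3 = a 2"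
    and F: "\<And>i m. \<lbrakk>i < 4; m < 4\<rbrakk> \<Longrightarrow> k i m * (a m - a i) = F m - F i"
    and k23: "k 0 2 = k 0 3" "k 1 2 = k 1 3"
  shows "separable k"
proof -
  define p where "p = vec4 ((a 0 - a 1) * (a 0 - a 2)) ((a 1 - a 0) * (a 1 - a 2))
    ((a 2 - a 0) * (a 2 - a 1)) ((a 2 - a 0) * (a 2 - a 1))"
  have p: "p i \<noteq> 0" if "i < 4" for i
    using less_4_cases[OF that] a by (elim disjE) (simp_all add: p_def)
  define c where "c = (\<lambda>i. 1 / p i)"
  define \<alpha> :: "nat \<Rightarrow> 3 \<Rightarrow> real" where
    "\<alpha> = (\<lambda>i j. if j = 1 then c i * a i else if j = 2 then a i else vec4 1 1 0 1 i)"
  define \<beta> :: "nat \<Rightarrow> 3 \<Rightarrow> real" where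
    "\<beta> = (\<lambda>i j. if j = 1 then - c i else if j = 2 then -1 else vec4 0 0 1 (-1) i)"
  have y: "affine_product \<alpha> \<beta> i z = (a i - z$1) * (a i - z$2) / p i * (vec4 1 1 0 1 i + vec4 0 0 1 (-1) i * z$3)" for i z
  proof -
    have "\<alpha> i 1 + \<beta> i 1 * z$1 = (a i - z$1) / p i"
      by (simp add: \<alpha>_def \<beta>_def c_def diff_divide_distrib)
    then show ?thesis unfolding affine_product_def prod_UNIV_3 by (simp add: \<alpha>_def \<beta>_def)
  qed
  define r where "r = (\<lambda>i (z::real^3). (a i - z$1) * (a i - z$2) / p i)"
  have y0: "affine_product \<alpha> \<beta> 0 z = r 0 z" and y1: "affine_product \<alpha> \<beta> 1 z = r 1 z"
    and y2: "affine_product \<alpha> \<beta> 2 z = r 2 z * z$3" and y3: "affine_product \<alpha> \<beta> 3 z = r 2 z * (1 - z$3)" for z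
    unfolding y r_def by (simp_all add: a(4) p_def)
  show ?thesis
  proof (rule separable_affine_product[where Z = "{z. z$1 < z$2}" and \<alpha> = \<alpha> and \<beta> = \<beta>, OF k])
    show "open {z :: real^3. z$1 < z$2}"
      by (intro open_Collect_less continuous_intros)
    show "(\<Sum>i<4. affine_product \<alpha> \<beta> i z) = 1" for z
    proof -
      have "r 0 z + r 1 z + r 2 z = 1"
        using lagrange_quadratic[OF a(1-3), of "z$1" "z$2"] by (simp add: r_def p_def)
      then show ?thesis unfolding sum_lessThan_4 y0 y1 y2 y3 by (simp add: algebra_simps)
    qed
    show "z = z'" if "z \<in> {z \<in> {z. z$1 < z$2}. \<forall>i<4. 0 < affine_product \<alpha> \<beta> i z}"
      "z' \<in> {z \<in> {z. z$1 < z$2}. \<forall>i<4. 0 < affine_product \<alpha> \<beta> i z}"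
      and eq: "\<And>i. i < 4 \<Longrightarrow> affine_product \<alpha> \<beta> i z = affine_product \<alpha> \<beta> i z'" for z z'
    proof -
      have r: "r 0 z = r 0 z'" "r 1 z = r 1 z'" "r 2 z * z$3 = r 2 z' * z'$3" "r 2 z * (1 - z$3) = r 2 z' * (1 - z'$3)"
        using eq[of 0] eq[of 1] eq[of 2] eq[of 3] unfolding y0 y1 y2 y3 by auto
      have "z$1 = z'$1 \<and> z$2 = z'$2"
        by (rule roots_quadratic_unique[of "a 0" _ _ _ _ "a 1"]) (use that r a p[of 0] p[of 1] in \<open>auto simp: r_def\<close>)
      moreover have "r 2 z = r 2 z'" using r(3,4) by (simp add: algebra_simps)
      moreover have "0 < r 2 z * z$3" using that(1) unfolding y2[symmetric] by auto
      ultimately have "z$1 = z'$1" "z$2 = z'$2" "z$3 = z'$3" using r(3) by auto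
      then show "z = z'" by (simp add: vec_eq_iff forall_3)
    qed
    show "\<exists>z\<in>{z. z$1 < z$2}. \<forall>i<4. affine_product \<alpha> \<beta> i z = q i"
      if q: "\<And>i. i < 4 \<Longrightarrow> 0 < q i" "(\<Sum>i<4. q i) = 1" for q
    proof -
      have q': "0 < q 0" "0 < q 1" "0 < q 2" "0 < q 3" using q(1) by auto
      obtain z1 z2 where z: "z1 < z2" "(a 0 - z1) * (a 0 - z2) = q 0 * ((a 0 - a 1) * (a 0 - a 2))"
        "(a 1 - z1) * (a 1 - z2) = q 1 * ((a 1 - a 0) * (a 1 - a 2))"
        "(a 2 - z1) * (a 2 - z2) = (q 2 + q 3) * ((a 2 - a 0) * (a 2 - a 1))"
        using elliptic_roots_quadratic[OF a(1-3), of "q 0" "q 1" "q 2 + q 3"] q' q(2)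
        by (auto simp: sum_lessThan_4)
      define z where "z = (vector [z1, z2, q 2 / (q 2 + q 3)] :: real^3)"
      have "r 0 z = q 0" "r 1 z = q 1" "r 2 z = q 2 + q 3"
        using z p[of 0] p[of 1] p[of 2] by (simp_all add: r_def z_def p_def)
      moreover have "1 - q 2 / (q 2 + q 3) = q 3 / (q 2 + q 3)" "q 2 + q 3 \<noteq> 0" using q' by (auto simp: field_simps)
      ultimately have "\<forall>i<4. affine_product \<alpha> \<beta> i z = q i"
        unfolding all_less_4 y0 y1 y2 y3 by (simp add: z_def)
      then show ?thesis using z by (intro bexI[of _ z]) (auto simp: z_def)
    qed
    show "\<exists>i<4. \<beta> i j \<noteq> 0" for j
      using p[of 2] by (intro exI[of _ 2]) (simp add: \<beta>_def c_def)
    fix z j assume z: "z \<in> {z \<in> {z. z$1 < z$2}. \<forall>i<4. 0 < affine_product \<alpha> \<beta> i z}"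
      and Yd: "(\<Sum>i<4. affine_product \<alpha> \<beta> i z * log_slope \<alpha> \<beta> i j z) = 0"
    show "eigen_direction k (\<lambda>i. affine_product \<alpha> \<beta> i z) (\<lambda>i. log_slope \<alpha> \<beta> i j z)"
    proof (cases "j = 3")
      case True
      show ?thesis
        by (rule block_direction(3)[OF k Yd k23]) (simp_all add: True log_slope_def \<beta>_def)
    next
      case False
      have "log_slope \<alpha> \<beta> i j z * (a i - z$j) = -1" if "i < 4" for i
        by (rule log_slope_factor[where c = "if j = 1 then c i else 1"])
           (use z that False exhaust_3[of j] in \<open>auto simp: \<alpha>_def \<beta>_def algebra_simps\<close>)
      from elliptic_direction[where F = F and a = a, OF F this Yd]
      show ?thesis by simp
    qed
  qed
qed

text \<open>Here z_1 = y_0 + y_1, while z_2 and z_3 are the shares of y_0 in y_0 + y_1 and of y_2 in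
  y_2 + y_3. Positivity of the y_i already confines all three to (0, 1).\<close>

lemma separable_toroidal:
  assumes k: "\<And>i m. k i m = k m i"
    and k': "k 0 2 = \<kappa>" "k 0 3 = \<kappa>" "k 1 2 = \<kappa>" "k 1 3 = \<kappa>"
  shows "separable k"
proof -
  define \<alpha> :: "nat \<Rightarrow> 3 \<Rightarrow> real" where
    "\<alpha> = (\<lambda>i j. if j = 1 then vec4 0 0 1 1 i else if j = 2 then vec4 0 1 1 1 i else vec4 1 1 0 1 i)"
  define \<beta> :: "nat \<Rightarrow> 3 \<Rightarrow> real" where
    "\<beta> = (\<lambda>i j. if j = 1 then vec4 1 1 (-1) (-1) i else if j = 2 then vec4 1 (-1) 0 0 i else vec4 0 0 1 (-1) i)"
  have y0: "affine_product \<alpha> \<beta> 0 z = z$1 * z$2" and y1: "affine_product \<alpha> \<beta> 1 z = z$1 * (1 - z$2)"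
    and y2: "affine_product \<alpha> \<beta> 2 z = (1 - z$1) * z$3" and y3: "affine_product \<alpha> \<beta> 3 z = (1 - z$1) * (1 - z$3)" for z
    unfolding affine_product_def prod_UNIV_3 by (simp_all add: \<alpha>_def \<beta>_def)
  show ?thesis
  proof (rule separable_affine_product[where Z = UNIV and \<alpha> = \<alpha> and \<beta> = \<beta>, OF k])
    show "open (UNIV :: (real^3) set)" by simp
    show "(\<Sum>i<4. affine_product \<alpha> \<beta> i z) = 1" for z
      unfolding sum_lessThan_4 y0 y1 y2 y3 by algebra
    show "z = z'" if z: "z \<in> {z \<in> UNIV. \<forall>i<4. 0 < affine_product \<alpha> \<beta> i z}"
      and eq: "\<And>i. i < 4 \<Longrightarrow> affine_product \<alpha> \<beta> i z = affine_product \<alpha> \<beta> i z'" for z z'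
    proof -
      have r: "z$1 * z$2 = z'$1 * z'$2" "z$1 * (1 - z$2) = z'$1 * (1 - z'$2)" "(1 - z$1) * z$3 = (1 - z'$1) * z'$3"
        using eq[of 0] eq[of 1] eq[of 2] unfolding y0 y1 y2 by auto
      have ne: "z$1 * z$2 \<noteq> 0" "(1 - z$1) * z$3 \<noteq> 0" using z unfolding y0[symmetric] y2[symmetric] by (auto simp: all_less_4)
      have "z$1 = z'$1" using r(1,2) by (simp add: algebra_simps)
      then have "z$1 = z'$1" "z$2 = z'$2" "z$3 = z'$3" using r ne by auto
      then show "z = z'" by (simp add: vec_eq_iff forall_3)
    qed
    show "\<exists>z\<in>UNIV. \<forall>i<4. affine_product \<alpha> \<beta> i z = q i"
      if q: "\<And>i. i < 4 \<Longrightarrow> 0 < q i" "(\<Sum>i<4. q i) = 1" for q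
    proof -
      have q': "0 < q 0" "0 < q 1" "0 < q 2" "0 < q 3" using q(1) by auto
      have sum: "1 - (q 0 + q 1) = q 2 + q 3" using q(2) by (simp add: sum_lessThan_4)
      have frac: "1 - q 0 / (q 0 + q 1) = q 1 / (q 0 + q 1)" "1 - q 2 / (q 2 + q 3) = q 3 / (q 2 + q 3)"
        using q' by (auto simp: field_simps)
      define z where "z = (vector [q 0 + q 1, q 0 / (q 0 + q 1), q 2 / (q 2 + q 3)] :: real^3)"
      have "\<forall>i<4. affine_product \<alpha> \<beta> i z = q i"
        unfolding all_less_4 y0 y1 y2 y3 using q' by (simp add: z_def sum[simplified] frac[simplified])
      then show ?thesis by blast
    qed
    show "\<exists>i<4. \<beta> i j \<noteq> 0" for j
      using exhaust_3[of j] by (elim disjE; intro exI[of _ "if j = 3 then 2 else 0"]) (simp_all add: \<beta>_def)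
    fix z j assume Yd: "(\<Sum>i<4. affine_product \<alpha> \<beta> i z * log_slope \<alpha> \<beta> i j z) = 0"
    have "j = 1 \<or> j = 2 \<or> j = 3" by (rule exhaust_3)
    then show "eigen_direction k (\<lambda>i. affine_product \<alpha> \<beta> i z) (\<lambda>i. log_slope \<alpha> \<beta> i j z)"
    proof (elim disjE)
      assume "j = 1"
      then show ?thesis
        by (intro block_direction(2)[where \<kappa> = \<kappa>, OF k Yd]) (simp_all add: log_slope_def \<alpha>_def \<beta>_def k'[simplified])
    next
      assume "j = 2"
      then show ?thesis
        by (intro block_direction(4)[OF k Yd]) (simp_all add: log_slope_def \<alpha>_def \<beta>_def k'[simplified])
    next
      assume "j = 3"
      then show ?thesis
        by (intro block_direction(3)[OF k Yd]) (simp_all add: log_slope_def \<alpha>_def \<beta>_def k'[simplified])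
    qed
  qed
qed

text \<open>Here z_1 = y_0, z_2 is the share of y_1 in y_1 + y_2 + y_3, and z_3 that of y_2 in y_2 +
  y_3: a latitude, a second latitude and a longitude, expressed by squares.\<close>

lemma separable_spherical:
  assumes k: "\<And>i m. k i m = k m i"
    and k': "k 0 1 = \<kappa>" "k 0 2 = \<kappa>" "k 0 3 = \<kappa>" "k 1 2 = k 1 3"
  shows "separable k"
proof -
  define \<alpha> :: "nat \<Rightarrow> 3 \<Rightarrow> real" where
    "\<alpha> = (\<lambda>i j. if j = 1 then vec4 0 1 1 1 i else if j = 2 then vec4 1 0 1 1 i else vec4 1 1 0 1 i)"
  define \<beta> :: "nat \<Rightarrow> 3 \<Rightarrow> real" where
    "\<beta> = (\<lambda>i j. if j = 1 then vec4 1 (-1) (-1) (-1) i else if j = 2 then vec4 0 1 (-1) (-1) i else vec4 0 0 1 (-1) i)"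
  have y0: "affine_product \<alpha> \<beta> 0 z = z$1" and y1: "affine_product \<alpha> \<beta> 1 z = (1 - z$1) * z$2"
    and y2: "affine_product \<alpha> \<beta> 2 z = (1 - z$1) * (1 - z$2) * z$3"
    and y3: "affine_product \<alpha> \<beta> 3 z = (1 - z$1) * (1 - z$2) * (1 - z$3)" for z
    unfolding affine_product_def prod_UNIV_3 by (simp_all add: \<alpha>_def \<beta>_def)
  show ?thesis
  proof (rule separable_affine_product[where Z = UNIV and \<alpha> = \<alpha> and \<beta> = \<beta>, OF k])
    show "open (UNIV :: (real^3) set)" by simp
    show "(\<Sum>i<4. affine_product \<alpha> \<beta> i z) = 1" for z
      unfolding sum_lessThan_4 y0 y1 y2 y3 by algebra
    show "z = z'" if z: "z \<in> {z \<in> UNIV. \<forall>i<4. 0 < affine_product \<alpha> \<beta> i z}"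
      and eq: "\<And>i. i < 4 \<Longrightarrow> affine_product \<alpha> \<beta> i z = affine_product \<alpha> \<beta> i z'" for z z'
    proof -
      have r: "z$1 = z'$1" "(1 - z$1) * z$2 = (1 - z'$1) * z'$2"
          "(1 - z$1) * (1 - z$2) * z$3 = (1 - z'$1) * (1 - z'$2) * z'$3"
        using eq[of 0] eq[of 1] eq[of 2] unfolding y0 y1 y2 by auto
      have ne: "(1 - z$1) * (1 - z$2) * z$3 \<noteq> 0" using z unfolding y2[symmetric] by (auto simp: all_less_4)
      then have "z$1 = z'$1" "z$2 = z'$2" "z$3 = z'$3" using r by auto
      then show "z = z'" by (simp add: vec_eq_iff forall_3)
    qed
    show "\<exists>z\<in>UNIV. \<forall>i<4. affine_product \<alpha> \<beta> i z = q i"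
      if q: "\<And>i. i < 4 \<Longrightarrow> 0 < q i" "(\<Sum>i<4. q i) = 1" for q
    proof -
      have q': "0 < q 0" "0 < q 1" "0 < q 2" "0 < q 3" using q(1) by auto
      have sum: "1 - q 0 = q 1 + q 2 + q 3" using q(2) by (simp add: sum_lessThan_4)
      have frac: "1 - q 1 / (q 1 + q 2 + q 3) = (q 2 + q 3) / (q 1 + q 2 + q 3)" "1 - q 2 / (q 2 + q 3) = q 3 / (q 2 + q 3)"
        using q' by (auto simp: field_simps)
      define z where "z = (vector [q 0, q 1 / (q 1 + q 2 + q 3), q 2 / (q 2 + q 3)] :: real^3)"
      have "q 1 + q 2 + q 3 \<noteq> 0" "q 2 + q 3 \<noteq> 0" using q' by auto
      then have "\<forall>i<4. affine_product \<alpha> \<beta> i z = q i"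
        unfolding all_less_4 y0 y1 y2 y3 by (simp add: z_def sum[simplified] frac[simplified])
      then show ?thesis by blast
    qed
    show "\<exists>i<4. \<beta> i j \<noteq> 0" for j
      using exhaust_3[of j] by (intro exI[of _ 2]) (auto simp: \<beta>_def)
    fix z j assume Yd: "(\<Sum>i<4. affine_product \<alpha> \<beta> i z * log_slope \<alpha> \<beta> i j z) = 0"
    have "j = 1 \<or> j = 2 \<or> j = 3" by (rule exhaust_3)
    then show "eigen_direction k (\<lambda>i. affine_product \<alpha> \<beta> i z) (\<lambda>i. log_slope \<alpha> \<beta> i j z)"
    proof (elim disjE)
      assume "j = 1"
      then show ?thesis
        by (intro block_direction(1)[where \<kappa> = \<kappa>, OF k Yd]) (simp_all add: log_slope_def \<alpha>_def \<beta>_def k'[simplified])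
    next
      assume "j = 2"
      then show ?thesis
        by (intro block_direction(5)[where \<kappa> = \<kappa>, OF k Yd]) (simp_all add: log_slope_def \<alpha>_def \<beta>_def k'[simplified])
    next
      assume "j = 3"
      then show ?thesis
        by (intro block_direction(3)[OF k Yd]) (simp_all add: log_slope_def \<alpha>_def \<beta>_def k'[simplified])
    qed
  qed
qed

text \<open>The coordinate z_1 = y_0 is a latitude from e_0; z_2, z_3 are elliptic coordinates on
  the two-sphere of the normalised remaining components, with parameters b_i.\<close>

lemma separable_cone:
  assumes k: "\<And>i m. k i m = k m i"
    and k': "k 0 1 = \<kappa>" "k 0 2 = \<kappa>" "k 0 3 = \<kappa>"
    and ne: "k 1 2 \<noteq> k 1 3" "k 1 2 \<noteq> k 2 3" "k 1 3 \<noteq> k 2 3"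
  shows "separable k"
proof -
  define b where "b = vec4 0 (k 2 3) (k 1 3) (k 1 2)"
  \<comment> \<open>For distinct i, m in {1, 2, 3} the value k_im is the remaining parameter, b_1 +
    b_2 + b_3 - b_i - b_m, which is the divided difference of this quadratic at b_i, b_m.\<close>
  define F where "F = (\<lambda>i. (b 1 + b 2 + b 3) * b i - b i ^ 2)"
  define p where "p = vec4 1 ((b 1 - b 2) * (b 1 - b 3)) ((b 2 - b 1) * (b 2 - b 3)) ((b 3 - b 1) * (b 3 - b 2))"
  have b: "b 1 \<noteq> b 2" "b 1 \<noteq> b 3" "b 2 \<noteq> b 3" using ne by (simp_all add: b_def)
  have p: "p i \<noteq> 0" if "i < 4" for i
    using less_4_cases[OF that] b by (elim disjE) (simp_all add: p_def)
  define \<alpha> :: "nat \<Rightarrow> 3 \<Rightarrow> real" where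
    "\<alpha> = (\<lambda>i j. if j = 1 then vec4 0 1 1 1 i else if i = 0 then 1 else if j = 2 then b i / p i else b i)"
  define \<beta> :: "nat \<Rightarrow> 3 \<Rightarrow> real" where
    "\<beta> = (\<lambda>i j. if j = 1 then vec4 1 (-1) (-1) (-1) i else if i = 0 then 0 else if j = 2 then -1 / p i else -1)"
  define r where "r = (\<lambda>i (z::real^3). (b i - z$2) * (b i - z$3) / p i)"
  have y0: "affine_product \<alpha> \<beta> 0 z = z$1" for z
    unfolding affine_product_def prod_UNIV_3 by (simp add: \<alpha>_def \<beta>_def)
  have y: "affine_product \<alpha> \<beta> i z = (1 - z$1) * r i z" if "i \<in> {1,2,3}" for i z
    using that unfolding affine_product_def prod_UNIV_3
    by (auto simp: \<alpha>_def \<beta>_def r_def diff_divide_distrib left_diff_distrib)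
  have y': "affine_product \<alpha> \<beta> 1 z = (1 - z$1) * r 1 z" "affine_product \<alpha> \<beta> 2 z = (1 - z$1) * r 2 z"
    "affine_product \<alpha> \<beta> 3 z = (1 - z$1) * r 3 z" for z
    by (intro y; simp)+
  have r_sum: "r 1 z + r 2 z + r 3 z = 1" for z
    using lagrange_quadratic[OF b, of "z$2" "z$3"] by (simp add: r_def p_def)
  show ?thesis
  proof (rule separable_affine_product[where Z = "{z. z$2 < z$3}" and \<alpha> = \<alpha> and \<beta> = \<beta>, OF k])
    show "open {z :: real^3. z$2 < z$3}"
      by (intro open_Collect_less continuous_intros)
    show sum1: "(\<Sum>i<4. affine_product \<alpha> \<beta> i z) = 1" for z
      unfolding sum_lessThan_4 y0 y' using r_sum[of z] by algebra
    show "z = z'" if z: "z \<in> {z \<in> {z. z$2 < z$3}. \<forall>i<4. 0 < affine_product \<alpha> \<beta> i z}"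
      "z' \<in> {z \<in> {z. z$2 < z$3}. \<forall>i<4. 0 < affine_product \<alpha> \<beta> i z}"
      and eq: "\<And>i. i < 4 \<Longrightarrow> affine_product \<alpha> \<beta> i z = affine_product \<alpha> \<beta> i z'" for z z'
    proof -
      have 1: "z$1 = z'$1" "(1 - z$1) * r 1 z = (1 - z'$1) * r 1 z'" "(1 - z$1) * r 2 z = (1 - z'$1) * r 2 z'"
        using eq[of 0] eq[of 1] eq[of 2] unfolding y0 y' by auto
      have "(1 - z$1) * r 1 z \<noteq> 0" using z(1) unfolding y'[symmetric] by (auto simp: all_less_4)
      then have "r 1 z = r 1 z'" "r 2 z = r 2 z'" using 1 by auto
      then have "z$2 = z'$2 \<and> z$3 = z'$3"
        by (intro roots_quadratic_unique[of "b 1" _ _ _ _ "b 2"]) (use z b p[of 1] p[of 2] in \<open>auto simp: r_def\<close>)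
      then show "z = z'" using 1 by (simp add: vec_eq_iff forall_3)
    qed
    show "\<exists>z\<in>{z. z$2 < z$3}. \<forall>i<4. affine_product \<alpha> \<beta> i z = q i"
      if q: "\<And>i. i < 4 \<Longrightarrow> 0 < q i" "(\<Sum>i<4. q i) = 1" for q
    proof -
      have q': "0 < q 0" "0 < q 1" "0 < q 2" "0 < q 3" using q(1) by auto
      define s where "s = q 1 + q 2 + q 3"
      have s: "0 < s" "1 - q 0 = s" using q' q(2) by (simp_all add: sum_lessThan_4 s_def)
      have "q 1 / s + q 2 / s + q 3 / s = 1" using s by (simp add: s_def add_divide_distrib[symmetric])
      then obtain z1 z2 where z: "z1 < z2" "(b 1 - z1) * (b 1 - z2) = q 1 / s * ((b 1 - b 2) * (b 1 - b 3))"
        "(b 2 - z1) * (b 2 - z2) = q 2 / s * ((b 2 - b 1) * (b 2 - b 3))"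
        "(b 3 - z1) * (b 3 - z2) = q 3 / s * ((b 3 - b 1) * (b 3 - b 2))"
        using elliptic_roots_quadratic[OF b, of "q 1 / s" "q 2 / s" "q 3 / s"] q' s by auto
      define z where "z = (vector [q 0, z1, z2] :: real^3)"
      have "r 1 z = q 1 / s" "r 2 z = q 2 / s" "r 3 z = q 3 / s"
        using z p[of 1] p[of 2] p[of 3] by (simp_all add: r_def z_def p_def)
      then have "\<forall>i<4. affine_product \<alpha> \<beta> i z = q i"
        unfolding all_less_4 y0 y' using s by (simp add: z_def)
      then show ?thesis using z by (intro bexI[of _ z]) (auto simp: z_def)
    qed
    show "\<exists>i<4. \<beta> i j \<noteq> 0" for j
      using exhaust_3[of j] p[of 1] by (intro exI[of _ 1]) (auto simp: \<beta>_def)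
    fix z j assume z: "z \<in> {z \<in> {z. z$2 < z$3}. \<forall>i<4. 0 < affine_product \<alpha> \<beta> i z}"
      and Yd: "(\<Sum>i<4. affine_product \<alpha> \<beta> i z * log_slope \<alpha> \<beta> i j z) = 0"
    show "eigen_direction k (\<lambda>i. affine_product \<alpha> \<beta> i z) (\<lambda>i. log_slope \<alpha> \<beta> i j z)"
    proof (cases "j = 1")
      case True
      then show ?thesis
        by (intro block_direction(1)[where \<kappa> = \<kappa>, OF k Yd]) (simp_all add: log_slope_def \<alpha>_def \<beta>_def k'[simplified])
    next
      case False
      have ne: "affine_product \<alpha> \<beta> i z \<noteq> 0" if "i \<in> {1,2,3}" for i
        using z that by (auto simp: all_less_4)
      have d: "log_slope \<alpha> \<beta> i j z * (b i - z$j) = -1" if "i \<in> {1,2,3}" for i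
        by (rule log_slope_factor[where c = "if j = 2 then 1 / p i else 1", OF ne[OF that]])
           (use that False in \<open>auto simp: \<alpha>_def \<beta>_def diff_divide_distrib left_diff_distrib\<close>)
      have F: "k i m * (b m - b i) = F m - F i" if "i \<in> {1,2,3}" "m \<in> {1,2,3}" for i m
      proof (cases "i = m")
        case False
        then have "k i m = b 1 + b 2 + b 3 - b i - b m"
          using that k[of 2 1] k[of 3 1] k[of 3 2] by (auto simp: b_def)
        then show ?thesis unfolding F_def by algebra
      qed simp
      show ?thesis
        by (rule elliptic_direction_cone[where b = b and F = F and \<kappa> = \<kappa> and z = "z$j", OF _ _ _ k' F _ d Yd])
           (use k k' False in \<open>auto simp: log_slope_def \<beta>_def\<close>)
    qed
  qed
qed

end


section \<open>Vanishing determinant implies integrability\<close>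

text \<open>k_pq is expressed by the complementary indices r, s, as suits divided differences:
  removing p and q from a symmetric function of all four parameters leaves one of a_r and
  a_s.\<close>

definition elliptic :: "(nat \<Rightarrow> nat \<Rightarrow> real) \<Rightarrow> (nat \<Rightarrow> nat \<Rightarrow> real) \<Rightarrow> bool" where
  "elliptic k f \<longleftrightarrow> (\<forall>p q r s. distinct [p, q, r, s] \<and> p < 4 \<and> q < 4 \<and> r < 4 \<and> s < 4 \<longrightarrow> k p q = f r s)"

lemma elliptic_six:
  assumes k: "\<And>i m. k i m = k m i" and f: "\<And>i m. f i m = f m i"
    and d: "distinct [p, q, r, s]" "p < 4" "q < 4" "r < 4" "s < 4"
    and E: "k p q = f r s" "k p r = f q s" "k p s = f q r" "k q r = f p s" "k q s = f p r" "k r s = f p q"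
  shows "elliptic k f"
  unfolding elliptic_def
proof (intro allI impI)
  fix x y z u :: nat
  assume a: "distinct [x, y, z, u] \<and> x < 4 \<and> y < 4 \<and> z < 4 \<and> u < 4"
  have "card {p, q, r, s} = card {..<4::nat}" using d by simp
  then have all: "{p, q, r, s} = {..<4}" by (intro card_subset_eq) (use d in auto)
  have "k q p = f r s" "k r p = f q s" "k s p = f q r" "k r q = f p s" "k s q = f p r" "k s r = f p q"
    "k p q = f s r" "k p r = f s q" "k p s = f r q" "k q r = f s p" "k q s = f r p" "k r s = f q p"
    "k q p = f s r" "k r p = f s q" "k s p = f r q" "k r q = f s p" "k s q = f r p" "k s r = f q p"
    using E k f by metis+
  moreover have "x \<in> {p, q, r, s}" "y \<in> {p, q, r, s}" "z \<in> {p, q, r, s}" "u \<in> {p, q, r, s}"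
    using a unfolding all by auto
  ultimately show "k x y = f z u" using a E by auto
qed

text \<open>The first assumption says that the points (s_i, P_i) of the plane are collinear, the
  second that their line is not vertical or degenerate to one abscissa; \<alpha> is its
  slope.\<close>

lemma common_shift:
  fixes P1 P2 P3 s1 s2 s3 :: real
  assumes "P1 * (s2 - s3) + P2 * (s3 - s1) + P3 * (s1 - s2) = 0" "\<not> (s1 = s2 \<and> s2 = s3)"
  obtains \<alpha> where "P1 - \<alpha> * s1 = P2 - \<alpha> * s2" "P2 - \<alpha> * s2 = P3 - \<alpha> * s3"
proof (cases "s1 = s2")
  case False
  define \<alpha> where "\<alpha> = (P1 - P2) / (s1 - s2)"
  have 1: "\<alpha> * (s1 - s2) = P1 - P2" using False by (simp add: \<alpha>_def)
  have "(s1 - s2) * (P2 - \<alpha> * s2 - (P3 - \<alpha> * s3)) = 0" using 1 assms(1) by algebra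
  then have 2: "P2 - \<alpha> * s2 - (P3 - \<alpha> * s3) = 0" using False by simp
  show thesis by (rule that[of \<alpha>]) (use 1 2 in \<open>simp_all add: algebra_simps\<close>)
next
  case True
  then have ne: "s2 \<noteq> s3" using assms(2) by simp
  define \<alpha> where "\<alpha> = (P2 - P3) / (s2 - s3)"
  have 1: "\<alpha> * (s2 - s3) = P2 - P3" using ne by (simp add: \<alpha>_def)
  have "(s2 - s3) * (P1 - P2) = 0" using assms(1) True by algebra
  then have 2: "P1 - P2 = 0" using ne by simp
  show thesis
  proof (rule that[of \<alpha>])
    show "P1 - \<alpha> * s1 = P2 - \<alpha> * s2" using True 2 by simp
    show "P2 - \<alpha> * s2 = P3 - \<alpha> * s3" using 1 by (simp add: algebra_simps)
  qed
qed

text \<open>Solves k_ij = A + C a_k a_l for complementary pairs. The equations at the vertex p let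
  a_q, a_r, a_s be the reciprocals of the three differences k_pi - A, with their product as C; the
  value k_qr then gives a_p, and equality of the opposite products yields the other two
  equations.\<close>

lemma elliptic_product:
  assumes k: "\<And>i m. k i m = k m i" and d: "distinct [p, q, r, s]" "p < 4" "q < 4" "r < 4" "s < 4"
    and ne: "k p q \<noteq> A" "k p r \<noteq> A" "k p s \<noteq> A"
    and eq: "(k p q - A) * (k r s - A) = (k p r - A) * (k q s - A)" "(k p r - A) * (k q s - A) = (k p s - A) * (k q r - A)"
  obtains a C where "elliptic k (\<lambda>i j. A + 0 * (a i + a j) + C * (a i * a j))"
proof -
  define a where "a = (\<lambda>i. if i = p then (k q r - A) / ((k p q - A) * (k p r - A)) else 1 / (k p i - A))"
  define C where "C = (k p q - A) * (k p r - A) * (k p s - A)"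
  have a: "a p = (k q r - A) / ((k p q - A) * (k p r - A))" "a q = 1 / (k p q - A)" "a r = 1 / (k p r - A)" "a s = 1 / (k p s - A)"
    using d by (auto simp: a_def)
  define x y z where "x = k p q - A" and "y = k p r - A" and "z = k p s - A"
  define u v w where "u = k q r - A" and "v = k q s - A" and "w = k r s - A"
  have K: "k p q = A + x" "k p r = A + y" "k p s = A + z" "k q r = A + u" "k q s = A + v" "k r s = A + w"
    by (simp_all add: x_def y_def z_def u_def v_def w_def)
  have ne': "x \<noteq> 0" "y \<noteq> 0" "z \<noteq> 0" using ne by (simp_all add: x_def y_def z_def)
  have eq': "x * w = y * v" "y * v = z * u" using eq by (simp_all add: x_def y_def z_def u_def v_def w_def)
  have a': "a p = u / (x * y)" "a q = 1 / x" "a r = 1 / y" "a s = 1 / z"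
    unfolding a by (simp_all add: x_def y_def z_def u_def)
  have C': "C = x * y * z" by (simp add: C_def x_def y_def z_def)
  have "elliptic k (\<lambda>i j. A + 0 * (a i + a j) + C * (a i * a j))"
  proof (rule elliptic_six[OF k _ d])
    show "k p q = A + 0 * (a r + a s) + C * (a r * a s)" "k p r = A + 0 * (a q + a s) + C * (a q * a s)"
      "k p s = A + 0 * (a q + a r) + C * (a q * a r)" "k q r = A + 0 * (a p + a s) + C * (a p * a s)"
      "k q s = A + 0 * (a p + a r) + C * (a p * a r)" "k r s = A + 0 * (a p + a q) + C * (a p * a q)"
      unfolding a' C' K using ne' eq' by (simp_all add: field_simps)
  qed (simp add: mult.commute)
  then show thesis using that by blast
qed

lemma det_assoc_matrix:
  "det (assoc_matrix w t) = (w$2 - w$3) * (w$3 - w$1) * (w$1 - w$2)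
    + (w$2 - w$3) * (t$1)\<^sup>2 + (w$3 - w$1) * (t$2)\<^sup>2 + (w$1 - w$2) * (t$3)\<^sup>2"
  unfolding det_3 assoc_matrix_def matrix_form_def by (simp add: power2_eq_square algebra_simps)

lemma trace_assoc_matrix: "trace (assoc_matrix w t) = 0"
  unfolding trace_def sum_3 assoc_matrix_def matrix_form_def by simp

lemma det_zero_classification:
  assumes k: "\<And>i m. k i m = k m i"
    and K: "k 0 1 = w$1 + t$1 + s/12" "k 0 2 = w$2 + t$2 + s/12" "k 0 3 = w$3 + t$3 + s/12"
    "k 2 3 = w$1 - t$1 + s/12" "k 1 3 = w$2 - t$2 + s/12" "k 1 2 = w$3 - t$3 + s/12"
    and w: "w$1 + w$2 + w$3 = (0::real)" and det: "det (assoc_matrix w t) = 0"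
  shows "(\<exists>a A B C. elliptic k (\<lambda>i j. A + B * (a i + a j) + C * (a i * a j)))
    \<or> (\<exists>i<4. \<exists>\<kappa>. \<forall>j<4. j \<noteq> i \<longrightarrow> k i j = \<kappa>)"
proof (cases "w$1 = w$2 \<and> w$2 = w$3")
  case True
  then have w0: "w$1 = 0" "w$2 = 0" "w$3 = 0" using w by auto
  \<comment> \<open>With w = 0 the values k_ij - s/12 are opposite on complementary pairs, so a_k +
    a_l = k_ij - s/12 is solvable; this is a solution.\<close>
  define a where "a = vec4 (- (t$1 + t$2 + t$3) / 2) ((- t$1 + t$2 + t$3) / 2) ((t$1 - t$2 + t$3) / 2) ((t$1 + t$2 - t$3) / 2)"
  have "elliptic k (\<lambda>i j. s/12 + 1 * (a i + a j) + 0 * (a i * a j))"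
    by (rule elliptic_six[OF k, of _ 0 1 2 3]) (auto simp: K[simplified] w0 a_def field_simps)
  then show ?thesis by blast
next
  case False
  define x where "x = s / 12"
  \<comment> \<open>The coefficients 2 w_b - 2 w_c are the differences of the sums of opposite
    values, which brings the determinant into the form of a collinearity condition.\<close>
  have "(k 0 1 * k 2 3) * (2 * w$2 - 2 * w$3) + (k 0 2 * k 1 3) * (2 * w$3 - 2 * w$1) + (k 0 3 * k 1 2) * (2 * w$1 - 2 * w$2) = 0"
    using det w unfolding det_assoc_matrix K x_def[symmetric] by algebra
  then have "(k 0 1 * k 2 3) * ((k 0 2 + k 1 3) - (k 0 3 + k 1 2)) + (k 0 2 * k 1 3) * ((k 0 3 + k 1 2) - (k 0 1 + k 2 3))
      + (k 0 3 * k 1 2) * ((k 0 1 + k 2 3) - (k 0 2 + k 1 3)) = 0"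
    unfolding K x_def[symmetric] by algebra
  moreover have "\<not> (k 0 1 + k 2 3 = k 0 2 + k 1 3 \<and> k 0 2 + k 1 3 = k 0 3 + k 1 2)"
    using False unfolding K by auto
  ultimately obtain A where A: "k 0 1 * k 2 3 - A * (k 0 1 + k 2 3) = k 0 2 * k 1 3 - A * (k 0 2 + k 1 3)"
    "k 0 2 * k 1 3 - A * (k 0 2 + k 1 3) = k 0 3 * k 1 2 - A * (k 0 3 + k 1 2)"
    by (rule common_shift)
  have eq: "(k 0 1 - A) * (k 2 3 - A) = (k 0 2 - A) * (k 1 3 - A)" "(k 0 2 - A) * (k 1 3 - A) = (k 0 3 - A) * (k 1 2 - A)"
    using A by algebra+
  have k': "k 1 0 = k 0 1" "k 2 0 = k 0 2" "k 3 0 = k 0 3" "k 2 1 = k 1 2" "k 3 1 = k 1 3" "k 3 2 = k 2 3"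
    by (rule k)+
  have vertex: ?thesis if "distinct [p, q, r, s]" "p < 4" "q < 4" "r < 4" "s < 4"
    "k p q \<noteq> A" "k p r \<noteq> A" "k p s \<noteq> A" "(k p q - A) * (k r s - A) = (k p r - A) * (k q s - A)"
    "(k p r - A) * (k q s - A) = (k p s - A) * (k q r - A)" for p q r s
    using elliptic_product[OF k that] by metis
  \<comment> \<open>If the common product is non-zero, so are all k_ij - A. Otherwise one edge of
    each opposite pair of the tetrahedron {0, 1, 2, 3} vanishes, and three such edges form a star or
    a triangle. In the case of a triangle, the other edges form the star of the fourth vertex:
    either none of them vanishes, or one that does completes a vanishing star.\<close>
  consider "k 0 1 \<noteq> A" "k 0 2 \<noteq> A" "k 0 3 \<noteq> A" | "k 0 1 \<noteq> A" "k 1 2 \<noteq> A" "k 1 3 \<noteq> A"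
    | "k 0 2 \<noteq> A" "k 1 2 \<noteq> A" "k 2 3 \<noteq> A" | "k 0 3 \<noteq> A" "k 1 3 \<noteq> A" "k 2 3 \<noteq> A"
    | "k 0 1 = A" "k 0 2 = A" "k 0 3 = A" | "k 0 1 = A" "k 1 2 = A" "k 1 3 = A"
    | "k 0 2 = A" "k 1 2 = A" "k 2 3 = A" | "k 0 3 = A" "k 1 3 = A" "k 2 3 = A"
  proof -
    have "(k 0 1 \<noteq> A \<and> k 0 2 \<noteq> A \<and> k 0 3 \<noteq> A) \<or> (k 0 1 = A \<or> k 2 3 = A) \<and> (k 0 2 = A \<or> k 1 3 = A) \<and> (k 0 3 = A \<or> k 1 2 = A)"
    proof (cases "(k 0 1 - A) * (k 2 3 - A) = 0")
      case True
      then have "(k 0 2 - A) * (k 1 3 - A) = 0" "(k 0 3 - A) * (k 1 2 - A) = 0" using eq by metis+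
      then show ?thesis using True by simp
    next
      case False
      then have "(k 0 2 - A) * (k 1 3 - A) \<noteq> 0" "(k 0 3 - A) * (k 1 2 - A) \<noteq> 0" using eq by metis+
      then show ?thesis using False by simp
    qed
    then show thesis using that by blast
  qed
  then show ?thesis
  proof cases
    case 1
    then show ?thesis using eq by (intro vertex[of 0 1 2 3]) auto
  next
    case 2
    then show ?thesis using eq k' by (intro vertex[of 1 0 2 3]) (auto simp: mult.commute)
  next
    case 3
    then show ?thesis using eq k' by (intro vertex[of 2 0 1 3]) (auto simp: mult.commute)
  next
    case 4
    then show ?thesis using eq k' by (intro vertex[of 3 0 1 2]) (auto simp: mult.commute)
  next
    case 5
    then have "\<forall>j<4. j \<noteq> 0 \<longrightarrow> k 0 j = A" unfolding all_less_4 by simp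
    then show ?thesis by (intro disjI2 exI[of _ 0]) auto
  next
    case 6
    then have "\<forall>j<4. j \<noteq> 1 \<longrightarrow> k 1 j = A" using k' unfolding all_less_4 by simp
    then show ?thesis by (intro disjI2 exI[of _ 1]) auto
  next
    case 7
    then have "\<forall>j<4. j \<noteq> 2 \<longrightarrow> k 2 j = A" using k' unfolding all_less_4 by simp
    then show ?thesis by (intro disjI2 exI[of _ 2]) auto
  next
    case 8
    then have "\<forall>j<4. j \<noteq> 3 \<longrightarrow> k 3 j = A" using k' unfolding all_less_4 by simp
    then show ?thesis by (intro disjI2 exI[of _ 3]) auto
  qed
qed

lemma complete_to_four:
  assumes "i < 4" "j < (4::nat)" "i \<noteq> j"
  shows "\<exists>r s. distinct [i, j, r, s] \<and> r < 4 \<and> s < 4"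
proof -
  have "card ({..<4} - {i, j}) = 2" using assms by simp
  then obtain r s where "{..<4} - {i, j} = {r, s}" "r \<noteq> s" by (auto simp: card_2_iff)
  then have "r \<in> {..<4} - {i, j}" "s \<in> {..<4} - {i, j}" by auto
  then have "distinct [i, j, r, s] \<and> r < 4 \<and> s < 4" using \<open>i \<noteq> j\<close> \<open>r \<noteq> s\<close> by auto
  then show ?thesis by blast
qed

lemma sorting_permutation:
  fixes a :: "nat \<Rightarrow> real"
  assumes "inj_on a {..<4}"
  obtains \<tau> where "bij_betw \<tau> {..<4::nat} {..<4::nat}" "a (\<tau> 0) < a (\<tau> 1)" "a (\<tau> 1) < a (\<tau> 2)" "a (\<tau> 2) < a (\<tau> 3)"
proof -
  define ys where "ys = sort_key a [0..<4]"
  have ys: "distinct ys" "set ys = {..<4}" "length ys = 4" "sorted (map a ys)"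
    by (auto simp: ys_def)
  have "a (ys ! i) < a (ys ! j)" if "i < j" "j < 4" for i j
  proof -
    have "a (ys ! i) \<le> a (ys ! j)" using sorted_nth_mono[OF ys(4), of i j] that ys(3) by simp
    moreover have "ys ! i \<noteq> ys ! j" using ys(1,3) that by (simp add: nth_eq_iff_index_eq)
    moreover have "ys ! i < 4" "ys ! j < 4" using ys(2,3) that nth_mem[of i ys] nth_mem[of j ys] by auto
    ultimately show ?thesis using assms by (auto simp: inj_on_def order_le_less)
  qed
  then show thesis
    using ys by (intro that[of "(!) ys"] bij_betw_nth) auto
qed

section \<open>Choice of coordinates according to the coincidences in each normal form\<close>

context orthonormal_frame
begin

lemma separable_vec4:
  assumes "distinct [p, q, r, s]" "p < 4" "q < 4" "r < 4" "s < 4"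
    and "\<And>f :: nat \<Rightarrow> 'a. orthonormal_frame f \<Longrightarrow>
      orthonormal_frame.separable f (\<lambda>i j. k (vec4 p q r s i) (vec4 p q r s j))"
  shows "separable k"
  using assms(6) orthonormal_frame_permute[OF _ bij_vec4[OF assms(1-5)]] separable_permute[OF bij_vec4[OF assms(1-5)]]
    orthonormal_frame_axioms by blast

text \<open>The distinguished index is numbered 0. Any two of the three remaining edges meet in a
  vertex, so if two of their values coincide, a renumbering gives spherical coordinates; if all
  three differ, they serve as parameters of conical coordinates.\<close>

lemma separable_star:
  assumes k: "\<And>i m. k i m = k m i" and "i < 4" and star: "\<And>j. \<lbrakk>j < 4; j \<noteq> i\<rbrakk> \<Longrightarrow> k i j = \<kappa>"
  shows "separable k"
proof -
  obtain p q r where d: "distinct [i, p, q, r]" "p < 4" "q < 4" "r < 4"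
  proof (cases "i < 3")
    case True
    then show thesis using that[of "if i = 0 then 1 else 0" "if i = 2 then 1 else 2" 3] \<open>i < 4\<close> by auto
  next
    case False
    then show thesis using that[of 0 1 2] \<open>i < 4\<close> by auto
  qed
  have spherical: "separable k" if "distinct [i, p, q, r]" "p < 4" "q < 4" "r < 4" "k p q = k p r" for p q r
  proof (rule separable_vec4[OF that(1) \<open>i < 4\<close> that(2-4)])
    fix f :: "nat \<Rightarrow> 'a" assume "orthonormal_frame f"
    then interpret f: orthonormal_frame f .
    show "f.separable (\<lambda>a b. k (vec4 i p q r a) (vec4 i p q r b))"
      by (rule f.separable_spherical[where \<kappa> = \<kappa>], rule k) (use that star in simp_all)
  qed
  consider "k p q = k p r" | "k q p = k q r" | "k r p = k r q"
    | "k p q \<noteq> k p r" "k p q \<noteq> k q r" "k p r \<noteq> k q r" using k by metis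
  then show ?thesis
  proof cases
    case 4
    show ?thesis
    proof (rule separable_vec4[OF d(1) \<open>i < 4\<close> d(2-4)])
      fix f :: "nat \<Rightarrow> 'a" assume "orthonormal_frame f"
      then interpret f: orthonormal_frame f .
      show "f.separable (\<lambda>a b. k (vec4 i p q r a) (vec4 i p q r b))"
        by (rule f.separable_cone[where \<kappa> = \<kappa>], rule k) (use 4 d star in simp_all)
    qed
  qed (use d spherical[of p q r] spherical[of q p r] spherical[of r p q] in auto)
qed

text \<open>Distinct a_i give elliptic coordinates, a single coincidence oblate or prolate ones, two
  disjoint coincidences toroidal ones. If three a_i agree, the k_ij at the fourth index are all
  equal, which leads back to the star.\<close>

lemma separable_elliptic:
  assumes k: "\<And>i m. k i m = k m i" and ell: "elliptic k (\<lambda>i j. A + B * (a i + a j) + C * (a i * a j))"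
  shows "separable k"
proof -
  define \<sigma> where "\<sigma> = a 0 + a 1 + a 2 + a 3"
  define \<epsilon> where "\<epsilon> = a 0 * a 1 + a 0 * a 2 + a 0 * a 3 + a 1 * a 2 + a 1 * a 3 + a 2 * a 3"
  \<comment> \<open>The cubic in a_i whose divided difference at a_i, a_m is A + B (a_r + a_s) + C
    a_r a_s; \<sigma> and \<epsilon> are the first two elementary symmetric functions of the four
    parameters.\<close>
  define F where "F = (\<lambda>i. A * a i + B * (\<sigma> * a i - (a i)\<^sup>2) + C * (\<epsilon> * a i - \<sigma> * (a i)\<^sup>2 + (a i)^3))"
  have ell': "k p q = A + B * (a r + a s) + C * (a r * a s)"
    if "distinct [p, q, r, s]" "p < 4" "q < 4" "r < 4" "s < 4" for p q r s
    using ell that unfolding elliptic_def by blast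
  have F: "k i m * (a m - a i) = F m - F i" if im: "i < 4" "m < 4" for i m
  proof -
    have pair: "k i m * (a m - a i) = F m - F i" if "distinct [i, m, r, s]" "i < 4" "m < 4" "r < 4" "s < 4" for i m r s
    proof -
      have "{i, m, r, s} = {..<4::nat}"
        by (rule card_subset_eq) (use that in auto)
      \<comment> \<open>Sums over the index set do not depend on the numbering; \<sigma> and
        \<epsilon> are recovered from the first two power sums.\<close>
      moreover have "(\<Sum>j\<in>{i, m, r, s}. a j) = a i + a m + a r + a s" "(\<Sum>j\<in>{i, m, r, s}. (a j)\<^sup>2) = (a i)\<^sup>2 + (a m)\<^sup>2 + (a r)\<^sup>2 + (a s)\<^sup>2"
        using that by auto
      ultimately have "\<sigma> = a i + a m + a r + a s" "(a 0)\<^sup>2 + (a 1)\<^sup>2 + (a 2)\<^sup>2 + (a 3)\<^sup>2 = (a i)\<^sup>2 + (a m)\<^sup>2 + (a r)\<^sup>2 + (a s)\<^sup>2"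
        unfolding \<sigma>_def by (simp_all add: sum_lessThan_4)
      moreover have "\<sigma>\<^sup>2 - 2 * \<epsilon> = (a 0)\<^sup>2 + (a 1)\<^sup>2 + (a 2)\<^sup>2 + (a 3)\<^sup>2"
        unfolding \<sigma>_def \<epsilon>_def by algebra
      ultimately have \<sigma>: "\<sigma> = a i + a m + a r + a s" and "\<sigma>\<^sup>2 - 2 * \<epsilon> = (a i)\<^sup>2 + (a m)\<^sup>2 + (a r)\<^sup>2 + (a s)\<^sup>2"
        by simp_all
      then have \<epsilon>: "\<epsilon> = a i * a m + a i * a r + a i * a s + a m * a r + a m * a s + a r * a s" by algebra
      show ?thesis unfolding ell'[OF that] F_def \<sigma> \<epsilon> by algebra
    qed
    show ?thesis
    proof (cases "i = m")
      case False
      then obtain r s where "distinct [i, m, r, s]" "r < 4" "s < 4"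
        using complete_to_four[OF im] by blast
      then show ?thesis using pair im by blast
    qed simp
  qed
  show ?thesis
  proof (cases "inj_on a {..<4}")
    case True
    then obtain \<tau> where \<tau>: "bij_betw \<tau> {..<4::nat} {..<4::nat}" "a (\<tau> 0) < a (\<tau> 1)" "a (\<tau> 1) < a (\<tau> 2)" "a (\<tau> 2) < a (\<tau> 3)"
      by (rule sorting_permutation)
    interpret p: orthonormal_frame "e \<circ> \<tau>"
      by (rule orthonormal_frame_permute[OF _ \<tau>(1)]) unfold_locales
    have "\<tau> i < 4" if "i < 4" for i using \<tau>(1) that by (auto simp: bij_betw_def)
    then show ?thesis
      by (intro separable_permute[OF \<tau>(1)] p.separable_elliptic_distinct[where a = "a \<circ> \<tau>" and F = "F \<circ> \<tau>"])
         (use \<tau> F k in auto)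
  next
    case False
    then obtain r s where rs: "r < 4" "s < 4" "r \<noteq> s" "a r = a s" by (auto simp: inj_on_def)
    then obtain p q where d: "distinct [p, q, r, s]" "p < 4" "q < 4"
      using complete_to_four[of r s] by auto
    have K: "k p q = A + B * (a s + a s) + C * (a s * a s)" "k r s = A + B * (a p + a q) + C * (a p * a q)"
      "k p r = A + B * (a q + a s) + C * (a q * a s)" "k p s = A + B * (a q + a s) + C * (a q * a s)"
      "k q r = A + B * (a p + a s) + C * (a p * a s)" "k q s = A + B * (a p + a s) + C * (a p * a s)"
      using ell'[of p q r s] ell'[of r s p q] ell'[of p r q s] ell'[of p s q r] ell'[of q r p s] ell'[of q s p r] d rs
      by auto
    have cases_j: "j = p \<or> j = q \<or> j = r \<or> j = s" if "j < 4" for j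
    proof -
      have "{p, q, r, s} = {..<4::nat}" by (rule card_subset_eq) (use d rs in auto)
      then show ?thesis using that by auto
    qed
    consider "a p \<noteq> a q" "a p \<noteq> a r" "a q \<noteq> a r" | "a p = a q" "a p \<noteq> a r" | "a q = a r" | "a p = a r" by auto
    then show ?thesis
    proof cases
      case 1
      show ?thesis
      proof (rule separable_vec4[OF d rs(1,2)])
        fix f :: "nat \<Rightarrow> 'a" assume "orthonormal_frame f"
        then interpret f: orthonormal_frame f .
        have lt: "vec4 p q r s i < 4" for i using d rs by (simp add: vec4_def)
        show "f.separable (\<lambda>i j. k (vec4 p q r s i) (vec4 p q r s j))"
        proof (rule f.separable_oblate[where a = "\<lambda>i. a (vec4 p q r s i)" and F = "\<lambda>i. F (vec4 p q r s i)"])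
          show "k (vec4 p q r s i) (vec4 p q r s m) = k (vec4 p q r s m) (vec4 p q r s i)" for i m by (rule k)
          show "k (vec4 p q r s i) (vec4 p q r s m) * (a (vec4 p q r s m) - a (vec4 p q r s i))
            = F (vec4 p q r s m) - F (vec4 p q r s i)" for i m by (intro F lt)
        qed (use 1 rs K in simp_all)
      qed
    next
      case 2
      show ?thesis
      proof (rule separable_vec4[OF d rs(1,2)])
        fix f :: "nat \<Rightarrow> 'a" assume "orthonormal_frame f"
        then interpret f: orthonormal_frame f .
        show "f.separable (\<lambda>i j. k (vec4 p q r s i) (vec4 p q r s j))"
          by (rule f.separable_toroidal[where \<kappa> = "k p r"], rule k) (use 2 rs K in simp_all)
      qed
    next
      case 3
      then have "k p j = k p q" if "j < 4" "j \<noteq> p" for j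
        using cases_j[OF that(1)] that(2) K rs by auto
      then show ?thesis by (rule separable_star[OF k d(2)])
    next
      case 4
      then have "k q j = k q p" if "j < 4" "j \<noteq> q" for j
        using cases_j[OF that(1)] that(2) K rs k[of p q] by auto
      then show ?thesis by (rule separable_star[OF k d(3)])
    qed
  qed
qed

lemma dense_nonzero_coordinates:
  "openin (top_of_set unit_sphere) {x \<in> unit_sphere. \<forall>i<4. x \<bullet> e i \<noteq> 0}"
  "unit_sphere \<subseteq> closure {x \<in> unit_sphere. \<forall>i<4. x \<bullet> e i \<noteq> 0}"
proof -
  let ?U = "{x \<in> unit_sphere. \<forall>i<4. x \<bullet> e i \<noteq> 0}"
  have "open (\<Inter>i\<in>{..<4}. {x. x \<bullet> e i \<noteq> 0})"
    by (intro open_INT finite_lessThan ballI open_Collect_neq continuous_intros)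
  then show "openin (top_of_set unit_sphere) ?U"
    unfolding openin_open by (intro exI[of _ "\<Inter>i\<in>{..<4}. {x. x \<bullet> e i \<noteq> 0}"]) auto
  show "unit_sphere \<subseteq> closure ?U"
  proof
    fix x :: 'a assume x: "x \<in> unit_sphere"
    \<comment> \<open>Adding a positive multiple of \<open>s\<close> moves every coordinate away
      from zero, those equal to zero included.\<close>
    define s where "s = (\<Sum>i<4. (if 0 \<le> x \<bullet> e i then 1 else -1) *\<^sub>R e i)"
    define y where "y = (\<lambda>n. sgn (x + (1 / real (Suc n)) *\<^sub>R s))"
    have ne: "(x + (1 / real (Suc n)) *\<^sub>R s) \<bullet> e i \<noteq> 0" if "i < 4" for n i
    proof -
      define c where "c = 1 / real (Suc n)"
      have c: "0 < c" by (simp add: c_def)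
      have eq: "(x + c *\<^sub>R s) \<bullet> e i = x \<bullet> e i + c * (if 0 \<le> x \<bullet> e i then 1 else -1)"
        using that by (simp add: s_def inner_add_left inner_combination)
      show ?thesis unfolding c_def[symmetric] eq using c by (cases "0 \<le> x \<bullet> e i") auto
    qed
    have "y n \<in> ?U" for n
    proof -
      have "x + (1 / real (Suc n)) *\<^sub>R s \<noteq> 0" using ne[of 0 n] by auto
      moreover have "y n \<bullet> e i \<noteq> 0" if "i < 4" for i
        using ne[OF that, of n] calculation by (simp add: y_def sgn_div_norm)
      ultimately show ?thesis by (simp add: y_def norm_sgn)
    qed
    moreover have "y \<longlonglongrightarrow> sgn (x + 0 *\<^sub>R s)"
      unfolding y_def using x
      by (intro tendsto_intros LIMSEQ_Suc[OF lim_1_over_n]) auto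
    then have "y \<longlonglongrightarrow> x" using x by (simp add: sgn_div_norm)
    ultimately show "x \<in> closure ?U" unfolding closure_sequential by blast
  qed
qed

lemma separable_imp_integrable:
  assumes "separable (sec R)" and R: "R = diag_form (sec R)" and KR: "corresponds K R"
  shows "integrable_tensor K"
  unfolding integrable_tensor_def
proof (rule exI[of _ "{x \<in> unit_sphere. \<forall>i<4. x \<bullet> e i \<noteq> 0}"], intro conjI ballI)
  show "openin (top_of_set unit_sphere) {x \<in> unit_sphere. \<forall>i<4. x \<bullet> e i \<noteq> 0}"
    "unit_sphere \<subseteq> closure {x \<in> unit_sphere. \<forall>i<4. x \<bullet> e i \<noteq> 0}"
    by (rule dense_nonzero_coordinates)+
  fix x assume "x \<in> {x \<in> unit_sphere. \<forall>i<4. x \<bullet> e i \<noteq> 0}"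
  then obtain D \<psi> where D: "coordinate_parametrisation D \<psi>" "x \<in> \<psi> ` D"
    "\<And>u j. u \<in> D \<Longrightarrow> eigenvector_at (\<lambda>x v w. diag_form (sec R) x v x w) (\<psi> u) (coordinate_vector \<psi> u j)"
    using assms(1) unfolding separable_def by blast
  have "eigenvector_at K (\<psi> u) (coordinate_vector \<psi> u j)" if "u \<in> D" for u j
  proof -
    have "\<psi> u \<in> unit_sphere"
      using D(1) that openin_imp_subset unfolding coordinate_parametrisation_def by blast
    then show ?thesis
      using D(3)[OF that, of j] KR unfolding eigenvector_at_def corresponds_def R[symmetric] by metis
  qed
  then show "\<exists>D \<psi>. coordinate_parametrisation D \<psi> \<and> x \<in> \<psi> ` D \<and>
      (\<forall>u\<in>D. \<forall>i. eigenvector_at K (\<psi> u) (coordinate_vector \<psi> u i))"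
    using D by blast
qed

lemma det_zero_imp_integrable:
  assumes R: "diagonal_curvature_tensor e R w t s" and "corresponds K R" and "det (assoc_matrix w t) = 0"
  shows "integrable_tensor K"
proof -
  note D = diagonal_curvature_tensorD[OF R]
  consider a A B C where "elliptic (sec R) (\<lambda>i j. A + B * (a i + a j) + C * (a i * a j))"
    | i \<kappa> where "i < 4" "\<And>j. \<lbrakk>j < 4; j \<noteq> i\<rbrakk> \<Longrightarrow> sec R i j = \<kappa>"
    using det_zero_classification[where k = "sec R", OF D(2) D(4-10) assms(3)] by blast
  then have "separable (sec R)"
  proof cases
    case 1
    then show ?thesis by (rule separable_elliptic[OF D(2)])
  next
    case 2
    then show ?thesis by (rule separable_star[OF D(2)])
  qed
  then show ?thesis by (rule separable_imp_integrable[OF _ D(1) assms(2)])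
qed

end


section \<open>Integrability implies vanishing determinant\<close>

text \<open>Here \<open>l\<^sub>a\<close> are the eigenvalues at a point, \<open>T\<^sub>a\<close> is \<open>(\<nabla>\<^bsub>X\<^sub>a\<^esub> K)(X\<^sub>b, X\<^sub>c)\<close> and \<open>G\<^sub>c\<close> is
  \<open>\<partial>\<^sub>a \<partial>\<^sub>b \<psi> \<bullet> X\<^sub>c\<close> with \<open>{a, b, c} = {1, 2, 3}\<close>.\<close>

lemma eigenvalue_cancellation:
  fixes l1 l2 l3 :: real
  assumes "l2 \<noteq> l3 \<Longrightarrow> T1 = (l2 - l3) * G3 \<and> T1 = (l3 - l2) * G2"
    and "l3 \<noteq> l1 \<Longrightarrow> T2 = (l3 - l1) * G1 \<and> T2 = (l1 - l3) * G3"
    and "l1 \<noteq> l2 \<Longrightarrow> T3 = (l1 - l2) * G2 \<and> T3 = (l2 - l1) * G1"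
  shows "l1 * (l3 - l2) * T1 + l2 * (l1 - l3) * T2 + l3 * (l2 - l1) * T3 = 0"
proof -
  have "(l3 - l2) * T1 = - (l3 - l2)\<^sup>2 * G3 \<and> (l3 - l2) * T1 = (l3 - l2)\<^sup>2 * G2"
  proof (cases "l2 = l3")
    case False
    then have "T1 = (l2 - l3) * G3" "T1 = (l3 - l2) * G2" using assms(1) by blast+
    then show ?thesis by (intro conjI; algebra)
  qed simp
  then have A1: "(l3 - l2) * T1 = - (l3 - l2)\<^sup>2 * G3" "(l3 - l2) * T1 = (l3 - l2)\<^sup>2 * G2"
    by blast+
  have "(l1 - l3) * T2 = - (l1 - l3)\<^sup>2 * G1 \<and> (l1 - l3) * T2 = (l1 - l3)\<^sup>2 * G3"
  proof (cases "l3 = l1")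
    case False
    then have "T2 = (l3 - l1) * G1" "T2 = (l1 - l3) * G3" using assms(2) by blast+
    then show ?thesis by (intro conjI; algebra)
  qed simp
  then have A2: "(l1 - l3) * T2 = - (l1 - l3)\<^sup>2 * G1" "(l1 - l3) * T2 = (l1 - l3)\<^sup>2 * G3"
    by blast+
  have "(l2 - l1) * T3 = - (l2 - l1)\<^sup>2 * G2 \<and> (l2 - l1) * T3 = (l2 - l1)\<^sup>2 * G1"
  proof (cases "l1 = l2")
    case False
    then have "T3 = (l1 - l2) * G2" "T3 = (l2 - l1) * G1" using assms(3) by blast+
    then show ?thesis by (intro conjI; algebra)
  qed simp
  then have A3: "(l2 - l1) * T3 = - (l2 - l1)\<^sup>2 * G2" "(l2 - l1) * T3 = (l2 - l1)\<^sup>2 * G1"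
    by blast+
  have "(l3 - l2)\<^sup>2 * (G2 + G3) = 0" "(l1 - l3)\<^sup>2 * (G1 + G3) = 0" "(l2 - l1)\<^sup>2 * (G1 + G2) = 0"
    using A1 A2 A3 by algebra+
  then have z: "l3 = l2 \<or> G2 + G3 = 0" "l1 = l3 \<or> G1 + G3 = 0" "l2 = l1 \<or> G1 + G2 = 0"
    by auto
  \<comment> \<open>If two eigenvalues coincide, the term with their difference drops out and the
    other two, written with the same G, cancel. If all are distinct, the three sums of two G vanish,
    hence every G and every term.\<close>
  have "l1 * ((l3 - l2) * T1) + l2 * ((l1 - l3) * T2) + l3 * ((l2 - l1) * T3) = 0"
  proof (cases "l3 = l2 \<or> l1 = l3 \<or> l2 = l1")
    case True
    then show ?thesis
    proof (elim disjE)
      assume "l3 = l2"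
      then show ?thesis unfolding A2(1) A3(2) by (simp add: power2_commute)
    next
      assume "l1 = l3"
      then show ?thesis unfolding A1(2) A3(1) by (simp add: power2_commute)
    next
      assume "l2 = l1"
      then show ?thesis unfolding A1(1) A2(2) by (simp add: power2_commute)
    qed
  next
    case False
    then have "G2 + G3 = 0" "G1 + G3 = 0" "G1 + G2 = 0" using z by auto
    then have "G1 = 0" "G2 = 0" "G3 = 0" by linarith+
    then show ?thesis using A1 A2 A3 by auto
  qed
  then show ?thesis by (simp add: mult.assoc)
qed

text \<open>Modulo \<open>x\<close>, which lies in the kernel, the space is spanned by three
  vectors, and alternating three-forms on such a space are determined by their value on these
  three.\<close>

lemma alternating_trilinear_zero:
  fixes H :: "'a::real_vector \<Rightarrow> 'a \<Rightarrow> 'a \<Rightarrow> real"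
  assumes lin: "\<And>v w. linear (\<lambda>u. H u v w)"
    and anti: "\<And>u v w. H v u w = - H u v w" "\<And>u v w. H u w v = - H u v w"
    and x: "\<And>v w. H x v w = 0" and X: "H X1 X2 X3 = 0"
    and span: "span {x, X1, X2, X3} = UNIV"
  shows "H u v w = 0"
proof -
  have diag: "H u u w = 0" "H u w u = 0" "H w u u = 0" for u w
    using anti(1)[of u u w] anti(2)[of w u u] anti(2)[of u u w] by linarith+
  have lin2: "linear (\<lambda>v. H u v w)" "linear (\<lambda>w. H u v w)" for u v w
  proof -
    have "(\<lambda>v. H u v w) = (\<lambda>v. - H v u w)" by (rule ext) (rule anti(1))
    then show "linear (\<lambda>v. H u v w)" using linear_compose_neg[OF lin[of u w]] by (simp only:)
    have "H u v w = H w u v" for w using anti(2)[of u w v] anti(1)[of w u v] by linarith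
    then have "(\<lambda>w. H u v w) = (\<lambda>w. H w u v)" by (rule ext)
    then show "linear (\<lambda>w. H u v w)" using lin[of u v] by (simp only:)
  qed
  have x': "H v x w = 0" "H v w x = 0" for v w
    using anti(1)[of x v w] anti(2)[of v x w] x[of v w] by linarith+
  have perm: "H X1 X3 X2 = 0" "H X2 X1 X3 = 0" "H X2 X3 X1 = 0" "H X3 X1 X2 = 0" "H X3 X2 X1 = 0"
    using X anti(2)[of X1 X3 X2] anti(1)[of X1 X2 X3] anti(1)[of X1 X3 X2] anti(2)[of X2 X3 X1] anti(2)[of X3 X2 X1]
    by linarith+
  have 1: "H u a b = 0" if ab: "a \<in> {x, X1, X2, X3}" "b \<in> {x, X1, X2, X3}" for u a b
  proof (rule linear_eq_0_on_span[OF lin[of a b], where b = "{x, X1, X2, X3}"])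
    show "u \<in> span {x, X1, X2, X3}" unfolding span by simp
    fix c assume "c \<in> {x, X1, X2, X3}"
    then show "H c a b = 0" using ab x x' diag X perm by auto
  qed
  have 2: "H u v b = 0" if b: "b \<in> {x, X1, X2, X3}" for u v b
  proof (rule linear_eq_0_on_span[OF lin2(1)[of u b], where b = "{x, X1, X2, X3}"])
    show "v \<in> span {x, X1, X2, X3}" unfolding span by simp
  qed (rule 1[OF _ b])
  show ?thesis
  proof (rule linear_eq_0_on_span[OF lin2(2)[of u v], where b = "{x, X1, X2, X3}"])
    show "w \<in> span {x, X1, X2, X3}" unfolding span by simp
  qed (rule 2)
qed

lemma curvature_symmetries:
  assumes "algebraic_curvature_tensor R"
  shows "R b a c d = - R a b c d" "R a b d c = - R a b c d" "R c d a b = R a b c d"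
  using assms unfolding algebraic_curvature_tensor_def by blast+

lemma coordinate_parametrisation_sphere:
  assumes "coordinate_parametrisation D \<psi>" "v \<in> D"
  shows "\<psi> v \<in> unit_sphere"
  using assms openin_imp_subset unfolding coordinate_parametrisation_def by blast

section \<open>The differentiated eigenvalue equation and the integrability form\<close>

context orthonormal_frame
begin

lemma curvature_zero:
  assumes R: "algebraic_curvature_tensor R" shows "R a a c d = 0" "R a b c c = 0"
proof -
  show "R a a c d = 0" using curvature_symmetries(1)[OF R, of a a c d] by linarith
  show "R a b c c = 0" using curvature_symmetries(2)[OF R, of a b c c] by linarith
qed

text \<open>The bilinear product rule handles the first two slots; expanding the third in the frame
  reduces it to products with scalar functions.\<close>

lemma has_derivative_curvature:
  fixes R :: "'a tensor4"
  assumes R: "algebraic_curvature_tensor R"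
    and "(f has_derivative f') (at u)" "(g has_derivative g') (at u)" "(h has_derivative h') (at u)"
  shows "((\<lambda>v. R (f v) (g v) (h v) w) has_derivative
    (\<lambda>d. R (f' d) (g u) (h u) w + R (f u) (g' d) (h u) w + R (f u) (g u) (h' d) w)) (at u)"
proof -
  have "bounded_bilinear (\<lambda>a b. R a b c w)" for c
    unfolding bilinear_conv_bounded_bilinear[symmetric] bilinear_def
    using curvature_linear(1,2)[OF R] by auto
  from bounded_bilinear.FDERIV[OF this assms(2,3)]
  have fg: "((\<lambda>v. R (f v) (g v) c w) has_derivative (\<lambda>d. R (f u) (g' d) c w + R (f' d) (g u) c w)) (at u)" for c .
  have "((\<lambda>v. h v \<bullet> e k) has_derivative (\<lambda>d. h' d \<bullet> e k)) (at u)" for k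
    using assms(4) by (rule has_derivative_inner_left)
  then have "((\<lambda>v. \<Sum>k<4. (h v \<bullet> e k) * R (f v) (g v) (e k) w) has_derivative
    (\<lambda>d. \<Sum>k<4. (h u \<bullet> e k) * (R (f u) (g' d) (e k) w + R (f' d) (g u) (e k) w) + (h' d \<bullet> e k) * R (f u) (g u) (e k) w)) (at u)"
    by (intro has_derivative_sum has_derivative_mult fg)
  moreover have "(\<Sum>k<4. (h u \<bullet> e k) * (R (f u) (g' d) (e k) w + R (f' d) (g u) (e k) w) + (h' d \<bullet> e k) * R (f u) (g u) (e k) w)
    = R (f' d) (g u) (h u) w + R (f u) (g' d) (h u) w + R (f u) (g u) (h' d) w" for d
    unfolding curvature_frame(3)[OF R, of _ _ "h u"] curvature_frame(3)[OF R, of _ _ "h' d"]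
    by (simp add: sum.distrib algebra_simps)
  moreover have "(\<lambda>v. \<Sum>k<4. (h v \<bullet> e k) * R (f v) (g v) (e k) w) = (\<lambda>v. R (f v) (g v) (h v) w)"
    using curvature_frame(3)[OF R] by metis
  ultimately show ?thesis by simp
qed

text \<open>The endomorphism of the tangent space given by K at \<open>x\<close>, extended to the
  ambient space by zero along \<open>x\<close>.\<close>

definition curv_op :: "'a tensor4 \<Rightarrow> 'a \<Rightarrow> 'a \<Rightarrow> 'a" where
  "curv_op R x v = (\<Sum>i<4. R x v x (e i) *\<^sub>R e i)"

lemma curv_op_inner:
  assumes "algebraic_curvature_tensor R" shows "curv_op R x v \<bullet> w = R x v x w"
proof -
  have "curv_op R x v \<bullet> w = (\<Sum>i<4. (w \<bullet> e i) * R x v x (e i))"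
    by (simp add: curv_op_def inner_sum_left inner_commute[of "e _" w] mult.commute)
  then show ?thesis using curvature_frame(4)[OF assms, of x v x w] by simp
qed

lemma linear_curv_op:
  assumes R: "algebraic_curvature_tensor R" shows "linear (curv_op R x)"
proof (rule linearI)
  note l = curvature_linear(2)[OF R]
  show "curv_op R x (a + b) = curv_op R x a + curv_op R x b" for a b
    by (simp add: curv_op_def linear_add[OF l] scaleR_left_distrib sum.distrib)
  show "curv_op R x (c *\<^sub>R a) = c *\<^sub>R curv_op R x a" for c a
    by (simp add: curv_op_def linear_scale[OF l] scaleR_sum_right)
qed

text \<open>The covariant derivative \<open>(\<nabla>\<^sub>u K)(v, w)\<close> at \<open>x\<close>, for tangent vectors.\<close>

definition curv_deriv :: "'a tensor4 \<Rightarrow> 'a \<Rightarrow> 'a \<Rightarrow> 'a \<Rightarrow> 'a \<Rightarrow> real" where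
  "curv_deriv R x u v w = R u v x w + R x v u w"

text \<open>The alternating sum of \<open>(\<nabla>\<^bsub>K u\<^esub> K)(v, K w)\<close>; up to normalisation, the only one of the
  integrability conditions that is not automatic for a diagonal curvature tensor.\<close>

definition integrability_form :: "'a tensor4 \<Rightarrow> 'a \<Rightarrow> 'a \<Rightarrow> 'a \<Rightarrow> 'a \<Rightarrow> real" where
  "integrability_form R x u v w =
     curv_deriv R x (curv_op R x u) v (curv_op R x w) - curv_deriv R x (curv_op R x u) w (curv_op R x v)
   + curv_deriv R x (curv_op R x v) w (curv_op R x u) - curv_deriv R x (curv_op R x v) u (curv_op R x w)
   + curv_deriv R x (curv_op R x w) u (curv_op R x v) - curv_deriv R x (curv_op R x w) v (curv_op R x u)"

lemma linear_curv_deriv: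
  assumes R: "algebraic_curvature_tensor R"
  shows "linear (\<lambda>u. curv_deriv R x u v w)" "linear (\<lambda>v. curv_deriv R x u v w)" "linear (\<lambda>w. curv_deriv R x u v w)"
  unfolding curv_deriv_def by (intro linear_compose_add curvature_linear[OF R])+

text \<open>Transfers the vanishing from the coordinate vectors to arbitrary ambient vectors. As the
  form annihilates \<open>x\<close>, it can be evaluated on the fixed frame without projecting to
  the tangent space.\<close>

lemma integrability_form_zero:
  assumes R: "algebraic_curvature_tensor R" and X: "integrability_form R x X1 X2 X3 = 0"
    and span: "span {x, X1, X2, X3} = UNIV"
  shows "integrability_form R x u v w = 0"
proof (rule alternating_trilinear_zero[where H = "integrability_form R x", OF _ _ _ _ X span])
  note L = linear_curv_op[OF R, of x]
  have l1: "linear (\<lambda>u. curv_deriv R x (curv_op R x u) v w)" for v w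
    using linear_compose[OF L linear_curv_deriv(1)[OF R]] by (simp add: o_def)
  have l3: "linear (\<lambda>u. curv_deriv R x v w (curv_op R x u))" for v w
    using linear_compose[OF L linear_curv_deriv(3)[OF R]] by (simp add: o_def)
  show "linear (\<lambda>u. integrability_form R x u v w)" for v w
    unfolding integrability_form_def
    by (intro linear_compose_add linear_compose_sub l1 l3 linear_curv_deriv(2)[OF R])
  show "integrability_form R x v u w = - integrability_form R x u v w" for u v w
    by (simp add: integrability_form_def)
  show "integrability_form R x u w v = - integrability_form R x u v w" for u v w
    by (simp add: integrability_form_def)
  show "integrability_form R x x v w = 0" for v w
  proof -
    have K0: "curv_op R x x = 0" by (simp add: curv_op_def curvature_zero[OF R])
    have z: "curv_deriv R x 0 v w = 0" "curv_deriv R x v w 0 = 0" for v w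
      using linear_0[OF linear_curv_deriv(1)[OF R]] linear_0[OF linear_curv_deriv(3)[OF R]] by auto
    have s: "curv_deriv R x a x b = - (R x a x b)" for a b
      by (simp add: curv_deriv_def curvature_zero[OF R] curvature_symmetries(1)[OF R, of x a])
    show ?thesis
      unfolding integrability_form_def K0 z s using curvature_symmetries(3)[OF R, of x "curv_op R x v" x "curv_op R x w"] by simp
  qed
qed

text \<open>An alternating form that annihilates \<open>x\<close> is a multiple of det(x, ., ., .),
  whose value on (e_1, e_2, e_3) is x_0. This accounts for one of the two factors x_0; the rest is
  symmetric in the four coordinates.\<close>

lemma integrability_form_frame:
  assumes R: "algebraic_curvature_tensor R" and diag: "R = diag_form (sec R)"
  shows "integrability_form R x (e 1) (e 2) (e 3) = 3 * (x \<bullet> e 0)\<^sup>2 * (x \<bullet> e 1) * (x \<bullet> e 2) * (x \<bullet> e 3) *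
     (sec R 0 1 * sec R 2 3 * (sec R 0 2 + sec R 1 3 - sec R 0 3 - sec R 1 2)
    + sec R 0 2 * sec R 1 3 * (sec R 0 3 + sec R 1 2 - sec R 0 1 - sec R 2 3)
    + sec R 0 3 * sec R 1 2 * (sec R 0 1 + sec R 2 3 - sec R 0 2 - sec R 1 3))"
proof -
  define k where "k = sec R"
  have k: "k 1 0 = k 0 1" "k 2 0 = k 0 2" "k 3 0 = k 0 3" "k 2 1 = k 1 2" "k 3 1 = k 1 3" "k 3 2 = k 2 3"
    "k 0 0 = 0" "k 1 1 = 0" "k 2 2 = 0" "k 3 3 = 0"
    unfolding k_def by (rule sec_props[OF R])+
  have Rq: "R a (e q) c d = (\<Sum>i<4. k i q * ((a \<bullet> e i) * ((c \<bullet> e i) * (d \<bullet> e q) - (c \<bullet> e q) * (d \<bullet> e i))))"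
    if "q < 4" for a q c d
  proof -
    have "R a (e q) c d = (\<Sum>i<4. \<Sum>j<4. if j = q then k i q * ((a \<bullet> e i) * ((c \<bullet> e i) * (d \<bullet> e q) - (c \<bullet> e q) * (d \<bullet> e i))) else 0)"
      unfolding k_def by (subst diag, unfold diag_form_def, intro sum.cong refl) (use that orthonormal in auto)
    then show ?thesis using that by simp
  qed
  define X where "X = (\<lambda>i. x \<bullet> e i)"
  have K: "curv_op R x (e q) \<bullet> e i = (if i = q then (\<Sum>m<4. k m q * (X m)\<^sup>2) else - (k i q * X i * X q))"
    if "q < 4" "i < 4" for q i
  proof -
    have "curv_op R x (e q) \<bullet> e i = (\<Sum>m<4. k m q * (X m * (X m * (if i = q then 1 else 0) - X q * (if i = m then 1 else 0))))"
      using that orthonormal unfolding curv_op_inner[OF R] Rq[OF that(1)] X_def by (auto intro!: sum.cong)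
    also have "\<dots> = (\<Sum>m<4. if i = q then k m q * (X m)\<^sup>2 else 0) - (\<Sum>m<4. if m = i then k m q * X m * X q else 0)"
      unfolding sum_subtractf[symmetric] by (intro sum.cong refl) (auto simp: power2_eq_square algebra_simps)
    also have "\<dots> = (if i = q then (\<Sum>m<4. k m q * (X m)\<^sup>2) else 0) - k i q * X i * X q"
      using that(2) by simp
    finally show ?thesis using sec_props(2)[OF R, of q] by (auto simp: k_def)
  qed
  have X_app: "x \<bullet> e i = X i" for i by (simp add: X_def)
  define A B C where "A = curv_op R x (e 1)" and "B = curv_op R x (e 2)" and "C = curv_op R x (e 3)"
  have Ae: "A \<bullet> e 0 = - (k 0 1 * X 0 * X 1)" "A \<bullet> e 1 = k 0 1 * (X 0)\<^sup>2 + k 1 2 * (X 2)\<^sup>2 + k 1 3 * (X 3)\<^sup>2"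
    "A \<bullet> e 2 = - (k 1 2 * X 2 * X 1)" "A \<bullet> e 3 = - (k 1 3 * X 3 * X 1)"
    unfolding A_def by (simp_all add: K sum_lessThan_4 k[simplified])
  have Be: "B \<bullet> e 0 = - (k 0 2 * X 0 * X 2)" "B \<bullet> e 2 = k 0 2 * (X 0)\<^sup>2 + k 1 2 * (X 1)\<^sup>2 + k 2 3 * (X 3)\<^sup>2"
    "B \<bullet> e 1 = - (k 1 2 * X 1 * X 2)" "B \<bullet> e 3 = - (k 2 3 * X 3 * X 2)"
    unfolding B_def by (simp_all add: K sum_lessThan_4 k[simplified])
  have Ce: "C \<bullet> e 0 = - (k 0 3 * X 0 * X 3)" "C \<bullet> e 3 = k 0 3 * (X 0)\<^sup>2 + k 1 3 * (X 1)\<^sup>2 + k 2 3 * (X 2)\<^sup>2"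
    "C \<bullet> e 1 = - (k 1 3 * X 1 * X 3)" "C \<bullet> e 2 = - (k 2 3 * X 2 * X 3)"
    unfolding C_def by (simp_all add: K sum_lessThan_4 k[simplified])
  have T: "curv_deriv R x p (e q) r = (\<Sum>i<4. k i q * ((p \<bullet> e i) * (X i * (r \<bullet> e q) - X q * (r \<bullet> e i))
      + X i * ((p \<bullet> e i) * (r \<bullet> e q) - (p \<bullet> e q) * (r \<bullet> e i))))" if "q < 4" for p q r
    unfolding curv_deriv_def Rq[OF that] sum.distrib[symmetric] X_def
    by (intro sum.cong refl) (simp add: algebra_simps)
  have T1: "curv_deriv R x p (e 1) r =
      k 0 1 * ((p \<bullet> e 0) * (X 0 * (r \<bullet> e 1) - X 1 * (r \<bullet> e 0)) + X 0 * ((p \<bullet> e 0) * (r \<bullet> e 1) - (p \<bullet> e 1) * (r \<bullet> e 0)))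
    + k 1 2 * ((p \<bullet> e 2) * (X 2 * (r \<bullet> e 1) - X 1 * (r \<bullet> e 2)) + X 2 * ((p \<bullet> e 2) * (r \<bullet> e 1) - (p \<bullet> e 1) * (r \<bullet> e 2)))
    + k 1 3 * ((p \<bullet> e 3) * (X 3 * (r \<bullet> e 1) - X 1 * (r \<bullet> e 3)) + X 3 * ((p \<bullet> e 3) * (r \<bullet> e 1) - (p \<bullet> e 1) * (r \<bullet> e 3)))" for p r
    by (subst T, simp, unfold sum_lessThan_4 k) simp
  have T2: "curv_deriv R x p (e 2) r =
      k 0 2 * ((p \<bullet> e 0) * (X 0 * (r \<bullet> e 2) - X 2 * (r \<bullet> e 0)) + X 0 * ((p \<bullet> e 0) * (r \<bullet> e 2) - (p \<bullet> e 2) * (r \<bullet> e 0)))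
    + k 1 2 * ((p \<bullet> e 1) * (X 1 * (r \<bullet> e 2) - X 2 * (r \<bullet> e 1)) + X 1 * ((p \<bullet> e 1) * (r \<bullet> e 2) - (p \<bullet> e 2) * (r \<bullet> e 1)))
    + k 2 3 * ((p \<bullet> e 3) * (X 3 * (r \<bullet> e 2) - X 2 * (r \<bullet> e 3)) + X 3 * ((p \<bullet> e 3) * (r \<bullet> e 2) - (p \<bullet> e 2) * (r \<bullet> e 3)))" for p r
    by (subst T, simp, unfold sum_lessThan_4 k) simp
  have T3: "curv_deriv R x p (e 3) r =
      k 0 3 * ((p \<bullet> e 0) * (X 0 * (r \<bullet> e 3) - X 3 * (r \<bullet> e 0)) + X 0 * ((p \<bullet> e 0) * (r \<bullet> e 3) - (p \<bullet> e 3) * (r \<bullet> e 0)))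
    + k 1 3 * ((p \<bullet> e 1) * (X 1 * (r \<bullet> e 3) - X 3 * (r \<bullet> e 1)) + X 1 * ((p \<bullet> e 1) * (r \<bullet> e 3) - (p \<bullet> e 3) * (r \<bullet> e 1)))
    + k 2 3 * ((p \<bullet> e 2) * (X 2 * (r \<bullet> e 3) - X 3 * (r \<bullet> e 2)) + X 2 * ((p \<bullet> e 2) * (r \<bullet> e 3) - (p \<bullet> e 3) * (r \<bullet> e 2)))" for p r
    by (subst T, simp, unfold sum_lessThan_4 k) simp
  show ?thesis
    unfolding integrability_form_def A_def[symmetric] B_def[symmetric] C_def[symmetric] T1 T2 T3 Ae Be Ce
      k_def[symmetric] X_app
    by (simp add: power2_eq_square algebra_simps)
qed

lemma integrable_imp_det_zero:
  assumes D: "diagonal_curvature_tensor e R w t s" and KR: "corresponds K R" and K: "integrable_tensor K"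
  shows "det (assoc_matrix w t) = 0"
proof -
  have R: "algebraic_curvature_tensor R" using D unfolding diagonal_curvature_tensor_def by blast
  note k = diagonal_curvature_tensorD[OF D]
  obtain U where U: "openin (top_of_set unit_sphere) U" "unit_sphere \<subseteq> closure U"
    "\<And>x. x \<in> U \<Longrightarrow> \<exists>D \<psi>. coordinate_parametrisation D \<psi> \<and> x \<in> \<psi> ` D \<and>
          (\<forall>u\<in>D. \<forall>i. eigenvector_at K (\<psi> u) (coordinate_vector \<psi> u i))"
    using K unfolding integrable_tensor_def by blast
  \<comment> \<open>A point of the sphere with all coordinates 1/2. A point of the dense set
    \<open>U\<close> within distance 1/4 of it has no vanishing coordinate, as is necessary for
    cancelling x_0^2 x_1 x_2 x_3 at the end.\<close>
  define c where "c = (\<Sum>i<4. (1/2) *\<^sub>R e i)"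
  have c: "c \<bullet> e i = 1/2" if "i < 4" for i using that by (simp only: c_def inner_combination)
  have "c \<bullet> c = 1" using inner_frame[of c c] by (simp add: c)
  then have "c \<in> closure U" using U(2) by (auto simp: norm_eq_sqrt_inner)
  then obtain x where x: "x \<in> U" "dist x c < 1/4" by (meson closure_approachable zero_less_divide_1_iff zero_less_numeral)
  have xe: "x \<bullet> e i \<noteq> 0" if "i < 4" for i
  proof -
    have "norm (e i) = 1" using orthonormal[OF that that] by (simp add: norm_eq_sqrt_inner)
    then have "\<bar>(x - c) \<bullet> e i\<bar> < 1/4"
      using Cauchy_Schwarz_ineq2[of "x - c" "e i"] x(2) by (simp add: dist_norm)
    then show ?thesis using c[OF that] by (auto simp: inner_diff_left)
  qed
  obtain D \<psi> where coord: "coordinate_parametrisation D \<psi>" and "x \<in> \<psi> ` D"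
    and eig: "\<And>v i. v \<in> D \<Longrightarrow> eigenvector_at K (\<psi> v) (coordinate_vector \<psi> v i)"
    using U(3)[OF x(1)] by blast
  then obtain u where u: "u \<in> D" "x = \<psi> u" by blast
  have "open D" and smooth: "smooth_on D \<psi>" and inj: "inj (frechet_derivative \<psi> (at u))"
    using coord u unfolding coordinate_parametrisation_def by auto
  have C2: "Ck_on 2 D \<psi>" using smooth unfolding smooth_on_def by blast
  define X where "X = (\<lambda>b v. coordinate_vector \<psi> v b)"
  define X2 where "X2 = (\<lambda>a b. frechet_derivative (X b) (at u) (axis a 1))"
  have d\<psi>: "(\<psi> has_derivative frechet_derivative \<psi> (at u)) (at u)"
    using C2 u by (auto simp: numeral_2_eq_2 frechet_derivative_works)
  have dX: "(X b has_derivative frechet_derivative (X b) (at u)) (at u)" for b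
    using C2 u by (auto simp: numeral_2_eq_2 X_def coordinate_vector_def[abs_def] frechet_derivative_works)
  have X2_sym: "X2 a b = X2 b a" for a b
    using second_derivative_symmetric[OF \<open>open D\<close> u(1) C2] by (simp add: X2_def X_def coordinate_vector_def[abs_def])
  have norm: "\<psi> v \<bullet> \<psi> v = 1" if "v \<in> D" for v
    using coordinate_parametrisation_sphere[OF coord that] by (simp add: norm_eq_sqrt_inner)
  have tangent: "\<psi> v \<bullet> X b v = 0" and nonzero: "X b v \<noteq> 0" if "v \<in> D" for v b
    using eig[OF that, of b] by (auto simp: eigenvector_at_def tangent_space_def X_def)
  \<comment> \<open>The eigenvalue equation, known for tangent \<open>w\<close>, holds for all
    \<open>w\<close>, because both sides vanish in the normal direction.\<close>
  have ev: "\<exists>l. \<forall>w. R (\<psi> v) (X b v) (\<psi> v) w = l * (X b v \<bullet> w)" if v: "v \<in> D" for v b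
  proof -
    obtain l where l: "\<And>w. w \<in> tangent_space (\<psi> v) \<Longrightarrow> K (\<psi> v) (X b v) w = l * (X b v \<bullet> w)"
      and t: "X b v \<in> tangent_space (\<psi> v)"
      using eig[OF v, of b] unfolding eigenvector_at_def X_def by blast
    have "R (\<psi> v) (X b v) (\<psi> v) w = l * (X b v \<bullet> w)" for w
    proof -
      define w' where "w' = w - (\<psi> v \<bullet> w) *\<^sub>R \<psi> v"
      have w': "w' \<in> tangent_space (\<psi> v)" using norm[OF v] by (simp add: w'_def tangent_space_def inner_diff_right)
      have "R (\<psi> v) (X b v) (\<psi> v) w = R (\<psi> v) (X b v) (\<psi> v) w' + (\<psi> v \<bullet> w) * R (\<psi> v) (X b v) (\<psi> v) (\<psi> v)"
        by (simp add: w'_def linear_diff[OF curvature_linear(4)[OF R]] linear_scale[OF curvature_linear(4)[OF R]])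
      also have "\<dots> = K (\<psi> v) (X b v) w'"
        using KR coordinate_parametrisation_sphere[OF coord v] t w' curvature_zero(2)[OF R] unfolding corresponds_def by simp
      also have "\<dots> = l * (X b v \<bullet> w)"
        using l[OF w'] tangent[OF v, of b] by (simp add: w'_def inner_diff_right inner_commute)
      finally show ?thesis .
    qed
    then show ?thesis by blast
  qed
  then obtain l where l: "\<And>b w. R x (X b u) x w = l b * (X b u \<bullet> w)"
    unfolding u(2) using u(1) by metis
  define T where "T = (\<lambda>a b c. R (X a u) (X b u) x (X c u) + R x (X b u) (X a u) (X c u))"
  have T_sym: "T a b c = T a c b" for a b c
    unfolding T_def using curvature_symmetries(3)[OF R] by (metis add.commute)
  have orth: "X b u \<bullet> X c u = 0" if "l b \<noteq> l c" for b c
    using l[of b "X c u"] l[of c "X b u"] curvature_symmetries(3)[OF R, of x "X c u" x "X b u"] that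
    by (simp add: inner_commute)
  \<comment> \<open>The eigenvalue is not known to be differentiable. With the vector Y = X_b(u)
    held fixed, it is eliminated from the equations for \<open>w\<close> and for \<open>Y\<close> by
    cross-multiplication, and the resulting identity is differentiated in the direction a.\<close>
  have T_eq: "T a b c = (l b - l c) * (X2 a b \<bullet> X c u)" if "l b \<noteq> l c" for a b c
  proof -
    define Y where "Y = X b u"
    have Rder: "((\<lambda>v. R (\<psi> v) (X b v) (\<psi> v) w) has_derivative
      (\<lambda>d. R (frechet_derivative \<psi> (at u) d) Y x w + R x (frechet_derivative (X b) (at u) d) x w
        + R x Y (frechet_derivative \<psi> (at u) d) w)) (at u)" for w
      using has_derivative_curvature[OF R d\<psi> dX[of b] d\<psi>, of w] unfolding u(2)[symmetric] Y_def .
    define F' where "F' = (\<lambda>w. R (X a u) Y x w + R x (X2 a b) x w + R x Y (X a u) w)"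
    have d1: "((\<lambda>v. R (\<psi> v) (X b v) (\<psi> v) w * (X b v \<bullet> Y)) has_derivative
      (\<lambda>d. R x Y x w * (frechet_derivative (X b) (at u) d \<bullet> Y)
       + (R (frechet_derivative \<psi> (at u) d) Y x w + R x (frechet_derivative (X b) (at u) d) x w
        + R x Y (frechet_derivative \<psi> (at u) d) w) * (Y \<bullet> Y))) (at u)" for w
      using has_derivative_mult[OF Rder[of w] has_derivative_inner_left[OF dX[of b], of Y]]
      unfolding u(2)[symmetric] Y_def .
    have d2: "((\<lambda>v. R (\<psi> v) (X b v) (\<psi> v) w * (X b v \<bullet> Y)) has_derivative
      (\<lambda>d. R x Y x Y * (frechet_derivative (X b) (at u) d \<bullet> w)
       + (R (frechet_derivative \<psi> (at u) d) Y x Y + R x (frechet_derivative (X b) (at u) d) x Y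
        + R x Y (frechet_derivative \<psi> (at u) d) Y) * (Y \<bullet> w))) (at u)" for w
    proof (rule has_derivative_transform_within_open[OF _ \<open>open D\<close> u(1)])
      show "((\<lambda>v. R (\<psi> v) (X b v) (\<psi> v) Y * (X b v \<bullet> w)) has_derivative
        (\<lambda>d. R x Y x Y * (frechet_derivative (X b) (at u) d \<bullet> w)
       + (R (frechet_derivative \<psi> (at u) d) Y x Y + R x (frechet_derivative (X b) (at u) d) x Y
        + R x Y (frechet_derivative \<psi> (at u) d) Y) * (Y \<bullet> w))) (at u)"
        using has_derivative_mult[OF Rder[of Y] has_derivative_inner_left[OF dX[of b], of w]]
        unfolding u(2)[symmetric] Y_def .
      show "R (\<psi> v) (X b v) (\<psi> v) Y * (X b v \<bullet> w) = R (\<psi> v) (X b v) (\<psi> v) w * (X b v \<bullet> Y)" if "v \<in> D" for v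
        using ev[OF that, of b] by auto
    qed
    have "R x Y x w * (X2 a b \<bullet> Y) + F' w * (Y \<bullet> Y) = R x Y x Y * (X2 a b \<bullet> w) + F' Y * (Y \<bullet> w)" for w
      using fun_cong[OF has_derivative_unique[OF d1[of w] d2[of w]], of "axis a 1"]
      unfolding F'_def X2_def X_def coordinate_vector_def .
    \<comment> \<open>For w = X_c both R(x, Y, x, w) and Y \<bullet> w vanish, since eigenvectors to
      different eigenvalues are orthogonal.\<close>
    from this[of "X c u"] have "F' (X c u) * (Y \<bullet> Y) = l b * (Y \<bullet> Y) * (X2 a b \<bullet> X c u)"
      using orth[OF that] by (simp add: l Y_def)
    then have "F' (X c u) = l b * (X2 a b \<bullet> X c u)"
      using nonzero[OF u(1), of b] by (simp add: Y_def)
    moreover have "R x (X2 a b) x (X c u) = l c * (X2 a b \<bullet> X c u)"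
      using l[of c "X2 a b"] curvature_symmetries(3)[OF R, of x "X2 a b" x "X c u"] by (simp add: inner_commute)
    ultimately show ?thesis unfolding F'_def T_def Y_def by (simp add: algebra_simps)
  qed
  have "l 1 * (l 3 - l 2) * T 1 2 3 + l 2 * (l 1 - l 3) * T 2 3 1 + l 3 * (l 2 - l 1) * T 3 1 2 = 0"
  proof (rule eigenvalue_cancellation[where ?G1.0 = "X2 2 3 \<bullet> X 1 u" and ?G2.0 = "X2 1 3 \<bullet> X 2 u" and ?G3.0 = "X2 1 2 \<bullet> X 3 u"])
    show "T 1 2 3 = (l 2 - l 3) * (X2 1 2 \<bullet> X 3 u) \<and> T 1 2 3 = (l 3 - l 2) * (X2 1 3 \<bullet> X 2 u)" if "l 2 \<noteq> l 3"
      using T_eq[of 2 3 1] T_eq[of 3 2 1] T_sym[of 1 2 3] that by simp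
    show "T 2 3 1 = (l 3 - l 1) * (X2 2 3 \<bullet> X 1 u) \<and> T 2 3 1 = (l 1 - l 3) * (X2 1 2 \<bullet> X 3 u)" if "l 3 \<noteq> l 1"
      using T_eq[of 3 1 2] T_eq[of 1 3 2] T_sym[of 2 3 1] X2_sym[of 2 1] that by simp
    show "T 3 1 2 = (l 1 - l 2) * (X2 1 3 \<bullet> X 2 u) \<and> T 3 1 2 = (l 2 - l 1) * (X2 2 3 \<bullet> X 1 u)" if "l 1 \<noteq> l 2"
      using T_eq[of 1 2 3] T_eq[of 2 1 3] T_sym[of 3 1 2] X2_sym[of 3 1] X2_sym[of 3 2] that by simp
  qed
  moreover have "curv_op R x (X b u) = l b *\<^sub>R X b u" for b
  proof (rule frame_ext)
    fix i :: nat
    show "curv_op R x (X b u) \<bullet> e i = (l b *\<^sub>R X b u) \<bullet> e i"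
      by (simp add: curv_op_inner[OF R] l)
  qed
  moreover have "curv_deriv R x (p *\<^sub>R X a u) (X b u) (q *\<^sub>R X c u) = p * q * T a b c" for a b c p q
    using linear_scale[OF linear_curv_deriv(1)[OF R]] linear_scale[OF linear_curv_deriv(3)[OF R]]
    by (simp add: T_def curv_deriv_def)
  ultimately have "integrability_form R x (X 1 u) (X 2 u) (X 3 u) = 0"
    using T_sym[of 1 3 2] T_sym[of 2 1 3] T_sym[of 3 2 1]
    by (simp add: integrability_form_def algebra_simps)
  moreover have "span {x, X 1 u, X 2 u, X 3 u} = UNIV"
  proof -
    define L where "L = frechet_derivative \<psi> (at u)"
    have L: "linear L" using d\<psi> by (simp add: L_def has_derivative_linear)
    have LX: "L v = (v$1) *\<^sub>R X 1 u + (v$2) *\<^sub>R X 2 u + (v$3) *\<^sub>R X 3 u" for v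
    proof -
      have X_eq: "X b u = L (axis b 1)" for b by (simp add: X_def coordinate_vector_def L_def)
      have "v = (v$1) *\<^sub>R axis 1 1 + (v$2) *\<^sub>R axis 2 1 + (v$3) *\<^sub>R (axis 3 1 :: real^3)"
        by (simp add: vec_eq_iff forall_3 axis_def)
      then have "L v = L ((v$1) *\<^sub>R axis 1 1 + (v$2) *\<^sub>R axis 2 1 + (v$3) *\<^sub>R axis 3 1)"
        by (rule arg_cong)
      then show ?thesis by (simp only: X_eq linear_add[OF L] linear_scale[OF L])
    qed
    have range: "range L \<subseteq> {v. x \<bullet> v = 0}"
      using tangent[OF u(1)] unfolding u(2)[symmetric] by (auto simp: LX inner_add_right)
    have "x \<noteq> 0" using xe[of 0] by auto
    have "dim (range L) = 3"
      using dim_image_eq[OF L, of UNIV] inj by (simp add: L_def)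
    moreover have "dim {v. x \<bullet> v = 0} = 3" using dim_hyperplane[OF \<open>x \<noteq> 0\<close>] dim4 by simp
    ultimately have "range L = {v. x \<bullet> v = 0}"
      using range L by (intro subspace_dim_equal) (auto intro: subspace_hyperplane linear_subspace_image)
    show ?thesis
    proof (intro equalityI subset_UNIV subsetI)
      fix v :: 'a
      define v' where "v' = v - (x \<bullet> v) *\<^sub>R x"
      have "x \<bullet> v' = 0" using norm[OF u(1)] unfolding u(2)[symmetric] by (simp add: v'_def inner_diff_right)
      then obtain a where "v' = L a" using \<open>range L = _\<close> by auto
      then have "v = (x \<bullet> v) *\<^sub>R x + ((a$1) *\<^sub>R X 1 u + (a$2) *\<^sub>R X 2 u + (a$3) *\<^sub>R X 3 u)"
        unfolding LX v'_def by (metis add.commute diff_add_cancel)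
      also have "\<dots> \<in> span {x, X 1 u, X 2 u, X 3 u}"
        by (intro span_add span_scale span_base) auto
      finally show "v \<in> span {x, X 1 u, X 2 u, X 3 u}" .
    qed
  qed
  ultimately have "integrability_form R x (e 1) (e 2) (e 3) = 0"
    by (rule integrability_form_zero[OF R])
  then have "sec R 0 1 * sec R 2 3 * (sec R 0 2 + sec R 1 3 - sec R 0 3 - sec R 1 2)
    + sec R 0 2 * sec R 1 3 * (sec R 0 3 + sec R 1 2 - sec R 0 1 - sec R 2 3)
    + sec R 0 3 * sec R 1 2 * (sec R 0 1 + sec R 2 3 - sec R 0 2 - sec R 1 3) = 0"
    using integrability_form_frame[OF R k(1), of x] xe[of 0] xe[of 1] xe[of 2] xe[of 3] by simp
  then have *: "(w$1 + t$1 + s/12) * (w$1 - t$1 + s/12) * (2 * w$2 - 2 * w$3)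
    + (w$2 + t$2 + s/12) * (w$2 - t$2 + s/12) * (2 * w$3 - 2 * w$1)
    + (w$3 + t$3 + s/12) * (w$3 - t$3 + s/12) * (2 * w$1 - 2 * w$2) = 0"
    unfolding k(4-9) by (simp add: algebra_simps)
  \<comment> \<open>The expression just obtained is -2 det. The terms with s cancel, because the
    cyclic sums of w_b - w_c and of w_a (w_b - w_c) are zero.\<close>
  define r where "r = s / 12"
  have "det (assoc_matrix w t) = 0"
    using * k(10) unfolding det_assoc_matrix r_def[symmetric] by algebra
  then show ?thesis .
qed

end


section \<open>The matrix space and its projective variety\<close>

text \<open>In this form invariance under conjugation by signed permutations is visible: such a
  conjugation permutes the off-diagonal pairs and multiplies both members of a pair by the same
  sign.\<close>

lemma matrix_space_iff:
  "M \<in> matrix_space \<longleftrightarrow> trace M = 0 \<and> (\<forall>i j. i \<noteq> j \<longrightarrow> M$i$j = - M$j$i)"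
proof
  assume "M \<in> matrix_space"
  then obtain \<Delta> t where "trace M = 0" and M: "M = matrix_form \<Delta> t" unfolding matrix_space_def by blast
  moreover have "\<forall>i j. i \<noteq> j \<longrightarrow> M$i$j = - M$j$i"
    unfolding M forall_3 by (simp add: matrix_form_def)
  ultimately show "trace M = 0 \<and> (\<forall>i j. i \<noteq> j \<longrightarrow> M$i$j = - M$j$i)" by blast
next
  assume M: "trace M = 0 \<and> (\<forall>i j. i \<noteq> j \<longrightarrow> M$i$j = - M$j$i)"
  then have off: "M$i$j = - M$j$i" if "i \<noteq> j" for i j using that by blast
  have a: "M$1$2 = - M$2$1" "M$2$3 = - M$3$2" "M$3$1 = - M$1$3" by (rule off; simp)+
  have "M = matrix_form (vector [M$1$1, M$2$2, M$3$3]) (vector [M$3$2, M$1$3, M$2$1])"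
    by (simp add: vec_eq_iff forall_3 matrix_form_def a)
  then show "M \<in> matrix_space" unfolding matrix_space_def using M by blast
qed

text \<open>The trace determines the third diagonal entry, which leaves 2 + 3 free
  parameters.\<close>

lemma matrix_space_parametrisation:
  obtains f :: "(real^2) \<times> (real^3) \<Rightarrow> real^3^3" where "linear f" "inj f" "range f = matrix_space"
proof
  define f :: "(real^2) \<times> (real^3) \<Rightarrow> real^3^3" where
    "f = (\<lambda>(d, t). matrix_form (vector [d$1, d$2, - (d$1 + d$2)]) t)"
  show "linear f"
    by (rule linearI) (auto simp: f_def vec_eq_iff forall_3 matrix_form_def algebra_simps)
  show "inj f"
  proof (rule injI, clarify)
    fix d t d' t' assume "f (d, t) = f (d', t')"
    then show "d = d' \<and> t = t'"
      by (simp add: f_def vec_eq_iff forall_2 forall_3 matrix_form_def)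
  qed
  show "range f = matrix_space"
  proof (intro equalityI subsetI)
    fix M assume "M \<in> range f"
    then obtain d :: "real^2" and t where M: "M = matrix_form (vector [d$1, d$2, - (d$1 + d$2)]) t" by (auto simp: f_def)
    have "trace M = 0" by (simp add: M trace_def sum_3 matrix_form_def)
    then show "M \<in> matrix_space" unfolding matrix_space_def using M by blast
  next
    fix M assume "M \<in> matrix_space"
    then obtain d :: "real^3" and t where "M = matrix_form d t" "trace M = 0" unfolding matrix_space_def by blast
    then have "M = f (vector [d$1, d$2], t)"
      by (simp add: f_def vec_eq_iff forall_3 matrix_form_def trace_def sum_3)
    then show "M \<in> range f" by blast
  qed
qed

lemma subspace_matrix_space: "subspace matrix_space"
  using matrix_space_parametrisation linear_subspace_image subspace_UNIV by metis

lemma dim_matrix_space: "dim matrix_space = 5"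
proof -
  obtain f :: "(real^2) \<times> (real^3) \<Rightarrow> real^3^3" where f: "linear f" "inj f" "range f = matrix_space"
    by (rule matrix_space_parametrisation)
  have "dim (range f) = dim (UNIV :: ((real^2) \<times> (real^3)) set)"
    using f by (intro dim_image_eq) auto
  then show ?thesis unfolding f(3) by simp
qed

lemma real_polynomial_function_entry: "real_polynomial_function (\<lambda>M :: real^'n^'m. M$i$j)"
proof -
  have "linear (\<lambda>M :: real^'n^'m. M$i$j)" by (rule linearI) auto
  then show ?thesis by (intro real_polynomial_function.intros(1)) (simp add: linear_conv_bounded_linear)
qed

lemma projective_variety_integrable_variety: "projective_variety matrix_space integrable_variety"
proof -
  have "real_polynomial_function (trace :: real^3^3 \<Rightarrow> real)"
    unfolding trace_def[abs_def] sum_3 by (intro real_polynomial_function.intros(3) real_polynomial_function_entry)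
  moreover have "real_polynomial_function (det :: real^3^3 \<Rightarrow> real)"
    unfolding det_3[abs_def]
    by (intro real_polynomial_function.intros(3) real_polynomial_function_diff real_polynomial_function.intros(4) real_polynomial_function_entry)
  moreover have "trace (c *\<^sub>R M) = c ^ 1 * trace M" for c and M :: "real^3^3"
    by (simp add: trace_def sum_3 algebra_simps)
  moreover have "det (c *\<^sub>R M) = c ^ 3 * det M" for c and M :: "real^3^3"
    unfolding det_3 by (simp add: power3_eq_cube algebra_simps)
  ultimately have "homogeneous_polynomial 1 (trace :: real^3^3 \<Rightarrow> real)" "homogeneous_polynomial 3 (det :: real^3^3 \<Rightarrow> real)"
    unfolding homogeneous_polynomial_def by auto
  then show ?thesis
    unfolding projective_variety_def integrable_variety_def
    by (intro exI[of _ "{trace, det}"]) auto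
qed

section \<open>Signed permutation matrices\<close>

definition signed_perm :: "(3 \<Rightarrow> 3) \<Rightarrow> (3 \<Rightarrow> real) \<Rightarrow> real^3^3" where
  "signed_perm \<sigma> \<epsilon> = (\<chi> i j. if i = \<sigma> j then \<epsilon> j else 0)"

definition signs :: "(3 \<Rightarrow> real) set" where
  "signs = (UNIV \<rightarrow> {1, -1})"

lemma signsD:
  assumes "\<epsilon> \<in> signs" shows "\<epsilon> j = 1 \<or> \<epsilon> j = -1" "\<epsilon> j * \<epsilon> j = 1"
proof -
  show "\<epsilon> j = 1 \<or> \<epsilon> j = -1" using assms by (simp add: signs_def Pi_iff)
  then show "\<epsilon> j * \<epsilon> j = 1" by auto
qed

lemma signsI: "(\<And>j. \<epsilon> j = 1 \<or> \<epsilon> j = -1) \<Longrightarrow> \<epsilon> \<in> signs"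
  by (simp add: signs_def)

lemma signed_permutation_matrix_iff:
  "signed_permutation_matrix P \<longleftrightarrow> (\<exists>\<sigma> \<epsilon>. \<sigma> permutes UNIV \<and> \<epsilon> \<in> signs \<and> P = signed_perm \<sigma> \<epsilon>)"
  unfolding signed_permutation_matrix_def signed_perm_def signs_def by (simp add: Pi_iff)

lemma signed_perm_mult:
  "signed_perm \<sigma> \<epsilon> ** signed_perm \<tau> \<eta> = signed_perm (\<sigma> \<circ> \<tau>) (\<lambda>j. \<epsilon> (\<tau> j) * \<eta> j)"
proof -
  have "(\<Sum>k\<in>UNIV. (if i = \<sigma> k then \<epsilon> k else 0) * (if k = \<tau> j then \<eta> j else 0))
    = (\<Sum>k\<in>UNIV. if k = \<tau> j then (if i = \<sigma> (\<tau> j) then \<epsilon> (\<tau> j) * \<eta> j else 0) else 0)" for i j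
    by (intro sum.cong) auto
  then show ?thesis by (simp add: signed_perm_def matrix_matrix_mult_def vec_eq_iff)
qed

lemma signed_perm_id: "signed_perm id (\<lambda>_. 1) = mat 1"
  by (simp add: signed_perm_def mat_def vec_eq_iff)

lemma signed_perm_inverse:
  assumes "\<sigma> permutes UNIV" "\<epsilon> \<in> signs"
  shows "signed_perm (inv' \<sigma>) (\<epsilon> \<circ> inv' \<sigma>) ** signed_perm \<sigma> \<epsilon> = mat 1"
    and "signed_perm \<sigma> \<epsilon> ** signed_perm (inv' \<sigma>) (\<epsilon> \<circ> inv' \<sigma>) = mat 1"
  unfolding signed_perm_mult signed_perm_id[symmetric]
  using permutes_inv_o[OF assms(1)] permutes_inverses[OF assms(1)] signsD(2)[OF assms(2)] by simp_all

lemma matrix_inv_eqI: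
  fixes A B :: "real^'n^'n"
  assumes "A ** B = mat 1" "B ** A = mat 1"
  shows "matrix_inv A = B"
proof -
  have inv: "A ** matrix_inv A = mat 1 \<and> matrix_inv A ** A = mat 1"
    unfolding matrix_inv_def by (rule someI[of _ B]) (use assms in simp)
  have "matrix_inv A = matrix_inv A ** (A ** B)" by (simp add: assms)
  also have "\<dots> = (matrix_inv A ** A) ** B" by (rule matrix_mul_assoc)
  finally show ?thesis by (simp add: inv)
qed

lemma matrix_inv_signed_perm:
  assumes "\<sigma> permutes UNIV" "\<epsilon> \<in> signs"
  shows "matrix_inv (signed_perm \<sigma> \<epsilon>) = signed_perm (inv' \<sigma>) (\<epsilon> \<circ> inv' \<sigma>)"
  by (rule matrix_inv_eqI) (rule signed_perm_inverse[OF assms])+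

text \<open>Every index is of the form \<sigma> a; addressing the entries in this way keeps the
  inverse permutation out of the formula.\<close>

lemma conj_signed_perm_nth:
  assumes "\<sigma> permutes UNIV" "\<epsilon> \<in> signs"
  shows "conj_matrix (signed_perm \<sigma> \<epsilon>) M $ \<sigma> a $ \<sigma> b = \<epsilon> a * \<epsilon> b * M$a$b"
proof -
  have inj: "\<sigma> i = \<sigma> j \<longleftrightarrow> i = j" for i j using permutes_inj[OF assms(1)] by (auto simp: inj_def)
  have b: "signed_perm (inv' \<sigma>) (\<epsilon> \<circ> inv' \<sigma>) $ k $ \<sigma> b = (if k = b then \<epsilon> b else 0)" for k
    using permutes_inverses[OF assms(1)] by (simp add: signed_perm_def)
  have "(signed_perm \<sigma> \<epsilon> ** M) $ \<sigma> a $ k = \<epsilon> a * M$a$k" for k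
  proof -
    have "(signed_perm \<sigma> \<epsilon> ** M) $ \<sigma> a $ k = (\<Sum>l\<in>UNIV. (if a = l then \<epsilon> l else 0) * M$l$k)"
      by (simp add: matrix_matrix_mult_def signed_perm_def inj)
    also have "\<dots> = (\<Sum>l\<in>UNIV. if l = a then \<epsilon> a * M$a$k else 0)"
      by (intro sum.cong) auto
    finally show ?thesis by simp
  qed
  then have "conj_matrix (signed_perm \<sigma> \<epsilon>) M $ \<sigma> a $ \<sigma> b = (\<Sum>k\<in>UNIV. \<epsilon> a * M$a$k * (if k = b then \<epsilon> b else 0))"
    unfolding conj_matrix_def matrix_inv_signed_perm[OF assms] matrix_matrix_mult_def[of "_ ** _"] by (simp add: b)
  also have "\<dots> = (\<Sum>k\<in>UNIV. if k = b then \<epsilon> a * \<epsilon> b * M$a$b else 0)"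
    by (intro sum.cong) auto
  finally show ?thesis by simp
qed

lemma permutes_3_cases:
  assumes "\<sigma> permutes (UNIV :: 3 set)"
  shows "(\<sigma> 1, \<sigma> 2, \<sigma> 3) \<in> {(1,2,3), (1,3,2), (2,1,3), (2,3,1), (3,1,2), (3,2,1)}"
proof -
  have "\<sigma> 1 \<noteq> \<sigma> 2" "\<sigma> 1 \<noteq> \<sigma> 3" "\<sigma> 2 \<noteq> \<sigma> 3"
    using permutes_inj[OF assms] by (simp_all add: inj_eq)
  then show ?thesis using exhaust_3[of "\<sigma> 1"] exhaust_3[of "\<sigma> 2"] exhaust_3[of "\<sigma> 3"]
    by (elim disjE; simp)
qed

lemma perm_sign_signed_perm:
  assumes "\<sigma> permutes UNIV" "\<epsilon> \<in> signs"
  shows "perm_sign (signed_perm \<sigma> \<epsilon>) = 1 \<or> perm_sign (signed_perm \<sigma> \<epsilon>) = -1"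
    and "det (signed_perm \<sigma> \<epsilon>) = perm_sign (signed_perm \<sigma> \<epsilon>) * (\<epsilon> 1 * \<epsilon> 2 * \<epsilon> 3)"
proof -
  have s: "\<bar>\<epsilon> j\<bar> = 1" for j using signsD(1)[OF assms(2), of j] by auto
  show "perm_sign (signed_perm \<sigma> \<epsilon>) = 1 \<or> perm_sign (signed_perm \<sigma> \<epsilon>) = -1"
    using permutes_3_cases[OF assms(1)] by (auto simp: perm_sign_def det_3 signed_perm_def s)
  show "det (signed_perm \<sigma> \<epsilon>) = perm_sign (signed_perm \<sigma> \<epsilon>) * (\<epsilon> 1 * \<epsilon> 2 * \<epsilon> 3)"
    using permutes_3_cases[OF assms(1)] by (auto simp: perm_sign_def det_3 signed_perm_def s)
qed

lemma carrier_octahedral_group: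
  "P \<in> carrier octahedral_group \<longleftrightarrow> (\<exists>\<sigma> \<epsilon>. \<sigma> permutes UNIV \<and> \<epsilon> \<in> signs \<and> P = signed_perm \<sigma> \<epsilon> \<and> det P = 1)"
  unfolding octahedral_group_def signed_permutation_matrix_iff by auto

lemma group_octahedral_group: "group octahedral_group"
proof (rule groupI)
  fix P Q assume "P \<in> carrier octahedral_group" "Q \<in> carrier octahedral_group"
  then obtain \<sigma> \<epsilon> \<tau> \<eta> where P: "\<sigma> permutes UNIV" "\<epsilon> \<in> signs" "P = signed_perm \<sigma> \<epsilon>" "det P = 1"
    and Q: "\<tau> permutes UNIV" "\<eta> \<in> signs" "Q = signed_perm \<tau> \<eta>" "det Q = 1"
    unfolding carrier_octahedral_group by blast
  have "\<epsilon> (\<tau> j) * \<eta> j = 1 \<or> \<epsilon> (\<tau> j) * \<eta> j = -1" for j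
    using signsD(1)[OF P(2), of "\<tau> j"] signsD(1)[OF Q(2), of j] by auto
  then have "(\<lambda>j. \<epsilon> (\<tau> j) * \<eta> j) \<in> signs" by (rule signsI)
  moreover have "det (P ** Q) = 1" using P Q by (simp add: det_mul)
  moreover have "P ** Q = signed_perm (\<sigma> \<circ> \<tau>) (\<lambda>j. \<epsilon> (\<tau> j) * \<eta> j)" unfolding P(3) Q(3) by (rule signed_perm_mult)
  ultimately show "P \<otimes>\<^bsub>octahedral_group\<^esub> Q \<in> carrier octahedral_group"
    using permutes_compose[OF Q(1) P(1)] unfolding carrier_octahedral_group by (auto simp: octahedral_group_def)
next
  have "(\<lambda>_. 1) \<in> signs" by (simp add: signs_def)
  then show "\<one>\<^bsub>octahedral_group\<^esub> \<in> carrier octahedral_group"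
    unfolding carrier_octahedral_group
    by (intro exI[of _ id] exI[of _ "\<lambda>_. 1"]) (simp add: signed_perm_id octahedral_group_def permutes_id)
next
  fix P assume "P \<in> carrier octahedral_group"
  then obtain \<sigma> \<epsilon> where P: "\<sigma> permutes UNIV" "\<epsilon> \<in> signs" "P = signed_perm \<sigma> \<epsilon>" "det P = 1"
    unfolding carrier_octahedral_group by blast
  define Q where "Q = signed_perm (inv' \<sigma>) (\<epsilon> \<circ> inv' \<sigma>)"
  have QP: "Q ** P = mat 1" unfolding Q_def P(3) by (rule signed_perm_inverse[OF P(1,2)])
  then have "det Q = 1" using det_mul[of Q P] P(4) by simp
  moreover have "\<epsilon> \<circ> inv' \<sigma> \<in> signs" using P(2) by (auto simp: signs_def)
  ultimately have "Q \<in> carrier octahedral_group"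
    unfolding carrier_octahedral_group Q_def using permutes_inv[OF P(1)] by blast
  then show "\<exists>Q\<in>carrier octahedral_group. Q \<otimes>\<^bsub>octahedral_group\<^esub> P = \<one>\<^bsub>octahedral_group\<^esub>"
    using QP by (auto simp: octahedral_group_def)
qed (auto simp: octahedral_group_def matrix_mul_assoc)

text \<open>There are 6 * 8 = 48 signed permutation matrices, and in odd dimension P \<mapsto> -P
  exchanges those of determinant 1 and -1.\<close>

lemma card_octahedral_group: "finite (carrier octahedral_group)" "card (carrier octahedral_group) = 24"
proof -
  define S where "S = (\<lambda>(\<sigma>, \<epsilon>). signed_perm \<sigma> \<epsilon>) ` ({\<sigma>. \<sigma> permutes UNIV} \<times> signs)"
  have signs_PiE: "signs = (\<Pi>\<^sub>E j\<in>UNIV. {1, -1})" by (auto simp: signs_def PiE_def)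
  have fin: "finite signs" "card signs = 8"
    unfolding signs_PiE by (simp_all add: finite_PiE card_PiE power3_eq_cube)
  have fin': "finite {\<sigma>. \<sigma> permutes (UNIV :: 3 set)}" "card {\<sigma>. \<sigma> permutes (UNIV :: 3 set)} = 6"
    by (simp_all add: finite_permutations card_permutations[of _ 3] fact_numeral)
  have "inj_on (\<lambda>(\<sigma>, \<epsilon>). signed_perm \<sigma> \<epsilon>) ({\<sigma>. \<sigma> permutes UNIV} \<times> signs)"
  proof (rule inj_onI, clarify)
    fix \<sigma> \<tau> :: "3 \<Rightarrow> 3" and \<epsilon> \<eta> assume \<epsilon>: "\<epsilon> \<in> signs" "\<eta> \<in> signs" and eq: "signed_perm \<sigma> \<epsilon> = signed_perm \<tau> \<eta>"
    have "\<epsilon> j = (if \<sigma> j = \<tau> j then \<eta> j else 0)" for j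
      using arg_cong[OF eq, of "\<lambda>P. P $ \<sigma> j $ j"] by (simp add: signed_perm_def)
    moreover have "\<epsilon> j \<noteq> 0" for j using signsD(1)[OF \<epsilon>(1), of j] by auto
    ultimately show "\<sigma> = \<tau> \<and> \<epsilon> = \<eta>" by (metis ext)
  qed
  then have S: "finite S" "card S = 48" unfolding S_def using fin fin' by (simp_all add: card_image card_cartesian_product)
  have O: "carrier octahedral_group = {P \<in> S. det P = 1}"
  proof (rule Set.set_eqI)
    fix P
    have "P \<in> S \<longleftrightarrow> (\<exists>\<sigma> \<epsilon>. \<sigma> permutes UNIV \<and> \<epsilon> \<in> signs \<and> P = signed_perm \<sigma> \<epsilon>)"
      unfolding S_def by auto
    then show "P \<in> carrier octahedral_group \<longleftrightarrow> P \<in> {P \<in> S. det P = 1}"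
      unfolding carrier_octahedral_group by blast
  qed
  then show "finite (carrier octahedral_group)" using S by simp
  have neg: "- P \<in> S" if in_S: "P \<in> S" for P
  proof -
    obtain \<sigma> \<epsilon> where P: "\<sigma> permutes UNIV" "\<epsilon> \<in> signs" "P = signed_perm \<sigma> \<epsilon>"
      using in_S by (auto simp: S_def)
    have "- P = signed_perm \<sigma> (\<lambda>j. - \<epsilon> j)" by (auto simp: P signed_perm_def vec_eq_iff)
    moreover have "(\<lambda>j. - \<epsilon> j) \<in> signs" using P(2) by (auto simp: signs_def Pi_iff)
    ultimately show ?thesis using P(1) by (auto simp: S_def)
  qed
  have det: "det P = 1 \<or> det P = -1" if in_S: "P \<in> S" for P
  proof -
    obtain \<sigma> \<epsilon> where P: "\<sigma> permutes UNIV" "\<epsilon> \<in> signs" "P = signed_perm \<sigma> \<epsilon>"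
      using in_S by (auto simp: S_def)
    then show ?thesis
      using perm_sign_signed_perm[OF P(1,2)] signsD(1)[OF P(2), of 1] signsD(1)[OF P(2), of 2] signsD(1)[OF P(2), of 3]
      by auto
  qed
  have det_neg: "det (- P) = - det P" for P :: "real^3^3" by (simp add: det_3)
  have "S = {P \<in> S. det P = 1} \<union> uminus ` {P \<in> S. det P = 1}"
  proof (intro equalityI subsetI)
    fix P assume P: "P \<in> S"
    show "P \<in> {P \<in> S. det P = 1} \<union> uminus ` {P \<in> S. det P = 1}"
    proof (cases "det P = 1")
      case False
      then have "det (- P) = 1" using det[OF P] by (simp add: det_neg)
      then have "P \<in> uminus ` {P \<in> S. det P = 1}" using neg[OF P] by (intro image_eqI[of _ _ "- P"]) auto
      then show ?thesis by blast
    qed (use P in auto)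
  qed (use neg in auto)
  moreover have "{P \<in> S. det P = 1} \<inter> uminus ` {P \<in> S. det P = 1} = {}"
    by (auto simp: det_neg)
  ultimately have "card S = card {P \<in> S. det P = 1} + card (uminus ` {P \<in> S. det P = 1})"
    using card_Un_disjoint[of "{P \<in> S. det P = 1}" "uminus ` {P \<in> S. det P = 1}"] S(1) by simp
  moreover have "card (uminus ` {P \<in> S. det P = 1}) = card {P \<in> S. det P = 1}"
    by (rule card_image) (simp add: inj_on_def)
  ultimately show "card (carrier octahedral_group) = 24" using S(2) O by simp
qed

section \<open>The octahedral group permutes the diagonals of the cube\<close>

text \<open>One vector on each of the four diagonals, oriented such that their sum is zero. The
  numbering 1, ..., 4 is that of \<open>sym_group 4\<close>.\<close>

definition diagonal :: "nat \<Rightarrow> real^3" where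
  "diagonal i = (if i = 1 then vector [1, 1, 1] else if i = 2 then vector [1, -1, -1]
    else if i = 3 then vector [-1, 1, -1] else vector [-1, -1, 1])"

lemma diagonal_simps:
  "diagonal 1 = vector [1, 1, 1]" "diagonal 2 = vector [1, -1, -1]"
  "diagonal 3 = vector [-1, 1, -1]" "diagonal 4 = vector [-1, -1, 1]"
  "diagonal (Suc 0) = vector [1, 1, 1]"
  by (simp_all add: diagonal_def)

lemma atLeast_1_4: "i \<in> {1..4} \<longleftrightarrow> i = 1 \<or> i = 2 \<or> i = 3 \<or> i = (4::nat)"
  by auto

lemma diagonal_entries: "diagonal i $ j = 1 \<or> diagonal i $ j = -1"
  using exhaust_3[of j] by (auto simp: diagonal_def)

lemma eq_up_to_sign: "\<lbrakk>x = a \<or> x = - a; x = b \<or> x = - b\<rbrakk> \<Longrightarrow> a = b \<or> a = - b"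
  for x :: "'a::ab_group_add"
  by (metis minus_minus)

lemma diagonal_unique:
  assumes "i \<in> {1..4}" "j \<in> {1..4}" "diagonal i = diagonal j \<or> diagonal i = - diagonal j"
  shows "i = j"
  using assms unfolding atLeast_1_4
  by (elim disjE; simp add: diagonal_def vec_eq_iff forall_3)

lemma diagonal_exists:
  assumes "\<And>a. v$a = 1 \<or> v$a = -1"
  shows "\<exists>j\<in>{1..4}. v = diagonal j \<or> v = - diagonal j"
proof -
  have "v = diagonal 1 \<or> v = - diagonal 1 \<or> v = diagonal 2 \<or> v = - diagonal 2
      \<or> v = diagonal 3 \<or> v = - diagonal 3 \<or> v = diagonal 4 \<or> v = - diagonal 4"
    using assms[of 1] assms[of 2] assms[of 3] unfolding diagonal_simps vec_eq_iff forall_3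
    by (elim disjE) simp_all
  then show ?thesis by (metis atLeast_1_4)
qed

text \<open>The diagonal is determined only as a line, hence the two signs. Outside {1..4} the value
  is the identity, as for an element of \<open>sym_group 4\<close>.\<close>

definition diagonal_action :: "real^3^3 \<Rightarrow> nat \<Rightarrow> nat" where
  "diagonal_action P i = (if i \<in> {1..4}
    then THE j. j \<in> {1..4} \<and> (P *v diagonal i = diagonal j \<or> P *v diagonal i = - diagonal j) else i)"

lemma signed_perm_vector_nth:
  assumes "\<sigma> permutes UNIV"
  shows "(signed_perm \<sigma> \<epsilon> *v v) $ \<sigma> a = \<epsilon> a * v$a"
proof -
  have "\<sigma> a = \<sigma> j \<longleftrightarrow> j = a" for j using permutes_inj[OF assms] by (auto simp: inj_def)
  then have "(signed_perm \<sigma> \<epsilon> *v v) $ \<sigma> a = (\<Sum>j\<in>UNIV. (if j = a then \<epsilon> j else 0) * v$j)"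
    by (simp add: matrix_vector_mult_def signed_perm_def)
  also have "\<dots> = (\<Sum>j\<in>UNIV. if j = a then \<epsilon> a * v$a else 0)"
    by (intro sum.cong) auto
  finally show ?thesis by simp
qed

lemma diagonal_action:
  assumes "P \<in> carrier octahedral_group" "i \<in> {1..4}"
  shows "diagonal_action P i \<in> {1..4}"
    and "P *v diagonal i = diagonal (diagonal_action P i) \<or> P *v diagonal i = - diagonal (diagonal_action P i)"
proof -
  obtain \<sigma> \<epsilon> where P: "\<sigma> permutes UNIV" "\<epsilon> \<in> signs" "P = signed_perm \<sigma> \<epsilon>"
    using assms(1) unfolding carrier_octahedral_group by blast
  have "(P *v diagonal i) $ b = 1 \<or> (P *v diagonal i) $ b = -1" for b
  proof -
    obtain a where "b = \<sigma> a" using permutes_surj[OF P(1)] by auto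
    then show ?thesis
      using signsD(1)[OF P(2), of a] diagonal_entries[of i a] by (auto simp: P(3) signed_perm_vector_nth[OF P(1)])
  qed
  then obtain j where j: "j \<in> {1..4}" "P *v diagonal i = diagonal j \<or> P *v diagonal i = - diagonal j"
    using diagonal_exists by blast
  have "j' = j" if "j' \<in> {1..4}" "P *v diagonal i = diagonal j' \<or> P *v diagonal i = - diagonal j'" for j'
    by (rule diagonal_unique[OF that(1) j(1) eq_up_to_sign[OF that(2) j(2)]])
  then have "(THE j. j \<in> {1..4} \<and> (P *v diagonal i = diagonal j \<or> P *v diagonal i = - diagonal j)) = j"
    using j by (intro the_equality) blast+
  then have "diagonal_action P i = j" unfolding diagonal_action_def if_P[OF assms(2)] .
  then show "diagonal_action P i \<in> {1..4}"
    "P *v diagonal i = diagonal (diagonal_action P i) \<or> P *v diagonal i = - diagonal (diagonal_action P i)"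
    using j by auto
qed

lemma diagonal_action_eqI:
  assumes "P \<in> carrier octahedral_group" "i \<in> {1..4}" "j \<in> {1..4}"
    and "P *v diagonal i = diagonal j \<or> P *v diagonal i = - diagonal j"
  shows "diagonal_action P i = j"
  by (rule diagonal_unique[OF diagonal_action(1)[OF assms(1,2)] assms(3)
      eq_up_to_sign[OF diagonal_action(2)[OF assms(1,2)] assms(4)]])

lemma matrix_vector_minus: "(A :: real^'n^'m) *v (- v) = - (A *v v)"
  using matrix_vector_mult_scaleR[of A "-1" v] by simp

text \<open>Suppose P preserves every diagonal. As the four chosen vectors have sum zero and this is
  essentially their only linear relation, P multiplies all of them by the same sign \<eta>; so P =
  \<eta> I, and det P = 1 forces \<eta> = 1. Surjectivity follows from 24 = 4!.\<close>

lemma octahedral_group_iso: "octahedral_group \<cong> sym_group 4"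
proof -
  interpret G: group octahedral_group by (rule group_octahedral_group)
  have perm: "diagonal_action P permutes {1..4}" if P: "P \<in> carrier octahedral_group" for P
  proof (rule bij_imp_permutes)
    have "inj_on (diagonal_action P) {1..4}"
    proof (rule inj_onI)
      fix i j :: nat assume ij: "i \<in> {1..4}" "j \<in> {1..4}" "diagonal_action P i = diagonal_action P j"
      have "P *v diagonal i = P *v diagonal j \<or> P *v diagonal i = P *v (- diagonal j)"
        using diagonal_action(2)[OF P ij(1)] diagonal_action(2)[OF P ij(2)] ij(3)
        unfolding matrix_vector_minus by (metis minus_minus)
      moreover have "invertible P"
        using P invertible_det_nz[of P] unfolding carrier_octahedral_group by auto
      ultimately have "diagonal i = diagonal j \<or> diagonal i = - diagonal j"
        by (metis invertible_def matrix_vector_mul_assoc matrix_vector_mul_lid)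
      then show "i = j" by (rule diagonal_unique[OF ij(1,2)])
    qed
    moreover have "diagonal_action P ` {1..4} \<subseteq> {1..4}" using diagonal_action(1)[OF P] by blast
    ultimately show "bij_betw (diagonal_action P) {1..4} {1..4}"
      by (simp add: bij_betw_def endo_inj_surj)
  qed (auto simp: diagonal_action_def)
  have mult: "diagonal_action (P ** Q) = diagonal_action P \<circ> diagonal_action Q"
    if PQ: "P \<in> carrier octahedral_group" "Q \<in> carrier octahedral_group" for P Q
  proof
    fix i
    have PQ': "P ** Q \<in> carrier octahedral_group"
      using G.m_closed[OF PQ] by (simp add: octahedral_group_def)
    show "diagonal_action (P ** Q) i = (diagonal_action P \<circ> diagonal_action Q) i"
    proof (cases "i \<in> {1..4}")
      case True
      define j where "j = diagonal_action Q i"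
      have j: "j \<in> {1..4}" "Q *v diagonal i = diagonal j \<or> Q *v diagonal i = - diagonal j"
        unfolding j_def by (rule diagonal_action[OF PQ(2) True])+
      have "(P ** Q) *v diagonal i = diagonal (diagonal_action P j) \<or> (P ** Q) *v diagonal i = - diagonal (diagonal_action P j)"
        using diagonal_action(2)[OF PQ(1) j(1)] j(2) unfolding matrix_vector_mul_assoc[symmetric]
        by (metis matrix_vector_minus minus_minus)
      then have "diagonal_action (P ** Q) i = diagonal_action P j"
        by (rule diagonal_action_eqI[OF PQ' True diagonal_action(1)[OF PQ(1) j(1)]])
      then show ?thesis by (simp add: j_def)
    qed (auto simp: diagonal_action_def)
  qed
  have hom: "diagonal_action \<in> hom octahedral_group (sym_group 4)"
    by (rule homI) (use perm mult in \<open>auto simp: sym_group_def octahedral_group_def\<close>)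
  have "P = \<one>\<^bsub>octahedral_group\<^esub>" if P: "P \<in> carrier octahedral_group" "diagonal_action P = \<one>\<^bsub>sym_group 4\<^esub>" for P
  proof -
    have "P *v diagonal i = diagonal i \<or> P *v diagonal i = - diagonal i" if "i \<in> {1..4}" for i
      using diagonal_action(2)[OF P(1) that] P(2) by (simp add: sym_group_def)
    from this[of 1] this[of 2] this[of 3] this[of 4]
    have d: "P *v diagonal 1 = diagonal 1 \<or> P *v diagonal 1 = - diagonal 1"
      "P *v diagonal 2 = diagonal 2 \<or> P *v diagonal 2 = - diagonal 2"
      "P *v diagonal 3 = diagonal 3 \<or> P *v diagonal 3 = - diagonal 3"
      "P *v diagonal 4 = diagonal 4 \<or> P *v diagonal 4 = - diagonal 4" by auto
    have "diagonal 1 + diagonal 2 + diagonal 3 + diagonal 4 = 0"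
      by (simp add: diagonal_simps vec_eq_iff forall_3)
    then have s: "P *v diagonal 1 + P *v diagonal 2 + P *v diagonal 3 + P *v diagonal 4 = 0"
      unfolding matrix_vector_right_distrib[symmetric] by (simp only: matrix_vector_mult_0_right)
    obtain \<eta> where \<eta>: "\<eta> = 1 \<or> \<eta> = (-1::real)" "P *v diagonal 1 = \<eta> *\<^sub>R diagonal 1" "P *v diagonal 2 = \<eta> *\<^sub>R diagonal 2"
      "P *v diagonal 3 = \<eta> *\<^sub>R diagonal 3" "P *v diagonal 4 = \<eta> *\<^sub>R diagonal 4"
    proof -
      obtain p q r t :: real where n: "p = 1 \<or> p = -1" "q = 1 \<or> q = -1" "r = 1 \<or> r = -1" "t = 1 \<or> t = -1"
        "P *v diagonal 1 = p *\<^sub>R diagonal 1" "P *v diagonal 2 = q *\<^sub>R diagonal 2"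
        "P *v diagonal 3 = r *\<^sub>R diagonal 3" "P *v diagonal 4 = t *\<^sub>R diagonal 4"
        using d by (metis scaleR_minus1_left scaleR_one)
      have "p + q - r - t = 0" "p - q + r - t = 0" "p - q - r + t = 0"
        using s[unfolded n(5-8)] by (auto simp: diagonal_simps vec_eq_iff forall_3)
      then have "q = p" "r = p" "t = p" by linarith+
      then show thesis using that[of p] n by auto
    qed
    have "P = \<eta> *\<^sub>R mat 1"
    proof -
      have e: "diagonal 1 + diagonal 2 = 2 *\<^sub>R axis 1 1" "diagonal 1 + diagonal 3 = 2 *\<^sub>R axis 2 1"
        "diagonal 1 + diagonal 4 = 2 *\<^sub>R axis 3 1"
        by (simp_all add: diagonal_simps vec_eq_iff forall_3 axis_def)
      have "P *v (2 *\<^sub>R axis j 1) = \<eta> *\<^sub>R (2 *\<^sub>R axis j 1)" for j :: 3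
        using exhaust_3[of j] \<eta>(2-5)
        by (elim disjE) (simp_all only: e[symmetric] matrix_vector_right_distrib scaleR_add_right)
      then have "2 *\<^sub>R (P *v axis j 1) = 2 *\<^sub>R (\<eta> *\<^sub>R axis j 1)" for j :: 3
        unfolding matrix_vector_mult_scaleR by (simp only: scaleR_left_commute[of \<eta> 2])
      then have "P *v axis j 1 = \<eta> *\<^sub>R axis j 1" for j :: 3
        unfolding scaleR_cancel_left by simp
      then have "column j P = \<eta> *\<^sub>R axis j 1" for j
        by (simp add: matrix_vector_mult_basis)
      then show ?thesis by (auto simp: vec_eq_iff column_def mat_def axis_def)
    qed
    moreover have "\<eta> = 1"
    proof -
      have "det (\<eta> *\<^sub>R mat 1 :: real^3^3) = \<eta> ^ 3" by (simp add: det_3 mat_def power3_eq_cube)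
      moreover have "det P = 1" using P(1) unfolding carrier_octahedral_group by blast
      ultimately have "\<eta> ^ 3 = 1" using \<open>P = \<eta> *\<^sub>R mat 1\<close> by simp
      then show ?thesis using \<eta>(1) by auto
    qed
    ultimately show ?thesis by (simp add: octahedral_group_def)
  qed
  then have inj: "inj_on diagonal_action (carrier octahedral_group)"
    using inj_on_one_iff'[OF hom group_octahedral_group sym_group_is_group] by blast
  have "diagonal_action ` carrier octahedral_group = carrier (sym_group 4)"
  proof (rule card_subset_eq)
    show "finite (carrier (sym_group 4))" by (simp add: sym_group_def finite_permutations)
    show "diagonal_action ` carrier octahedral_group \<subseteq> carrier (sym_group 4)" using hom by (auto simp: hom_def)
    show "card (diagonal_action ` carrier octahedral_group) = card (carrier (sym_group 4))"
      using card_image[OF inj] card_octahedral_group(2) sym_group_card_carrier[of 4] by (simp add: fact_numeral)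
  qed
  then show ?thesis unfolding is_iso_def iso_def using hom inj by (auto simp: bij_betw_def)
qed

section \<open>Conjugation actions\<close>

text \<open>Elements of \<open>Bij E\<close> are extensional functions, which is why the maps are
  restricted to \<open>E\<close>. The inverse group element supplies the inverse map.\<close>

lemma group_action_restrictI:
  assumes "group G"
    and closed: "\<And>g x. \<lbrakk>g \<in> carrier G; x \<in> E\<rbrakk> \<Longrightarrow> a g x \<in> E"
    and mult: "\<And>g h x. \<lbrakk>g \<in> carrier G; h \<in> carrier G; x \<in> E\<rbrakk> \<Longrightarrow> a (g \<otimes>\<^bsub>G\<^esub> h) x = a g (a h x)"
    and one: "\<And>x. x \<in> E \<Longrightarrow> a \<one>\<^bsub>G\<^esub> x = x"
  shows "group_action G E (\<lambda>g. restrict (a g) E)"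
proof -
  interpret group G by (rule assms(1))
  have inverse: "a (inv\<^bsub>G\<^esub> g) (a g x) = x" "a g (a (inv\<^bsub>G\<^esub> g) x) = x" if "g \<in> carrier G" "x \<in> E" for g x
    using mult[of "inv\<^bsub>G\<^esub> g" g x] mult[of g "inv\<^bsub>G\<^esub> g" x] one that by (simp_all add: l_inv r_inv)
  have bij: "restrict (a g) E \<in> Bij E" if g: "g \<in> carrier G" for g
  proof -
    have "bij_betw (a g) E E"
      by (rule bij_betw_byWitness[where f' = "a (inv\<^bsub>G\<^esub> g)"]) (use g closed inverse in auto)
    then show ?thesis unfolding Bij_def by (simp add: bij_betw_restrict_eq cong: bij_betw_cong)
  qed
  have "(\<lambda>g. restrict (a g) E) \<in> hom G (BijGroup E)"
  proof (rule homI)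
    fix g h assume gh: "g \<in> carrier G" "h \<in> carrier G"
    show "restrict (a (g \<otimes>\<^bsub>G\<^esub> h)) E = restrict (a g) E \<otimes>\<^bsub>BijGroup E\<^esub> restrict (a h) E"
      using bij[OF gh(1)] bij[OF gh(2)] gh by (auto simp: BijGroup_def compose_def mult closed restrict_def fun_eq_iff)
  qed (use bij in \<open>simp add: BijGroup_def\<close>)
  then show ?thesis
    unfolding group_action_def group_hom_def group_hom_axioms_def
    using assms(1) group_BijGroup by blast
qed

lemma conj_matrix_mult:
  assumes "P \<in> carrier octahedral_group" "Q \<in> carrier octahedral_group"
  shows "conj_matrix (P ** Q) M = conj_matrix P (conj_matrix Q M)"
proof -
  have inv: "A ** matrix_inv A = mat 1" "matrix_inv A ** A = mat 1" if "A \<in> carrier octahedral_group" for A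
    using that matrix_inv_signed_perm signed_perm_inverse unfolding carrier_octahedral_group by force+
  have cancel: "A ** (matrix_inv A ** B) = B" "matrix_inv A ** (A ** B) = B"
    if "A \<in> carrier octahedral_group" for A B :: "real^3^3"
    by (simp_all add: matrix_mul_assoc inv[OF that])
  have "matrix_inv (P ** Q) = matrix_inv Q ** matrix_inv P"
    by (rule matrix_inv_eqI) (simp_all add: matrix_mul_assoc[symmetric] cancel assms inv)
  then show ?thesis by (simp add: conj_matrix_def matrix_mul_assoc)
qed

lemma conj_matrix_one: "conj_matrix (mat 1) M = M"
proof -
  have "matrix_inv (mat 1 :: real^3^3) = mat 1" by (rule matrix_inv_eqI) auto
  then show ?thesis by (simp add: conj_matrix_def)
qed

lemma linear_conj_matrix: "linear (conj_matrix P)"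
proof (rule linearI)
  have distrib: "(A + B) ** C = A ** C + B ** C" for A B C :: "real^3^3"
    by (simp add: matrix_matrix_mult_def vec_eq_iff sum.distrib distrib_right)
  show "conj_matrix P (A + B) = conj_matrix P A + conj_matrix P B" for A B
    by (simp add: conj_matrix_def matrix_add_ldistrib distrib)
  show "conj_matrix P (c *\<^sub>R A) = c *\<^sub>R conj_matrix P A" for c A
    by (simp add: conj_matrix_def matrix_scalar_ac scalar_matrix_assoc)
qed

lemma conj_matrix_invariants:
  assumes P: "P \<in> carrier octahedral_group"
  shows "trace (conj_matrix P M) = trace M" "det (conj_matrix P M) = det M"
    and "M \<in> matrix_space \<Longrightarrow> conj_matrix P M \<in> matrix_space"
    and "conj_matrix P M = 0 \<longleftrightarrow> M = 0"
proof -
  obtain \<sigma> \<epsilon> where \<sigma>: "\<sigma> permutes UNIV" "\<epsilon> \<in> signs" "P = signed_perm \<sigma> \<epsilon>"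
    using P unfolding carrier_octahedral_group by blast
  have inv: "P ** matrix_inv P = mat 1" "matrix_inv P ** P = mat 1"
    using matrix_inv_signed_perm[OF \<sigma>(1,2)] signed_perm_inverse[OF \<sigma>(1,2)] \<sigma>(3) by auto
  show tr: "trace (conj_matrix P M) = trace M"
    unfolding conj_matrix_def by (subst trace_mul_sym) (simp add: matrix_mul_assoc inv)
  have "det P * det (matrix_inv P) = 1" using inv(1) by (metis det_I det_mul)
  then show "det (conj_matrix P M) = det M" unfolding conj_matrix_def det_mul by (simp add: algebra_simps)
  show "conj_matrix P M \<in> matrix_space" if M: "M \<in> matrix_space"
    unfolding matrix_space_iff tr
  proof (intro conjI allI impI)
    show "trace M = 0" using M by (simp add: matrix_space_iff)
    fix i j :: 3 assume "i \<noteq> j"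
    obtain a b where ab: "i = \<sigma> a" "j = \<sigma> b" using permutes_surj[OF \<sigma>(1)] by (metis surjD)
    then have "a \<noteq> b" using \<open>i \<noteq> j\<close> by blast
    then have "M$a$b = - M$b$a" by (rule M[unfolded matrix_space_iff, THEN conjunct2, rule_format])
    then show "conj_matrix P M $ i $ j = - conj_matrix P M $ j $ i"
      unfolding \<sigma>(3) ab conj_signed_perm_nth[OF \<sigma>(1,2)] by simp
  qed
  show "conj_matrix P M = 0 \<longleftrightarrow> M = 0"
  proof
    assume "conj_matrix P M = 0"
    then have "\<epsilon> a * \<epsilon> b * M$a$b = 0" for a b
      using conj_signed_perm_nth[OF \<sigma>(1,2), of M a b] \<sigma>(3) by simp
    then have "M$a$b = 0" for a b using signsD(2)[OF \<sigma>(2)] by (metis mult_eq_0_iff zero_neq_one)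
    then show "M = 0" by (simp add: vec_eq_iff)
  qed (use linear_0[OF linear_conj_matrix] in simp)
qed

lemma conj_point_span: "conj_point P (span {M}) = span {conj_matrix P M}"
  unfolding conj_point_def using linear_span_image[OF linear_conj_matrix, of P "{M}"] by simp

lemma conj_point_closed:
  assumes "P \<in> carrier octahedral_group"
  shows "p \<in> projectivisation matrix_space \<Longrightarrow> conj_point P p \<in> projectivisation matrix_space"
    and "p \<in> integrable_variety \<Longrightarrow> conj_point P p \<in> integrable_variety"
proof -
  show closed: "conj_point P p \<in> projectivisation matrix_space" if p: "p \<in> projectivisation matrix_space" for p
  proof -
    obtain M where "p = span {M}" "M \<in> matrix_space" "M \<noteq> 0" using p unfolding projectivisation_def by blast
    then show ?thesis
      unfolding projectivisation_def using conj_matrix_invariants(3,4)[OF assms, of M] conj_point_span by blast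
  qed
  show "p \<in> integrable_variety \<Longrightarrow> conj_point P p \<in> integrable_variety"
    unfolding integrable_variety_def using closed conj_matrix_invariants(1,2)[OF assms]
    by (auto simp: conj_point_def)
qed

lemma group_actions_conj_point:
  "group_action octahedral_group (projectivisation matrix_space)
     (\<lambda>P. restrict (conj_point P) (projectivisation matrix_space))"
  "group_action octahedral_group integrable_variety (\<lambda>P. restrict (conj_point P) integrable_variety)"
proof -
  have mult: "conj_point (P \<otimes>\<^bsub>octahedral_group\<^esub> Q) p = conj_point P (conj_point Q p)"
    if "P \<in> carrier octahedral_group" "Q \<in> carrier octahedral_group" for P Q p
    using conj_matrix_mult[OF that] by (simp add: octahedral_group_def conj_point_def image_image)
  have one: "conj_point \<one>\<^bsub>octahedral_group\<^esub> p = p" for p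
    by (simp add: octahedral_group_def conj_point_def conj_matrix_one)
  show "group_action octahedral_group (projectivisation matrix_space)
     (\<lambda>P. restrict (conj_point P) (projectivisation matrix_space))"
    by (rule group_action_restrictI[OF group_octahedral_group]) (use conj_point_closed(1) mult one in auto)
  show "group_action octahedral_group integrable_variety (\<lambda>P. restrict (conj_point P) integrable_variety)"
    by (rule group_action_restrictI[OF group_octahedral_group]) (use conj_point_closed(2) mult one in auto)
qed


section \<open>Equivalence of the associated matrices\<close>

text \<open>The skew part of the matrix is the cross product with \<open>t\<close>, so conjugation
  by a rotation P turns \<open>t\<close> into P t. The diagonal is merely permuted, whereas the
  differences of the permuted w_j acquire the sign of \<sigma>; the factor \<open>perm_sign\<close>
  restores agreement and passes to \<open>t\<close> as well. As the w_j have sum zero, the diagonal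
  determines them.\<close>

lemma assoc_signed_perm_iff:
  fixes w t w' t' :: "real^3"
  assumes \<sigma>: "\<sigma> permutes UNIV" and \<epsilon>: "\<epsilon> \<in> signs" and det: "det (signed_perm \<sigma> \<epsilon>) = 1"
    and w: "w$1 + w$2 + w$3 = 0" "w'$1 + w'$2 + w'$3 = 0"
  shows "assoc_matrix w' t' = perm_sign (signed_perm \<sigma> \<epsilon>) *\<^sub>R conj_matrix (signed_perm \<sigma> \<epsilon>) (assoc_matrix w t)
    \<longleftrightarrow> (\<forall>j. w'$\<sigma> j = w$j \<and> t'$\<sigma> j = perm_sign (signed_perm \<sigma> \<epsilon>) * \<epsilon> j * t$j)"
proof -
  define c where "c = perm_sign (signed_perm \<sigma> \<epsilon>)"
  have abs: "\<bar>\<epsilon> j\<bar> = 1" for j using signsD(1)[OF \<epsilon>, of j] by auto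
  have c: "c = det (\<chi> i j. if i = \<sigma> j then 1 else (0::real))"
    unfolding c_def perm_sign_def by (rule arg_cong[of _ _ det]) (simp add: vec_eq_iff signed_perm_def abs)
  have prod: "c * (\<epsilon> 1 * \<epsilon> 2 * \<epsilon> 3) = 1"
    using perm_sign_signed_perm(2)[OF \<sigma> \<epsilon>] det by (simp add: c_def)
  have "assoc_matrix w' t' = c *\<^sub>R conj_matrix (signed_perm \<sigma> \<epsilon>) (assoc_matrix w t)
    \<longleftrightarrow> (\<forall>a b. assoc_matrix w' t' $ \<sigma> a $ \<sigma> b = c * (\<epsilon> a * \<epsilon> b * assoc_matrix w t $ a $ b))" (is "?M = ?N \<longleftrightarrow> ?R")
  proof
    assume "?M = ?N"
    then show ?R by (simp add: conj_signed_perm_nth[OF \<sigma> \<epsilon>])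
  next
    assume R: ?R
    have "?M $ i $ j = ?N $ i $ j" for i j
    proof -
      obtain a b where "i = \<sigma> a" "j = \<sigma> b" using permutes_surj[OF \<sigma>] by (metis surjD)
      then show ?thesis using R by (simp add: conj_signed_perm_nth[OF \<sigma> \<epsilon>])
    qed
    then show "?M = ?N" by (simp add: vec_eq_iff)
  qed
  also have "\<dots> \<longleftrightarrow> (\<forall>j. w'$\<sigma> j = w$j \<and> t'$\<sigma> j = c * \<epsilon> j * t$j)"
  proof -
    have A: "assoc_matrix w t $ 1 $ 1 = w$2 - w$3" "assoc_matrix w t $ 2 $ 2 = w$3 - w$1" "assoc_matrix w t $ 3 $ 3 = w$1 - w$2"
      "assoc_matrix w t $ 1 $ 2 = - t$3" "assoc_matrix w t $ 2 $ 1 = t$3" "assoc_matrix w t $ 1 $ 3 = t$2"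
      "assoc_matrix w t $ 3 $ 1 = - t$2" "assoc_matrix w t $ 2 $ 3 = - t$1" "assoc_matrix w t $ 3 $ 2 = t$1" for w t
      by (simp_all add: assoc_matrix_def matrix_form_def)
    have \<epsilon>': "\<epsilon> 1 = 1 \<or> \<epsilon> 1 = -1" "\<epsilon> 2 = 1 \<or> \<epsilon> 2 = -1" "\<epsilon> 3 = 1 \<or> \<epsilon> 3 = -1"
      by (rule signsD(1)[OF \<epsilon>])+
    have w3: "w$3 = - w$1 - w$2" "w'$3 = - w'$1 - w'$2" using w by auto
    consider "\<sigma> 1 = 1" "\<sigma> 2 = 2" "\<sigma> 3 = 3" | "\<sigma> 1 = 1" "\<sigma> 2 = 3" "\<sigma> 3 = 2"
      | "\<sigma> 1 = 2" "\<sigma> 2 = 1" "\<sigma> 3 = 3" | "\<sigma> 1 = 2" "\<sigma> 2 = 3" "\<sigma> 3 = 1"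
      | "\<sigma> 1 = 3" "\<sigma> 2 = 1" "\<sigma> 3 = 2" | "\<sigma> 1 = 3" "\<sigma> 2 = 2" "\<sigma> 3 = 1"
      using permutes_3_cases[OF \<sigma>] by auto
    then show ?thesis
    proof cases
      case 1
      then have "c = 1" by (simp add: c det_3)
      then show ?thesis unfolding forall_3 1 A using \<epsilon>' prod w3
        by (elim disjE; simp; argo)
    next
      case 2
      then have "c = -1" by (simp add: c det_3)
      then show ?thesis unfolding forall_3 2 A using \<epsilon>' prod w3
        by (elim disjE; simp; argo)
    next
      case 3
      then have "c = -1" by (simp add: c det_3)
      then show ?thesis unfolding forall_3 3 A using \<epsilon>' prod w3
        by (elim disjE; simp; argo)
    next
      case 4
      then have "c = 1" by (simp add: c det_3)
      then show ?thesis unfolding forall_3 4 A using \<epsilon>' prod w3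
        by (elim disjE; simp; argo)
    next
      case 5
      then have "c = 1" by (simp add: c det_3)
      then show ?thesis unfolding forall_3 5 A using \<epsilon>' prod w3
        by (elim disjE; simp; argo)
    next
      case 6
      then have "c = -1" by (simp add: c det_3)
      then show ?thesis unfolding forall_3 6 A using \<epsilon>' prod w3
        by (elim disjE; simp; argo)
    qed
  qed
  finally show ?thesis unfolding c_def .
qed

text \<open>\<open>S\<^sub>4\<close> as the group of permutations of three objects combined with an even number of sign changes.\<close>

definition data_equiv :: "real^3 \<Rightarrow> real^3 \<Rightarrow> real^3 \<Rightarrow> real^3 \<Rightarrow> bool" where
  "data_equiv w t w' t' \<longleftrightarrow> (\<exists>\<sigma> \<eta>. \<sigma> permutes UNIV \<and> \<eta> \<in> signs \<and> \<eta> 1 * \<eta> 2 * \<eta> 3 = 1 \<and>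
    (\<forall>j. w'$\<sigma> j = w$j \<and> t'$\<sigma> j = \<eta> j * t$j))"

text \<open>The substitution \<eta>_j = sgn(\<sigma>) \<epsilon>_j turns the condition det P = 1
  into an even number of sign changes, since \<eta>_1 \<eta>_2 \<eta>_3 = sgn(\<sigma>)^3
  \<epsilon>_1 \<epsilon>_2 \<epsilon>_3 = det P.\<close>

lemma assoc_matrix_equiv_iff:
  assumes w: "w$1 + w$2 + w$3 = 0" "w'$1 + w'$2 + w'$3 = 0"
  shows "(\<exists>P\<in>carrier octahedral_group. assoc_matrix w' t' = perm_sign P *\<^sub>R conj_matrix P (assoc_matrix w t))
    \<longleftrightarrow> data_equiv w t w' t'"
proof
  assume "\<exists>P\<in>carrier octahedral_group. assoc_matrix w' t' = perm_sign P *\<^sub>R conj_matrix P (assoc_matrix w t)"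
  then obtain \<sigma> \<epsilon> where \<sigma>: "\<sigma> permutes UNIV" "\<epsilon> \<in> signs" "det (signed_perm \<sigma> \<epsilon>) = 1"
    and eq: "assoc_matrix w' t' = perm_sign (signed_perm \<sigma> \<epsilon>) *\<^sub>R conj_matrix (signed_perm \<sigma> \<epsilon>) (assoc_matrix w t)"
    unfolding carrier_octahedral_group Bex_def by blast
  define c where "c = perm_sign (signed_perm \<sigma> \<epsilon>)"
  have c: "c = 1 \<or> c = -1" "c * (\<epsilon> 1 * \<epsilon> 2 * \<epsilon> 3) = 1"
    using perm_sign_signed_perm[OF \<sigma>(1,2)] \<sigma>(3) by (auto simp: c_def)
  have data: "\<forall>j. w'$\<sigma> j = w$j \<and> t'$\<sigma> j = c * \<epsilon> j * t$j"
    using assoc_signed_perm_iff[OF \<sigma> w] eq unfolding c_def by blast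
  have "(\<lambda>j. c * \<epsilon> j) \<in> signs"
    by (rule signsI) (use c(1) signsD(1)[OF \<sigma>(2)] in \<open>metis mult_1 mult_minus1 minus_minus\<close>)
  moreover have "(c * \<epsilon> 1) * (c * \<epsilon> 2) * (c * \<epsilon> 3) = 1" using c by (elim disjE) auto
  ultimately show "data_equiv w t w' t'"
    unfolding data_equiv_def using \<sigma>(1) data by (intro exI[of _ \<sigma>] exI[of _ "\<lambda>j. c * \<epsilon> j"]) simp
next
  assume "data_equiv w t w' t'"
  then obtain \<sigma> \<eta> where \<sigma>: "\<sigma> permutes UNIV" "\<eta> \<in> signs" and \<eta>: "\<eta> 1 * \<eta> 2 * \<eta> 3 = 1"
    and data: "\<forall>j. w'$\<sigma> j = w$j \<and> t'$\<sigma> j = \<eta> j * t$j"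
    unfolding data_equiv_def by blast
  define c where "c = perm_sign (signed_perm \<sigma> \<eta>)"
  have c: "c = 1 \<or> c = -1" using perm_sign_signed_perm[OF \<sigma>] by (simp add: c_def)
  define \<epsilon> where "\<epsilon> = (\<lambda>j. c * \<eta> j)"
  have \<epsilon>: "\<epsilon> \<in> signs"
    unfolding \<epsilon>_def by (rule signsI) (use c(1) signsD(1)[OF \<sigma>(2)] in \<open>metis mult_1 mult_minus1 minus_minus\<close>)
  have c': "perm_sign (signed_perm \<sigma> \<epsilon>) = c"
  proof -
    have "\<bar>\<epsilon> j\<bar> = \<bar>\<eta> j\<bar>" for j using c by (auto simp: \<epsilon>_def abs_mult)
    then show ?thesis
      unfolding c_def perm_sign_def by (intro arg_cong[of _ _ det]) (simp add: vec_eq_iff signed_perm_def)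
  qed
  have "c * (\<epsilon> 1 * \<epsilon> 2 * \<epsilon> 3) = 1" using c \<eta> by (auto simp: \<epsilon>_def)
  then have det: "det (signed_perm \<sigma> \<epsilon>) = 1" using perm_sign_signed_perm(2)[OF \<sigma>(1) \<epsilon>] c' by simp
  have "\<forall>j. w'$\<sigma> j = w$j \<and> t'$\<sigma> j = c * \<epsilon> j * t$j" using data c by (auto simp: \<epsilon>_def)
  then have "assoc_matrix w' t' = perm_sign (signed_perm \<sigma> \<epsilon>) *\<^sub>R conj_matrix (signed_perm \<sigma> \<epsilon>) (assoc_matrix w t)"
    using assoc_signed_perm_iff[OF \<sigma>(1) \<epsilon> det w] unfolding c' by blast
  moreover have "signed_perm \<sigma> \<epsilon> \<in> carrier octahedral_group"
    unfolding carrier_octahedral_group using \<sigma>(1) \<epsilon> det by blast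
  ultimately show "\<exists>P\<in>carrier octahedral_group. assoc_matrix w' t' = perm_sign P *\<^sub>R conj_matrix P (assoc_matrix w t)"
    by blast
qed

text \<open>If the signs found from the squares have product -1, equality of the products forces
  some t_j = 0, and the sign at this index can be reversed.\<close>

lemma adjust_signs:
  fixes t u :: "3 \<Rightarrow> real"
  assumes "\<And>j. (u j)\<^sup>2 = (t j)\<^sup>2" and "u 1 * u 2 * u 3 = t 1 * t 2 * t 3"
  obtains \<eta> where "\<eta> \<in> signs" "\<eta> 1 * \<eta> 2 * \<eta> 3 = 1" "\<And>j. u j = \<eta> j * t j"
proof -
  define \<epsilon> where "\<epsilon> = (\<lambda>j. if u j = t j then 1 else -1 :: real)"
  have \<epsilon>: "\<epsilon> \<in> signs" by (rule signsI) (simp add: \<epsilon>_def)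
  have u: "u j = \<epsilon> j * t j" for j using assms(1)[of j] by (auto simp: \<epsilon>_def power2_eq_iff)
  show thesis
  proof (cases "\<epsilon> 1 * \<epsilon> 2 * \<epsilon> 3 = 1")
    case True
    then show thesis using that \<epsilon> u by blast
  next
    case False
    then have m: "\<epsilon> 1 * \<epsilon> 2 * \<epsilon> 3 = -1"
      using signsD(1)[OF \<epsilon>, of 1] signsD(1)[OF \<epsilon>, of 2] signsD(1)[OF \<epsilon>, of 3] by auto
    have "u 1 * u 2 * u 3 = (\<epsilon> 1 * \<epsilon> 2 * \<epsilon> 3) * (t 1 * t 2 * t 3)" unfolding u by (simp add: mult_ac)
    then have "t 1 * t 2 * t 3 = 0" using assms(2) m by simp
    then obtain j where j: "t j = 0" by auto
    define \<eta> where "\<eta> = \<epsilon>(j := - \<epsilon> j)"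
    have "\<eta> i = 1 \<or> \<eta> i = -1" for i using signsD(1)[OF \<epsilon>, of i] by (auto simp: \<eta>_def)
    then have "\<eta> \<in> signs" by (rule signsI)
    moreover have "\<eta> 1 * \<eta> 2 * \<eta> 3 = 1" using m exhaust_3[of j] by (auto simp: \<eta>_def)
    moreover have "u i = \<eta> i * t i" for i using u[of i] j by (auto simp: \<eta>_def)
    ultimately show thesis using that by blast
  qed
qed

lemma permutation_from_counts:
  fixes f g :: "3 \<Rightarrow> 'b"
  assumes "\<And>y. (\<Sum>j\<in>UNIV. if f j = y then 1 else 0 :: real) = (\<Sum>j\<in>UNIV. if g j = y then 1 else 0)"
  obtains \<sigma> where "\<sigma> permutes UNIV" "\<And>j. f j = g (\<sigma> j)"
proof -
  have c: "real (count (image_mset h (mset_set UNIV)) y) = (\<Sum>j\<in>UNIV. if h j = y then 1 else 0)" for h :: "3 \<Rightarrow> 'b" and y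
    unfolding UNIV_3 by simp
  have "image_mset f (mset_set UNIV) = image_mset g (mset_set UNIV)"
  proof (rule multiset_eqI)
    show "count (image_mset f (mset_set UNIV)) y = count (image_mset g (mset_set UNIV)) y" for y
      using assms[of y] c[of f y] c[of g y] by simp
  qed
  then show thesis using image_mset_eq_implies_permutes[of UNIV f g] that by (metis UNIV_I finite)
qed

text \<open>Includes a = b = 0 with factor 1, the case of zero associated matrices, that is, of
  constant curvature tensors.\<close>

lemma span_singleton_eq_iff:
  "span {a} = span {b :: 'a::real_vector} \<longleftrightarrow> (\<exists>c. c \<noteq> 0 \<and> a = c *\<^sub>R b)"
proof
  assume eq: "span {a} = span {b}"
  have "a \<in> span {b}" "b \<in> span {a}" using eq span_base[of a "{a}"] span_base[of b "{b}"] by auto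
  then obtain c where "a = c *\<^sub>R b" by (auto simp: span_singleton)
  moreover obtain d where "b = d *\<^sub>R a" using \<open>b \<in> span {a}\<close> by (auto simp: span_singleton)
  ultimately show "\<exists>c. c \<noteq> 0 \<and> a = c *\<^sub>R b"
    by (cases "c = 0") (auto intro: exI[of _ 1])
next
  assume "\<exists>c. c \<noteq> 0 \<and> a = c *\<^sub>R b"
  then obtain c where c: "c \<noteq> 0" "a = c *\<^sub>R b" by blast
  then have "b = (1 / c) *\<^sub>R a" by simp
  then have "a \<in> span {b}" "b \<in> span {a}" using c by (metis insertI1 span_base span_scale)+
  then show "span {a} = span {b}" by (intro antisym span_minimal) auto
qed

section \<open>Isometries of diagonal curvature tensors\<close>

context orthonormal_frame
begin

lemma diag_form_frame_left:
  assumes "i < 4" "j < 4"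
  shows "diag_form k (e i) (e j) c d = k i j * ((c \<bullet> e i) * (d \<bullet> e j) - (c \<bullet> e j) * (d \<bullet> e i))"
proof -
  have "diag_form k (e i) (e j) c d = (\<Sum>p<4. \<Sum>q<4. if q = j then (if p = i then k i j * ((c \<bullet> e i) * (d \<bullet> e j) - (c \<bullet> e j) * (d \<bullet> e i)) else 0) else 0)"
    unfolding diag_form_def by (intro sum.cong refl) (use assms orthonormal in auto)
  then show ?thesis using assms by simp
qed

lemma diag_form_frame_right:
  assumes "i < 4" "j < 4" and k: "\<And>i j. k i j = k j i"
  shows "diag_form k a b (e i) (e j) = k i j * ((a \<bullet> e i) * (b \<bullet> e j) - (a \<bullet> e j) * (b \<bullet> e i))"
proof -
  have "diag_form k a b (e i) (e j) = (\<Sum>p<4. \<Sum>q<4. (if q = j then (if p = i then k i j * ((a \<bullet> e i) * (b \<bullet> e j)) else 0) else 0)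
    - (if q = i then (if p = j then k i j * ((a \<bullet> e j) * (b \<bullet> e i)) else 0) else 0))"
    unfolding diag_form_def by (intro sum.cong refl) (use assms orthonormal k[of i j] in auto)
  then show ?thesis using assms by (simp add: sum_subtractf right_diff_distrib)
qed

lemma orthogonal_frame:
  fixes \<phi> :: "'a \<Rightarrow> 'a"
  assumes "orthogonal_transformation \<phi>"
  shows "orthonormal_frame (\<phi> \<circ> e)"
proof
  fix i j :: nat assume "i < 4" "j < 4"
  then show "(\<phi> \<circ> e) i \<bullet> (\<phi> \<circ> e) j = (if i = j then 1 else 0)"
    using assms orthonormal by (simp add: orthogonal_transformation_def)
qed (rule dim4)

lemma isometric_imp_data_equiv:
  assumes D: "diagonal_curvature_tensor e R w t s" and D': "diagonal_curvature_tensor e R' w' t' s'"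
    and \<phi>: "orthogonal_transformation \<phi>" and R': "R' = pullback_tensor \<phi> R"
  shows "s = s' \<and> data_equiv w t w' t'"
proof -
  interpret f: orthonormal_frame "\<phi> \<circ> e" by (rule orthogonal_frame[OF \<phi>])
  note D1 = diagonal_curvature_tensorD[OF D] and D2 = diagonal_curvature_tensorD[OF D']
  have R: "algebraic_curvature_tensor R" using D unfolding diagonal_curvature_tensor_def by blast
  define k where "k = sec R"
  define k' where "k' = sec R'"
  have fsec: "f.sec R = k'" by (simp add: fun_eq_iff f.sec_def k'_def sec_def R' pullback_tensor_def)
  have "diagonal_tensor (\<phi> \<circ> e) R"
    using D' unfolding diagonal_curvature_tensor_def diagonal_tensor_def R' pullback_tensor_def by simp
  then have R_f: "R = f.diag_form k'" using f.diagonal_tensor_eq_diag_form[OF R] fsec by simp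
  \<comment> \<open>\<open>A\<close> is the matrix of the isometry in the frame, and
    \<open>C\<close> collects its 2 by 2 minors, the action on bivectors.\<close>
  define A where "A = (\<lambda>i m. \<phi> (e i) \<bullet> e m)"
  define C where "C = (\<lambda>i j m n. A i m * A j n - A i n * A j m)"
  \<comment> \<open>R is diagonal in both frames, so a mixed component can be evaluated with the
    eigenvalues of either frame.\<close>
  have C_zero: "C i j m n = 0 \<or> k' i j = k m n" if "i < 4" "j < 4" "m < 4" "n < 4" for i j m n
  proof -
    have "R (\<phi> (e i)) (\<phi> (e j)) (e m) (e n) = k m n * C i j m n"
      using diag_form_frame_right[OF that(3,4), of "sec R", OF D1(2), of "\<phi> (e i)" "\<phi> (e j)"] D1(1)
      by (simp add: k_def C_def A_def)
    moreover have "R (\<phi> (e i)) (\<phi> (e j)) (e m) (e n) = k' i j * C i j m n"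
      using f.diag_form_frame_left[OF that(1,2), of k' "e m" "e n"] R_f
      by (simp add: C_def A_def inner_commute mult.commute)
    ultimately show ?thesis by auto
  qed
  have row: "(\<Sum>m<4. A i m * A j m) = (if i = j then 1 else 0)" if "i < 4" "j < 4" for i j
    using inner_frame[of "\<phi> (e i)" "\<phi> (e j)"] f.orthonormal[OF that] by (simp add: A_def)
  have col: "(\<Sum>i<4. A i m * A i n) = (if m = n then 1 else 0)" if "m < 4" "n < 4" for m n
    using f.inner_frame[of "e m" "e n"] orthonormal[OF that] by (simp add: A_def inner_commute)
  \<comment> \<open>The eigenvalues of the Ricci tensor in the two frames.\<close>
  define \<rho> where "\<rho> = (\<lambda>m. \<Sum>n<4. k m n)"
  define \<rho>' where "\<rho>' = (\<lambda>i. \<Sum>j<4. k' i j)"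
  have kk: "k m m = 0" and kk': "k' m m = 0" for m using D1(3) D2(3) by (simp_all add: k_def k'_def)
  \<comment> \<open>Contracting the previous relation with \<open>A\<close> passes from minors to
    entries: orthonormality leaves A_im \<rho>_m on one side and A_im \<rho>'_i on the
    other.\<close>
  have A_zero: "A i m = 0 \<or> \<rho>' i = \<rho> m" if im: "i < 4" "m < 4" for i m
  proof -
    have "(\<Sum>j<4. \<Sum>n<4. A j n * (C i j m n * k m n)) = (\<Sum>j<4. \<Sum>n<4. A j n * (C i j m n * k' i j))"
      using C_zero[OF im(1) _ im(2)] by (intro sum.cong refl) fastforce
    moreover have "(\<Sum>j<4. \<Sum>n<4. A j n * (C i j m n * k m n)) = A i m * \<rho> m"
    proof -
      have "(\<Sum>j<4. \<Sum>n<4. A j n * (C i j m n * k m n)) = (\<Sum>n<4. \<Sum>j<4. A j n * (C i j m n * k m n))"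
        by (rule sum.swap)
      also have "\<dots> = (\<Sum>n<4. k m n * (A i m * (\<Sum>j<4. A j n * A j n) - A i n * (\<Sum>j<4. A j n * A j m)))"
        unfolding sum_distrib_left sum_subtractf[symmetric] C_def by (intro sum.cong refl) (simp add: algebra_simps)
      also have "\<dots> = (\<Sum>n<4. k m n * A i m)"
        using col im kk by (intro sum.cong refl) auto
      finally show ?thesis by (simp add: \<rho>_def sum_distrib_left mult.commute)
    qed
    moreover have "(\<Sum>j<4. \<Sum>n<4. A j n * (C i j m n * k' i j)) = A i m * \<rho>' i"
    proof -
      have "(\<Sum>j<4. \<Sum>n<4. A j n * (C i j m n * k' i j))
        = (\<Sum>j<4. k' i j * (A i m * (\<Sum>n<4. A j n * A j n) - A j m * (\<Sum>n<4. A i n * A j n)))"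
        unfolding sum_distrib_left sum_subtractf[symmetric] C_def by (intro sum.cong refl) (simp add: algebra_simps)
      also have "\<dots> = (\<Sum>j<4. k' i j * A i m)"
        using row im kk' by (intro sum.cong refl) auto
      finally show ?thesis by (simp add: \<rho>'_def sum_distrib_left mult.commute)
    qed
    ultimately show ?thesis by auto
  qed
  text \<open>The squares of the entries of \<open>\<phi>\<close> and of its second compound are doubly stochastic matrices
    that vanish unless the labels of row and column agree, so both sides have the same labels with
    the same multiplicities.\<close>
  have \<rho>_sum: "(\<Sum>i<4. g (\<rho>' i)) = (\<Sum>m<4. g (\<rho> m))" for g :: "real \<Rightarrow> real"
  proof -
    have "(\<Sum>i<4. g (\<rho>' i)) = (\<Sum>i<4. \<Sum>m<4. g (\<rho>' i) * (A i m * A i m))"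
      unfolding sum_distrib_left[symmetric] using row by simp
    also have "\<dots> = (\<Sum>i<4. \<Sum>m<4. g (\<rho> m) * (A i m * A i m))"
      using A_zero by (intro sum.cong refl) fastforce
    also have "\<dots> = (\<Sum>m<4. \<Sum>i<4. g (\<rho> m) * (A i m * A i m))" by (rule sum.swap)
    also have "\<dots> = (\<Sum>m<4. g (\<rho> m))" unfolding sum_distrib_left[symmetric] using col by simp
    finally show ?thesis .
  qed
  have C_row: "(\<Sum>m<4. \<Sum>n<4. (C i j m n)\<^sup>2) = (if i = j then 0 else 2)" if "i < 4" "j < 4" for i j
  proof -
    have "(\<Sum>m<4. \<Sum>n<4. (C i j m n)\<^sup>2) = (\<Sum>m<4. \<Sum>n<4. (A i m * A i m) * (A j n * A j n))
      + (\<Sum>m<4. \<Sum>n<4. (A j m * A j m) * (A i n * A i n)) - 2 * (\<Sum>m<4. \<Sum>n<4. (A i m * A j m) * (A i n * A j n))"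
      unfolding sum_distrib_left sum.distrib[symmetric] sum_subtractf[symmetric] C_def
      by (intro sum.cong refl) (simp add: power2_eq_square algebra_simps)
    then show ?thesis unfolding sum_product[symmetric] using row that by simp
  qed
  have C_col: "(\<Sum>i<4. \<Sum>j<4. (C i j m n)\<^sup>2) = (if m = n then 0 else 2)" if "m < 4" "n < 4" for m n
  proof -
    have "(\<Sum>i<4. \<Sum>j<4. (C i j m n)\<^sup>2) = (\<Sum>i<4. \<Sum>j<4. (A i m * A i m) * (A j n * A j n))
      + (\<Sum>i<4. \<Sum>j<4. (A i n * A i n) * (A j m * A j m)) - 2 * (\<Sum>i<4. \<Sum>j<4. (A i m * A i n) * (A j m * A j n))"
      unfolding sum_distrib_left sum.distrib[symmetric] sum_subtractf[symmetric] C_def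
      by (intro sum.cong refl) (simp add: power2_eq_square algebra_simps)
    then show ?thesis unfolding sum_product[symmetric] using col that by simp
  qed
  have label_sum: "(\<Sum>i<4. \<Sum>j<4. if i = j then 0 else 2 * g (k' i j) (\<rho>' i + \<rho>' j))
    = (\<Sum>m<4. \<Sum>n<4. if m = n then 0 else 2 * g (k m n) (\<rho> m + \<rho> n))" for g :: "real \<Rightarrow> real \<Rightarrow> real"
  proof -
    have "(\<Sum>i<4. \<Sum>j<4. if i = j then 0 else 2 * g (k' i j) (\<rho>' i + \<rho>' j))
      = (\<Sum>i<4. \<Sum>j<4. \<Sum>m<4. \<Sum>n<4. g (k' i j) (\<rho>' i + \<rho>' j) * (C i j m n)\<^sup>2)"
      unfolding sum_distrib_left[symmetric] by (intro sum.cong refl) (simp add: C_row)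
    also have "\<dots> = (\<Sum>i<4. \<Sum>j<4. \<Sum>m<4. \<Sum>n<4. g (k m n) (\<rho> m + \<rho> n) * (C i j m n)\<^sup>2)"
    proof (intro sum.cong refl)
      fix i j m n :: nat assume "i \<in> {..<4}" "j \<in> {..<4}" "m \<in> {..<4}" "n \<in> {..<4}"
      then have lt: "i < 4" "j < 4" "m < 4" "n < 4" by auto
      show "g (k' i j) (\<rho>' i + \<rho>' j) * (C i j m n)\<^sup>2 = g (k m n) (\<rho> m + \<rho> n) * (C i j m n)\<^sup>2"
      proof (cases "C i j m n = 0")
        case False
        then have "k' i j = k m n" using C_zero[OF lt] by blast
        moreover have "A i m \<noteq> 0 \<and> A j n \<noteq> 0 \<or> A i n \<noteq> 0 \<and> A j m \<noteq> 0" using False by (auto simp: C_def)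
        then have "\<rho>' i + \<rho>' j = \<rho> m + \<rho> n"
          using A_zero[OF lt(1,3)] A_zero[OF lt(2,4)] A_zero[OF lt(1,4)] A_zero[OF lt(2,3)] by auto
        ultimately show ?thesis by simp
      qed simp
    qed
    also have "\<dots> = (\<Sum>m<4. \<Sum>n<4. \<Sum>i<4. \<Sum>j<4. g (k m n) (\<rho> m + \<rho> n) * (C i j m n)\<^sup>2)"
    proof -
      have "(\<Sum>i<4. \<Sum>j<4. \<Sum>m<4. \<Sum>n<4. h i j m n) = (\<Sum>m<4. \<Sum>n<4. \<Sum>i<4. \<Sum>j<4. h i j m n)"
        for h :: "nat \<Rightarrow> nat \<Rightarrow> nat \<Rightarrow> nat \<Rightarrow> real"
      proof -
        have pair: "(\<Sum>i<4. \<Sum>j<4. H i j) = (\<Sum>p\<in>{..<4} \<times> {..<4}. H (fst p) (snd p))"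
          for H :: "nat \<Rightarrow> nat \<Rightarrow> real"
          by (simp add: sum.cartesian_product case_prod_beta)
        show ?thesis unfolding pair by (rule sum.swap)
      qed
      then show ?thesis .
    qed
    also have "\<dots> = (\<Sum>m<4. \<Sum>n<4. if m = n then 0 else 2 * g (k m n) (\<rho> m + \<rho> n))"
      unfolding sum_distrib_left[symmetric] by (intro sum.cong refl) (simp add: C_col)
    finally show ?thesis .
  qed
  have K: "k 1 0 = k 0 1" "k 2 0 = k 0 2" "k 3 0 = k 0 3" "k 2 1 = k 1 2" "k 3 1 = k 1 3" "k 3 2 = k 2 3"
    "k' 1 0 = k' 0 1" "k' 2 0 = k' 0 2" "k' 3 0 = k' 0 3" "k' 2 1 = k' 1 2" "k' 3 1 = k' 1 3" "k' 3 2 = k' 2 3"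
    unfolding k_def k'_def by (rule D1(2) D2(2))+
  have V: "k 0 1 = w$1 + t$1 + s/12" "k 0 2 = w$2 + t$2 + s/12" "k 0 3 = w$3 + t$3 + s/12"
    "k 2 3 = w$1 - t$1 + s/12" "k 1 3 = w$2 - t$2 + s/12" "k 1 2 = w$3 - t$3 + s/12"
    unfolding k_def by (rule D1(4-9))+
  have V': "k' 0 1 = w'$1 + t'$1 + s'/12" "k' 0 2 = w'$2 + t'$2 + s'/12" "k' 0 3 = w'$3 + t'$3 + s'/12"
    "k' 2 3 = w'$1 - t'$1 + s'/12" "k' 1 3 = w'$2 - t'$2 + s'/12" "k' 1 2 = w'$3 - t'$3 + s'/12"
    unfolding k'_def by (rule D2(4-9))+
  have w3: "w$3 = - w$1 - w$2" "w'$3 = - w'$1 - w'$2" using D1(10) D2(10) by auto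
  have \<rho>: "\<rho> 0 = t$1 + t$2 + t$3 + s/4" "\<rho> 1 = t$1 - t$2 - t$3 + s/4" "\<rho> 2 = t$2 - t$1 - t$3 + s/4" "\<rho> 3 = t$3 - t$1 - t$2 + s/4"
    unfolding \<rho>_def sum_lessThan_4 K V kk w3 by simp_all
  have \<rho>': "\<rho>' 0 = t'$1 + t'$2 + t'$3 + s'/4" "\<rho>' 1 = t'$1 - t'$2 - t'$3 + s'/4" "\<rho>' 2 = t'$2 - t'$1 - t'$3 + s'/4" "\<rho>' 3 = t'$3 - t'$1 - t'$2 + s'/4"
    unfolding \<rho>'_def sum_lessThan_4 K V' kk' w3 by simp_all
  have s: "s = s'"
    using \<rho>_sum[of "\<lambda>x. x"] unfolding sum_lessThan_4 \<rho> \<rho>' by simp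
  \<comment> \<open>The squares t_j^2 lose the product of the signs; the third power sum of the
    trace-free Ricci eigenvalues retains it.\<close>
  have "(\<Sum>m<4. (\<rho> m - s/4)^3) = 24 * (t$1 * t$2 * t$3)" "(\<Sum>m<4. (\<rho>' m - s/4)^3) = 24 * (t'$1 * t'$2 * t'$3)"
    unfolding sum_lessThan_4 \<rho> \<rho>' s by (simp_all, algebra+)
  then have prod: "t'$1 * t'$2 * t'$3 = t$1 * t$2 * t$3"
    using \<rho>_sum[of "\<lambda>x. (x - s/4)^3"] by simp
  have count: "(\<Sum>j\<in>UNIV. if (w$j, (t$j)\<^sup>2) = y then 1 else 0 :: real) = (\<Sum>j\<in>UNIV. if (w'$j, (t'$j)\<^sup>2) = y then 1 else 0)" for y
  proof -
    define h where "h = (\<lambda>a b :: real. if (a, b\<^sup>2) = y then 1 else 0 :: real)"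
    \<comment> \<open>\<open>g\<close> decodes the labels of a pair (m, n): k_mn = w_j + u + s/12
      and \<rho>_m + \<rho>_n = 2 u + s/2, where u is t_j or -t_j, so both u and w_j are recovered.
      \<open>h\<close> depends on u only through u^2.\<close>
    define g where "g = (\<lambda>a b. h (a - s/12 - (b - s/2) / 2) ((b - s/2) / 2))"
    have hneg: "h a (- b) = h a b" for a b by (simp add: h_def)
    have g1: "g (w$i + t$i + s/12) (2 * t$i + s/2) = h (w$i) (t$i)" "g (w$i - t$i + s/12) (- 2 * t$i + s/2) = h (w$i) (t$i)"
      for w t and i :: 3
      using hneg[of "w$i" "t$i"] by (simp_all add: g_def)
    \<comment> \<open>Each j belongs to two complementary pairs, each taken in two orders with
      weight 2, whence the factor 8.\<close>
    have sums: "(\<Sum>m<4. \<Sum>n<4. if m = n then 0 else 2 * g (K m n) (r m + r n)) = 8 * (\<Sum>j\<in>UNIV. h (w$j) (t$j))"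
      if "K 1 0 = K 0 1" "K 2 0 = K 0 2" "K 3 0 = K 0 3" "K 2 1 = K 1 2" "K 3 1 = K 1 3" "K 3 2 = K 2 3"
        "K 0 1 = w$1 + t$1 + s/12" "K 0 2 = w$2 + t$2 + s/12" "K 0 3 = w$3 + t$3 + s/12"
        "K 2 3 = w$1 - t$1 + s/12" "K 1 3 = w$2 - t$2 + s/12" "K 1 2 = w$3 - t$3 + s/12"
        "r 0 = t$1 + t$2 + t$3 + s/4" "r 1 = t$1 - t$2 - t$3 + s/4" "r 2 = t$2 - t$1 - t$3 + s/4" "r 3 = t$3 - t$1 - t$2 + s/4"
      for K :: "nat \<Rightarrow> nat \<Rightarrow> real" and r and w t :: "real^3"
    proof -
      have r: "r 0 + r 1 = 2 * t$1 + s/2" "r 0 + r 2 = 2 * t$2 + s/2" "r 0 + r 3 = 2 * t$3 + s/2"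
        "r 2 + r 3 = - 2 * t$1 + s/2" "r 1 + r 3 = - 2 * t$2 + s/2" "r 1 + r 2 = - 2 * t$3 + s/2"
        "r 1 + r 0 = 2 * t$1 + s/2" "r 2 + r 0 = 2 * t$2 + s/2" "r 3 + r 0 = 2 * t$3 + s/2"
        "r 3 + r 2 = - 2 * t$1 + s/2" "r 3 + r 1 = - 2 * t$2 + s/2" "r 2 + r 1 = - 2 * t$3 + s/2"
        unfolding that(13-16) by simp_all
      show ?thesis
        unfolding sum_lessThan_4 sum_3 r that(1-12) g1 by simp
    qed
    have "8 * (\<Sum>j\<in>UNIV. h (w'$j) (t'$j)) = 8 * (\<Sum>j\<in>UNIV. h (w$j) (t$j))"
      using label_sum[of g] sums[of k w t \<rho>, OF K(1-6) V \<rho>] sums[of k' w' t' \<rho>', OF K(7-12) V'[folded s] \<rho>'[folded s]]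
      by simp
    then show ?thesis by (simp add: h_def)
  qed
  obtain \<sigma> where \<sigma>: "\<sigma> permutes UNIV" "\<And>j. (w$j, (t$j)\<^sup>2) = (w'$\<sigma> j, (t'$\<sigma> j)\<^sup>2)"
    using permutation_from_counts[of "\<lambda>j. (w$j, (t$j)\<^sup>2)" "\<lambda>j. (w'$j, (t'$j)\<^sup>2)", OF count] by blast
  have "t'$\<sigma> 1 * t'$\<sigma> 2 * t'$\<sigma> 3 = t$1 * t$2 * t$3"
    using permutes_3_cases[OF \<sigma>(1)] prod by (auto simp: mult_ac)
  then obtain \<eta> where "\<eta> \<in> signs" "\<eta> 1 * \<eta> 2 * \<eta> 3 = 1" "\<And>j. t'$\<sigma> j = \<eta> j * t$j"
    using \<sigma>(2) by (elim adjust_signs[of "\<lambda>j. t'$\<sigma> j" "\<lambda>j. t$j", rotated]) auto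
  then have "data_equiv w t w' t'" unfolding data_equiv_def using \<sigma> by (intro exI[of _ \<sigma>] exI[of _ \<eta>]) auto
  then show ?thesis using s by blast
qed

end


section \<open>Isometries realising equivalent data, and the effect of scale and shift\<close>

context orthonormal_frame
begin

lemma permuted_tensors_isometric:
  assumes R: "R = diag_form (sec R)" and R': "R' = diag_form (sec R')"
    and \<tau>: "bij_betw \<tau> {..<4} {..<4}"
    and sec: "\<And>i j. \<lbrakk>i < 4; j < 4\<rbrakk> \<Longrightarrow> sec R' i j = sec R (\<tau> i) (\<tau> j)"
  shows "isometric_tensors R R'"
proof -
  interpret f: orthonormal_frame "e \<circ> \<tau>"
    by (rule orthonormal_frame_permute[OF _ \<tau>]) unfold_locales
  define \<phi> where "\<phi> = (\<lambda>v. \<Sum>i<4. (v \<bullet> e i) *\<^sub>R (e \<circ> \<tau>) i)"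
  have \<phi>e: "\<phi> v \<bullet> e (\<tau> i) = v \<bullet> e i" if "i < 4" for v i
    using f.inner_combination[OF that] by (simp add: \<phi>_def)
  have "linear \<phi>"
    by (rule linearI) (simp_all add: \<phi>_def inner_add_left scaleR_left_distrib sum.distrib scaleR_sum_right)
  moreover have "\<phi> v \<bullet> \<phi> w = v \<bullet> w" for v w
    using f.inner_frame[of "\<phi> v" "\<phi> w"] inner_frame[of v w] by (simp add: \<phi>e)
  ultimately have "orthogonal_transformation \<phi>" by (simp add: orthogonal_transformation_def)
  moreover have "R' = pullback_tensor \<phi> R"
  proof (intro ext)
    fix a b c d
    have "R' a b c d = f.diag_form (\<lambda>i j. sec R (\<tau> i) (\<tau> j)) (\<phi> a) (\<phi> b) (\<phi> c) (\<phi> d)"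
      by (subst R') (simp add: diag_form_def f.diag_form_def sec \<phi>e)
    also have "\<dots> = R (\<phi> a) (\<phi> b) (\<phi> c) (\<phi> d)"
      unfolding diag_form_permute[OF \<tau>] R[symmetric] ..
    finally show "R' a b c d = pullback_tensor \<phi> R a b c d" by (simp add: pullback_tensor_def)
  qed
  ultimately show ?thesis unfolding isometric_tensors_def by blast
qed

text \<open>Renumbering the frame suffices. S_4 permutes the three splittings of {0, 1, 2, 3} into
  two pairs, and with them the w_j; a double transposition keeps every splitting but exchanges the
  pairs in two of them, which reverses two of the t_j. For each \<sigma>, four numberings give the
  four even sign patterns.\<close>

lemma data_equiv_imp_isometric:
  assumes D: "diagonal_curvature_tensor e R w t s" and D': "diagonal_curvature_tensor e R' w' t' s"
    and equiv: "data_equiv w t w' t'"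
  shows "isometric_tensors R R'"
proof -
  note D1 = diagonal_curvature_tensorD[OF D] and D2 = diagonal_curvature_tensorD[OF D']
  have isometric: "isometric_tensors R R'"
    if "distinct [p, q, r, u] \<and> p < 4 \<and> q < 4 \<and> r < 4 \<and> u < 4 \<and>
      sec R' 0 1 = sec R p q \<and> sec R' 0 2 = sec R p r \<and> sec R' 0 3 = sec R p u \<and>
      sec R' 1 2 = sec R q r \<and> sec R' 1 3 = sec R q u \<and> sec R' 2 3 = sec R r u" for p q r u
  proof (rule permuted_tensors_isometric[OF D1(1) D2(1), where \<tau> = "vec4 p q r u"])
    show "bij_betw (vec4 p q r u) {..<4} {..<4}" by (rule bij_vec4) (use that in auto)
    have sym: "sec R' 1 0 = sec R' 0 1" "sec R' 2 0 = sec R' 0 2" "sec R' 3 0 = sec R' 0 3"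
      "sec R' 2 1 = sec R' 1 2" "sec R' 3 1 = sec R' 1 3" "sec R' 3 2 = sec R' 2 3"
      "sec R q p = sec R p q" "sec R r p = sec R p r" "sec R u p = sec R p u"
      "sec R r q = sec R q r" "sec R u q = sec R q u" "sec R u r = sec R r u"
      by (rule D1(2) D2(2))+
    fix i j :: nat assume ij: "i < 4" "j < 4"
    show "sec R' i j = sec R (vec4 p q r u i) (vec4 p q r u j)"
      using less_4_cases[OF ij(1)] less_4_cases[OF ij(2)] that sym[unfolded One_nat_def]
      by (elim disjE; simp add: D1(3) D2(3))
  qed
  obtain \<sigma> \<eta> where \<sigma>: "\<sigma> permutes UNIV" "\<eta> \<in> signs" and \<eta>: "\<eta> 1 * \<eta> 2 * \<eta> 3 = 1"
    and data: "\<And>j. w'$\<sigma> j = w$j" "\<And>j. t'$\<sigma> j = \<eta> j * t$j"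
    using equiv unfolding data_equiv_def by blast
  have K: "sec R 0 1 = w$1 + t$1 + s/12" "sec R 0 2 = w$2 + t$2 + s/12" "sec R 0 3 = w$3 + t$3 + s/12"
    "sec R 2 3 = w$1 - t$1 + s/12" "sec R 1 3 = w$2 - t$2 + s/12" "sec R 1 2 = w$3 - t$3 + s/12"
    "sec R 1 0 = w$1 + t$1 + s/12" "sec R 2 0 = w$2 + t$2 + s/12" "sec R 3 0 = w$3 + t$3 + s/12"
    "sec R 3 2 = w$1 - t$1 + s/12" "sec R 3 1 = w$2 - t$2 + s/12" "sec R 2 1 = w$3 - t$3 + s/12"
    using D1(4-9) D1(2)[of 1 0] D1(2)[of 2 0] D1(2)[of 3 0] D1(2)[of 3 2] D1(2)[of 3 1] D1(2)[of 2 1] by auto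
  have "\<eta> 1 = 1 \<or> \<eta> 1 = -1" "\<eta> 2 = 1 \<or> \<eta> 2 = -1" "\<eta> 3 = 1 \<or> \<eta> 3 = -1"
    by (rule signsD(1)[OF \<sigma>(2)])+
  then consider "\<eta> 1 = 1" "\<eta> 2 = 1" "\<eta> 3 = 1" | "\<eta> 1 = 1" "\<eta> 2 = -1" "\<eta> 3 = -1"
    | "\<eta> 1 = -1" "\<eta> 2 = 1" "\<eta> 3 = -1" | "\<eta> 1 = -1" "\<eta> 2 = -1" "\<eta> 3 = 1"
    using \<eta> by (elim disjE) auto
  then have signs: "t'$\<sigma> 1 = t$1 \<and> t'$\<sigma> 2 = t$2 \<and> t'$\<sigma> 3 = t$3
    \<or> t'$\<sigma> 1 = t$1 \<and> t'$\<sigma> 2 = - t$2 \<and> t'$\<sigma> 3 = - t$3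
    \<or> t'$\<sigma> 1 = - t$1 \<and> t'$\<sigma> 2 = t$2 \<and> t'$\<sigma> 3 = - t$3
    \<or> t'$\<sigma> 1 = - t$1 \<and> t'$\<sigma> 2 = - t$2 \<and> t'$\<sigma> 3 = t$3"
    by cases (simp_all add: data)
  have w': "w'$\<sigma> 1 = w$1" "w'$\<sigma> 2 = w$2" "w'$\<sigma> 3 = w$3" by (rule data(1))+
  note K' = D2(4-9)
  have "\<sigma> 1 = 1 \<and> \<sigma> 2 = 2 \<and> \<sigma> 3 = 3 \<or> \<sigma> 1 = 1 \<and> \<sigma> 2 = 3 \<and> \<sigma> 3 = 2
    \<or> \<sigma> 1 = 2 \<and> \<sigma> 2 = 1 \<and> \<sigma> 3 = 3 \<or> \<sigma> 1 = 2 \<and> \<sigma> 2 = 3 \<and> \<sigma> 3 = 1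
    \<or> \<sigma> 1 = 3 \<and> \<sigma> 2 = 1 \<and> \<sigma> 3 = 2 \<or> \<sigma> 1 = 3 \<and> \<sigma> 2 = 2 \<and> \<sigma> 3 = 1"
    using permutes_3_cases[OF \<sigma>(1)] by auto
  then show ?thesis
  proof (elim disjE conjE)
    assume "\<sigma> 1 = 1" "\<sigma> 2 = 2" "\<sigma> 3 = 3"
    then show ?thesis
      using signs w' isometric[of 0 1 2 3] isometric[of 1 0 3 2] isometric[of 2 3 0 1] isometric[of 3 2 1 0]
      by (elim disjE) (simp_all add: K'[unfolded One_nat_def] K[unfolded One_nat_def])
  next
    assume "\<sigma> 1 = 1" "\<sigma> 2 = 3" "\<sigma> 3 = 2"
    then show ?thesis
      using signs w' isometric[of 0 1 3 2] isometric[of 1 0 2 3] isometric[of 2 3 1 0] isometric[of 3 2 0 1]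
      by (elim disjE) (simp_all add: K'[unfolded One_nat_def] K[unfolded One_nat_def])
  next
    assume "\<sigma> 1 = 2" "\<sigma> 2 = 1" "\<sigma> 3 = 3"
    then show ?thesis
      using signs w' isometric[of 0 2 1 3] isometric[of 1 3 0 2] isometric[of 2 0 3 1] isometric[of 3 1 2 0]
      by (elim disjE) (simp_all add: K'[unfolded One_nat_def] K[unfolded One_nat_def])
  next
    assume "\<sigma> 1 = 2" "\<sigma> 2 = 3" "\<sigma> 3 = 1"
    then show ?thesis
      using signs w' isometric[of 0 3 1 2] isometric[of 1 2 0 3] isometric[of 2 1 3 0] isometric[of 3 0 2 1]
      by (elim disjE) (simp_all add: K'[unfolded One_nat_def] K[unfolded One_nat_def])
  next
    assume "\<sigma> 1 = 3" "\<sigma> 2 = 1" "\<sigma> 3 = 2"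
    then show ?thesis
      using signs w' isometric[of 0 2 3 1] isometric[of 1 3 2 0] isometric[of 2 0 1 3] isometric[of 3 1 0 2]
      by (elim disjE) (simp_all add: K'[unfolded One_nat_def] K[unfolded One_nat_def])
  next
    assume "\<sigma> 1 = 3" "\<sigma> 2 = 2" "\<sigma> 3 = 1"
    then show ?thesis
      using signs w' isometric[of 0 3 2 1] isometric[of 1 2 3 0] isometric[of 2 1 0 3] isometric[of 3 0 1 2]
      by (elim disjE) (simp_all add: K'[unfolded One_nat_def] K[unfolded One_nat_def])
  qed
qed

lemma constant_curvature_frame:
  assumes "i < 4" "j < 4" "m < 4" "n < 4"
  shows "constant_curvature_tensor (e i) (e j) (e m) (e n)
    = (if i = m then 1 else 0) * (if j = n then 1 else 0) - (if i = n then 1 else 0) * (if j = m then 1 else 0)"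
  unfolding constant_curvature_tensor_def using assms by (simp add: orthonormal)

text \<open>The constant curvature tensor has all k_ij = 1, so it shifts s/12 by m and s by 12
  m.\<close>

lemma diagonal_curvature_tensor_affine:
  assumes D: "diagonal_curvature_tensor e R w t s"
  shows "diagonal_curvature_tensor e (\<lambda>x y z u. c * R x y z u + m * constant_curvature_tensor x y z u)
    (c *\<^sub>R w) (c *\<^sub>R t) (c * s + 12 * m)"
proof -
  have R: "algebraic_curvature_tensor R" and diag: "diagonal_tensor e R"
    using D unfolding diagonal_curvature_tensor_def by blast+
  let ?Q = "\<lambda>x y z u. c * R x y z u + m * constant_curvature_tensor x y z u"
  have "algebraic_curvature_tensor ?Q"
    unfolding algebraic_curvature_tensor_def
  proof (intro conjI allI)
    note l = curvature_linear[OF R]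
    show "linear (\<lambda>a. ?Q a b' c' d')" "linear (\<lambda>b. ?Q a' b c' d')" "linear (\<lambda>c. ?Q a' b' c d')" "linear (\<lambda>d. ?Q a' b' c' d)"
      for a' b' c' d'
      by (rule linearI; simp add: linear_add[OF l(1)] linear_add[OF l(2)] linear_add[OF l(3)] linear_add[OF l(4)]
          linear_scale[OF l(1)] linear_scale[OF l(2)] linear_scale[OF l(3)] linear_scale[OF l(4)]
          constant_curvature_tensor_def inner_add_left inner_add_right algebra_simps)+
    note sym = curvature_symmetries[OF R]
    show "?Q b' a' c' d' = - ?Q a' b' c' d'" for a' b' c' d'
      unfolding sym(1)[of b' a'] by (simp add: constant_curvature_tensor_def algebra_simps)
    show "?Q a' b' d' c' = - ?Q a' b' c' d'" for a' b' c' d'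
      unfolding sym(2)[of a' b' d' c'] by (simp add: constant_curvature_tensor_def algebra_simps)
    show "?Q c' d' a' b' = ?Q a' b' c' d'" for a' b' c' d'
      unfolding sym(3)[of c' d' a' b'] by (simp add: constant_curvature_tensor_def inner_commute algebra_simps)
    show "?Q a' b' c' d' + ?Q a' c' d' b' + ?Q a' d' b' c' = 0" for a' b' c' d'
    proof -
      have "R a' b' c' d' + R a' c' d' b' + R a' d' b' c' = 0"
        using R unfolding algebraic_curvature_tensor_def by blast
      then have "c * (R a' b' c' d' + R a' c' d' b' + R a' d' b' c') = 0" by simp
      then show ?thesis by (simp add: constant_curvature_tensor_def inner_commute algebra_simps)
    qed
  qed
  moreover have "diagonal_tensor e ?Q"
    unfolding diagonal_tensor_def
  proof (intro allI impI)
    fix i j k l :: nat assume ijkl: "i < 4" "j < 4" "k < 4" "l < 4" "{i, j} \<noteq> {k, l}"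
    then have "\<not> (i = k \<and> j = l)" "\<not> (i = l \<and> j = k)" by auto
    then have "constant_curvature_tensor (e i) (e j) (e k) (e l) = 0"
      using ijkl by (auto simp: constant_curvature_frame)
    moreover have "R (e i) (e j) (e k) (e l) = 0" using diag ijkl unfolding diagonal_tensor_def by blast
    ultimately show "?Q (e i) (e j) (e k) (e l) = 0" by simp
  qed
  ultimately show ?thesis
    using D unfolding diagonal_curvature_tensor_def
    by (simp add: constant_curvature_frame add_divide_distrib distrib_left right_diff_distrib)
       (simp add: distrib_left[symmetric])
qed

lemma isometric_iff:
  assumes D: "diagonal_curvature_tensor e R w t s" and D': "diagonal_curvature_tensor e R' w' t' s'"
  shows "isometric_tensors R R' \<longleftrightarrow> s = s' \<and> (\<exists>P \<in> carrier octahedral_group.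
    assoc_matrix w' t' = perm_sign P *\<^sub>R conj_matrix P (assoc_matrix w t))"
  unfolding assoc_matrix_equiv_iff[OF diagonal_curvature_tensorD(10)[OF D] diagonal_curvature_tensorD(10)[OF D']]
proof
  show "s = s' \<and> data_equiv w t w' t'" if "isometric_tensors R R'"
    using that isometric_imp_data_equiv[OF D D'] unfolding isometric_tensors_def by blast
  show "isometric_tensors R R'" if "s = s' \<and> data_equiv w t w' t'"
    using data_equiv_imp_isometric[OF D, of R' w' t'] D' that by blast
qed

text \<open>For every scale c the choice m = (s' - c s)/12 matches the scalar curvatures, so only
  the matrices remain to be compared, and \<open>perm_sign P\<close> is absorbed into the
  scale.\<close>

lemma projectively_isometric_iff:
  assumes D: "diagonal_curvature_tensor e R w t s" and D': "diagonal_curvature_tensor e R' w' t' s'"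
  shows "projectively_isometric_tensors R R' \<longleftrightarrow>
    span {assoc_matrix w' t'} \<in> orbit octahedral_group conj_point (span {assoc_matrix w t})"
proof -
  define Q where "Q = (\<lambda>c m x y z u. c * R x y z u + m * constant_curvature_tensor x y z u)"
  have "projectively_isometric_tensors R R' \<longleftrightarrow> (\<exists>c m. c \<noteq> 0 \<and> isometric_tensors (Q c m) R')"
  proof -
    have pull: "(\<lambda>x y z u. c * pullback_tensor \<phi> R x y z u + m * constant_curvature_tensor x y z u) = pullback_tensor \<phi> (Q c m)"
      if "orthogonal_transformation \<phi>" for \<phi> :: "'a \<Rightarrow> 'a" and c m
      using that by (simp add: fun_eq_iff Q_def pullback_tensor_def constant_curvature_tensor_def orthogonal_transformation_def)
    have "(\<exists>\<phi>. orthogonal_transformation \<phi> \<and> c \<noteq> 0 \<and>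
        R' = (\<lambda>x y z u. c * pullback_tensor \<phi> R x y z u + m * constant_curvature_tensor x y z u))
      \<longleftrightarrow> c \<noteq> 0 \<and> isometric_tensors (Q c m) R'" for c m
      unfolding isometric_tensors_def by (auto simp: pull cong: conj_cong)
    then show ?thesis unfolding projectively_isometric_tensors_def by blast
  qed
  also have "\<dots> \<longleftrightarrow> (\<exists>c m. c \<noteq> 0 \<and> c * s + 12 * m = s' \<and> (\<exists>P \<in> carrier octahedral_group.
    assoc_matrix w' t' = perm_sign P *\<^sub>R conj_matrix P (c *\<^sub>R assoc_matrix w t)))"
  proof -
    have "assoc_matrix (c *\<^sub>R w) (c *\<^sub>R t) = c *\<^sub>R assoc_matrix w t" for c
      by (simp add: assoc_matrix_def matrix_form_def vec_eq_iff forall_3 algebra_simps)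
    then show ?thesis
      using isometric_iff[OF diagonal_curvature_tensor_affine[OF D] D'] unfolding Q_def by simp
  qed
  also have "\<dots> \<longleftrightarrow> (\<exists>P \<in> carrier octahedral_group. \<exists>c. c \<noteq> 0 \<and> assoc_matrix w' t' = c *\<^sub>R conj_matrix P (assoc_matrix w t))"
  proof
    assume "\<exists>c m. c \<noteq> 0 \<and> c * s + 12 * m = s' \<and> (\<exists>P \<in> carrier octahedral_group.
      assoc_matrix w' t' = perm_sign P *\<^sub>R conj_matrix P (c *\<^sub>R assoc_matrix w t))"
    then obtain c P where "c \<noteq> 0" and P: "P \<in> carrier octahedral_group"
      and "assoc_matrix w' t' = perm_sign P *\<^sub>R conj_matrix P (c *\<^sub>R assoc_matrix w t)" by blast
    then have "assoc_matrix w' t' = (perm_sign P * c) *\<^sub>R conj_matrix P (assoc_matrix w t)"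
      by (simp add: linear_scale[OF linear_conj_matrix])
    moreover have "perm_sign P \<noteq> 0"
      using P perm_sign_signed_perm(1) unfolding carrier_octahedral_group by force
    ultimately show "\<exists>P \<in> carrier octahedral_group. \<exists>c. c \<noteq> 0 \<and> assoc_matrix w' t' = c *\<^sub>R conj_matrix P (assoc_matrix w t)"
      using P \<open>c \<noteq> 0\<close> by (intro bexI[of _ P] exI[of _ "perm_sign P * c"]) auto
  next
    assume "\<exists>P \<in> carrier octahedral_group. \<exists>c. c \<noteq> 0 \<and> assoc_matrix w' t' = c *\<^sub>R conj_matrix P (assoc_matrix w t)"
    then obtain c P where "c \<noteq> 0" and P: "P \<in> carrier octahedral_group"
      and eq: "assoc_matrix w' t' = c *\<^sub>R conj_matrix P (assoc_matrix w t)" by blast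
    have "perm_sign P = 1 \<or> perm_sign P = -1"
      using P perm_sign_signed_perm(1) unfolding carrier_octahedral_group by blast
    then have "perm_sign P * (perm_sign P * c) = c" "perm_sign P * c \<noteq> 0" using \<open>c \<noteq> 0\<close> by auto
    then have eq': "assoc_matrix w' t' = perm_sign P *\<^sub>R conj_matrix P ((perm_sign P * c) *\<^sub>R assoc_matrix w t)"
      by (simp add: eq linear_scale[OF linear_conj_matrix])
    obtain d where d: "d = perm_sign P * c" by blast
    show "\<exists>c m. c \<noteq> 0 \<and> c * s + 12 * m = s' \<and> (\<exists>P \<in> carrier octahedral_group.
      assoc_matrix w' t' = perm_sign P *\<^sub>R conj_matrix P (c *\<^sub>R assoc_matrix w t))"
    proof (rule exI[of _ d], rule exI[of _ "(s' - d * s) / 12"], intro conjI)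
      show "d \<noteq> 0" using \<open>perm_sign P * c \<noteq> 0\<close> by (simp add: d)
      show "d * s + 12 * ((s' - d * s) / 12) = s'" by (simp add: field_simps)
      show "\<exists>P \<in> carrier octahedral_group. assoc_matrix w' t' = perm_sign P *\<^sub>R conj_matrix P (d *\<^sub>R assoc_matrix w t)"
        unfolding d using P eq' by blast
    qed
  qed
  also have "\<dots> \<longleftrightarrow> span {assoc_matrix w' t'} \<in> orbit octahedral_group conj_point (span {assoc_matrix w t})"
    unfolding orbit_def conj_point_span span_singleton_eq_iff[symmetric] by blast
  finally show ?thesis .
qed

end

theorem theorem1p14:
  fixes e :: "nat \<Rightarrow> 'a::euclidean_space"
  assumes dim4: "DIM('a) = 4"
    and orthonormal: "\<forall>i<4. \<forall>j<4. e i \<bullet> e j = (if i = j then 1 else 0)"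
  shows
    "(\<forall>(K :: 'a tensor_field2) R w t s.
        killing_tensor K \<and> diagonal_curvature_tensor e R w t s \<and> corresponds K R \<longrightarrow>
        (integrable_tensor K \<longleftrightarrow> trace (assoc_matrix w t) = 0 \<and> det (assoc_matrix w t) = 0))
     \<and> subspace matrix_space \<and> dim matrix_space = 5
     \<and> projective_variety matrix_space integrable_variety
     \<and> octahedral_group \<cong> sym_group 4
     \<and> group_action octahedral_group (projectivisation matrix_space)
         (\<lambda>P. restrict (conj_point P) (projectivisation matrix_space))
     \<and> group_action octahedral_group integrable_variety
         (\<lambda>P. restrict (conj_point P) integrable_variety)
     \<and> (\<forall>(R :: 'a tensor4) R' w t s w' t' s'.
          diagonal_curvature_tensor e R w t s \<and> diagonal_curvature_tensor e R' w' t' s' \<longrightarrow>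
          (projectively_isometric_tensors R R' \<longleftrightarrow>
             span {assoc_matrix w' t'} \<in> orbit octahedral_group conj_point (span {assoc_matrix w t})))
     \<and> (\<forall>(R :: 'a tensor4) R' w t s w' t' s'.
          diagonal_curvature_tensor e R w t s \<and> diagonal_curvature_tensor e R' w' t' s' \<longrightarrow>
          (isometric_tensors R R' \<longleftrightarrow>
             s = s' \<and> (\<exists>P \<in> carrier octahedral_group.
               assoc_matrix w' t' = perm_sign P *\<^sub>R conj_matrix P (assoc_matrix w t))))"
proof -
  interpret orthonormal_frame e
    by unfold_locales (use dim4 orthonormal in auto)
  have integrable: "integrable_tensor K \<longleftrightarrow> trace (assoc_matrix w t) = 0 \<and> det (assoc_matrix w t) = 0"
    if "diagonal_curvature_tensor e R w t s" "corresponds K R" for K R w t s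
    using integrable_imp_det_zero[OF that] det_zero_imp_integrable[OF that] trace_assoc_matrix by metis
  show ?thesis
    by (intro conjI allI impI; (elim conjE)?;
        rule integrable subspace_matrix_space dim_matrix_space projective_variety_integrable_variety
          octahedral_group_iso group_actions_conj_point projectively_isometric_iff isometric_iff; assumption)
qed

end
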